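(* Let $X$ be a uniformly contractible proper metric space with finite asymptotic dimension, $\operatorname{asdim} X<\infty$, and let $\bar X=X\cup\nu X$ be its Higson compactification. Then $\check H^{n}(\bar X;\mathbb Z_p)=0$ for all $n\ge 1$ and all primes $p$, where $\check H^*$ denotes Čech cohomology and $\mathbb Z_p=\mathbb Z/p\mathbb Z$.
   Context: A metric space is proper if every closed ball $B_r(x)$ is compact. A metric space $X$ is uniformly contractible if there is a function $S:\mathbb R_+\to\mathbb R_+$ such that every ball $B_r(x)$ is contractible to a point inside the ball $B_{S(r)}(x)$. The asymptotic dimension satisfies $\operatorname{asdim}X\le n$ if for every $d>0$ there is a uniformly bounded open cover of $X$ with multiplicity $\le n+1$ and Lebesgue number $\ge d$. The Higson compactification $\bar X=X\cup\nu X$ of a proper metric space $X$ is the compactification determined by the ring of bounded continuous functions with gradient tending to zero at infinity, i.e. bounded continuous $f$ such that for every $R>0$ the diameter of $f(B_R(x))$ tends to $0$ as $x\to\infty$. Equivalently, a continuous map $f:X\to Z$ to a compact metric space extends over $\nu X$ if and only if for every $R$, $\operatorname{diam} f(B_R(x))\to 0$ as $x\to\infty$. The remainder $\nu X$ is called the Higson corona. *)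

theory Defs
  imports "HOL-Analysis.Analysis" "HOL-Algebra.Product_Groups" "HOL-Algebra.FiniteProduct"
    "HOL-Library.Extended_Nat"
begin

section \<open>Coarse geometry of metric spaces\<close>

definition proper_metric :: "'a metric \<Rightarrow> bool" where
  "proper_metric X \<longleftrightarrow> (\<forall>x\<in>mspace X. \<forall>r. compactin (mtopology_of X) (mcball_of X x r))"

text \<open>The closed ball around \<open>x\<close> of radius \<open>r\<close> is contractible to a point inside the closed ball
  of radius \<open>S r\<close>: the inclusion map is homotopic to a constant map, as maps into the bigger ball.\<close>

definition uniformly_contractible :: "'a metric \<Rightarrow> bool" where
  "uniformly_contractible X \<longleftrightarrow>
     (\<exists>S :: real \<Rightarrow> real. (\<forall>r\<ge>0. S r \<ge> 0) \<and>
       (\<forall>r\<ge>0. \<forall>x\<in>mspace X. \<exists>c.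
          homotopic_with (\<lambda>_. True)
            (subtopology (mtopology_of X) (mcball_of X x r))
            (subtopology (mtopology_of X) (mcball_of X x (S r)))
            (\<lambda>y. y) (\<lambda>_. c)))"

definition open_covers :: "'b topology \<Rightarrow> 'b set set set" where
  "open_covers T = {\<U>. (\<forall>U\<in>\<U>. openin T U) \<and> \<Union>\<U> = topspace T}"

definition uniformly_bounded :: "'a metric \<Rightarrow> 'a set set \<Rightarrow> bool" where
  "uniformly_bounded X \<U> \<longleftrightarrow> (\<exists>D. \<forall>U\<in>\<U>. \<forall>x\<in>U. \<forall>y\<in>U. mdist X x y \<le> D)"

definition multiplicity_le :: "'a metric \<Rightarrow> 'a set set \<Rightarrow> nat \<Rightarrow> bool" where
  "multiplicity_le X \<U> m \<longleftrightarrow>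
     (\<forall>x\<in>mspace X. finite {U\<in>\<U>. x \<in> U} \<and> card {U\<in>\<U>. x \<in> U} \<le> m)"

text \<open>Every subset of diameter less than \<open>d\<close> is contained in a single member of the cover.\<close>

definition lebesgue_number_ge :: "'a metric \<Rightarrow> 'a set set \<Rightarrow> real \<Rightarrow> bool" where
  "lebesgue_number_ge X \<U> d \<longleftrightarrow>
     (\<forall>A\<subseteq>mspace X. (\<exists>e<d. \<forall>x\<in>A. \<forall>y\<in>A. mdist X x y \<le> e) \<longrightarrow> (\<exists>U\<in>\<U>. A \<subseteq> U))"

definition asdim_le :: "'a metric \<Rightarrow> nat \<Rightarrow> bool" where
  "asdim_le X n \<longleftrightarrow>
     (\<forall>d>0. \<exists>\<U>\<in>open_covers (mtopology_of X).
        uniformly_bounded X \<U> \<and> multiplicity_le X \<U> (n + 1) \<and> lebesgue_number_ge X \<U> d)"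

definition asdim :: "'a metric \<Rightarrow> enat" where
  "asdim X = (INF n\<in>{n. asdim_le X n}. enat n)"


section \<open>The Higson compactification\<close>

text \<open>For a proper space, a point tends to infinity when it leaves every compact set.
  Restricting to extensional functions identifies functions that agree on the space.\<close>

definition higson_functions :: "'a metric \<Rightarrow> ('a \<Rightarrow> real) set" where
  "higson_functions X =
     {f \<in> extensional (mspace X).
        continuous_map (mtopology_of X) euclideanreal f \<and> bounded (f ` mspace X) \<and>
        (\<forall>R>0. \<forall>\<epsilon>>0. \<exists>K. compactin (mtopology_of X) K \<and>
           (\<forall>x\<in>mspace X - K. diameter (f ` mcball_of X x R) < \<epsilon>))}"

definition higson_embedding :: "'a metric \<Rightarrow> 'a \<Rightarrow> ('a \<Rightarrow> real) \<Rightarrow> real" where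
  "higson_embedding X x = (\<lambda>f\<in>higson_functions X. f x)"

text \<open>The compactification determined by the ring of Higson functions: the closure of the image of
  the space under the evaluation map into the product of lines indexed by these functions.\<close>

definition higson_compactification :: "'a metric \<Rightarrow> (('a \<Rightarrow> real) \<Rightarrow> real) topology" where
  "higson_compactification X =
     (let P = product_topology (\<lambda>_. euclideanreal) (higson_functions X)
      in subtopology P (P closure_of (higson_embedding X ` mspace X)))"

text \<open>For proper \<open>X\<close> this is indeed a Hausdorff compactification of \<open>X\<close>.\<close>

lemma topspace_higson_dense:
  "topspace (higson_compactification X) =
   higson_compactification X closure_of (higson_embedding X ` mspace X)"
proof -
  let ?P = "product_topology (\<lambda>_. euclideanreal) (higson_functions X)"
  let ?E = "higson_embedding X ` mspace X"
  have "?E \<subseteq> topspace ?P" by (auto simp: higson_embedding_def)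
  then have "?E \<subseteq> ?P closure_of ?E" by (rule closure_of_subset)
  moreover have "?P closure_of ?E \<subseteq> topspace ?P" by (rule closure_of_subset_topspace)
  ultimately show ?thesis
    unfolding higson_compactification_def Let_def
    by (simp add: closure_of_subtopology topspace_subtopology Int_absorb1)
qed

lemma Hausdorff_space_higson_compactification: "Hausdorff_space (higson_compactification X)"
  by (simp add: higson_compactification_def Let_def Hausdorff_space_subtopology
      Hausdorff_space_product_topology)

lemma compact_space_higson_compactification: "compact_space (higson_compactification X)"
proof -
  let ?P = "product_topology (\<lambda>_. euclideanreal) (higson_functions X)"
  let ?E = "higson_embedding X ` mspace X"
  have "\<forall>f\<in>higson_functions X. \<exists>b. \<forall>x\<in>mspace X. \<bar>f x\<bar> \<le> b"
    by (auto simp: higson_functions_def bounded_iff)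
  then obtain b where b: "\<And>f x. f \<in> higson_functions X \<Longrightarrow> x \<in> mspace X \<Longrightarrow> \<bar>f x\<bar> \<le> b f"
    by metis
  let ?B = "\<Pi>\<^sub>E f\<in>higson_functions X. {- b f..b f}"
  have comp: "compactin ?P ?B"
    by (auto simp: compactin_PiE)
  have "closedin ?P ?B" by (auto simp: closedin_product_topology)
  moreover have "?E \<subseteq> ?B"
    using b by (fastforce simp: higson_embedding_def abs_le_iff)
  ultimately have "?P closure_of ?E \<subseteq> ?B" by (simp add: closure_of_minimal)
  then have "compactin ?P (?P closure_of ?E)"
    using closed_compactin comp closedin_closure_of by blast
  then show ?thesis
    by (simp add: higson_compactification_def Let_def compact_space_subtopology)
qed

lemma higson_bump:
  fixes X :: "'a metric"
  assumes "proper_metric X" "x \<in> mspace X" "r > 0"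
  shows "(\<lambda>y\<in>mspace X. max 0 (r - mdist X x y)) \<in> higson_functions X" (is "?f \<in> _")
proof -
  interpret M: Metric_space "mspace X" "mdist X" by simp
  have "continuous_map (mtopology_of X) euclideanreal (\<lambda>y. max 0 (r - mdist X x y))"
    by (intro continuous_map_real_max continuous_map_diff continuous_on_mdist assms) simp_all
  moreover have "\<And>y. y \<in> topspace (mtopology_of X) \<Longrightarrow> max 0 (r - mdist X x y) = ?f y" by simp
  ultimately have c: "continuous_map (mtopology_of X) euclideanreal ?f"
    using continuous_map_eq[of "mtopology_of X" euclideanreal "\<lambda>y. max 0 (r - mdist X x y)" ?f] by blast
  have b: "bounded (?f ` mspace X)"
    unfolding bounded_iff by (rule exI[of _ r]) (use assms(3) in auto)
  have "\<exists>K. compactin (mtopology_of X) K \<and>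
           (\<forall>z\<in>mspace X - K. diameter (?f ` mcball_of X z R) < \<epsilon>)" if "R > 0" "\<epsilon> > 0" for R \<epsilon>
  proof (intro exI conjI ballI)
    show "compactin (mtopology_of X) (mcball_of X x (r + R))"
      using assms by (simp add: proper_metric_def)
    fix z assume z: "z \<in> mspace X - mcball_of X x (r + R)"
    have "?f y = 0" if "y \<in> mcball_of X z R" for y
    proof -
      have "mdist X z y \<le> R" "y \<in> mspace X" "mdist X x z > r + R" using that z assms(2) by auto
      then have "mdist X x y \<ge> r"
        using M.triangle[of x y z] M.commute[of y z] assms(2) z by auto
      with that show ?thesis by auto
    qed
    then have "?f ` mcball_of X z R \<subseteq> {0}" by (intro image_subsetI) (simp only: singleton_iff)
    then have "?f ` mcball_of X z R = {} \<or> ?f ` mcball_of X z R = {0}" by (rule subset_singletonD)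
    then show "diameter (?f ` mcball_of X z R) < \<epsilon>" using \<open>\<epsilon> > 0\<close> by (auto simp del: image_is_empty)
  qed
  with c b show ?thesis by (simp add: higson_functions_def)
qed

lemma embedding_map_higson_embedding:
  fixes X :: "'a metric"
  assumes "proper_metric X"
  shows "embedding_map (mtopology_of X) (higson_compactification X) (higson_embedding X)"
proof -
  interpret M: Metric_space "mspace X" "mdist X" by simp
  let ?P = "product_topology (\<lambda>_. euclideanreal) (higson_functions X)"
  let ?e = "higson_embedding X"
  let ?E = "?e ` mspace X"
  have EP: "?E \<subseteq> topspace ?P" by (auto simp: higson_embedding_def)
  have contP: "continuous_map (mtopology_of X) ?P ?e"
    unfolding continuous_map_componentwise
    by (auto simp: higson_embedding_def higson_functions_def)
  define bump where "bump x r = (\<lambda>y\<in>mspace X. max 0 (r - mdist X x y))" for x r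
  have bump: "bump x r \<in> higson_functions X" if "x \<in> mspace X" "r > 0" for x r
    using higson_bump[OF assms that] by (simp add: bump_def)
  have bv: "?e y (bump x r) = max 0 (r - mdist X x y)" 
    if "x \<in> mspace X" "r > 0" "y \<in> mspace X" for x y r
    using bump[OF that(1,2)] that(3) by (simp add: higson_embedding_def, simp add: bump_def)
  have inj: "inj_on ?e (mspace X)"
  proof (rule inj_onI, rule ccontr)
    fix x y assume xy: "x \<in> mspace X" "y \<in> mspace X" "?e x = ?e y" "x \<noteq> y"
    define r where "r = mdist X x y"
    have "r > 0" using xy unfolding r_def by simp
    then have "?e x (bump x r) = r" "?e y (bump x r) = 0"
      using bv[of x r x] bv[of x r y] xy by (auto simp: r_def)
    with xy \<open>r > 0\<close> show False by simp
  qed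
  have opn: "open_map (mtopology_of X) (subtopology ?P ?E) ?e"
    unfolding open_map_def
  proof (intro allI impI)
    fix U assume U: "openin (mtopology_of X) U"
    then have UX: "U \<subseteq> mspace X" using openin_subset by fastforce
    show "openin (subtopology ?P ?E) (?e ` U)"
    proof (subst openin_subopen, intro ballI)
      fix q assume "q \<in> ?e ` U"
      then obtain x where x: "x \<in> U" "q = ?e x" by blast
      then have xX: "x \<in> mspace X" using UX by blast
      obtain r where r: "r > 0" "M.mball x r \<subseteq> U"
        using U x(1) unfolding mtopology_of_def M.openin_mtopology by blast
      let ?T = "{z \<in> topspace ?P. z (bump x r) \<in> {0<..}} \<inter> ?E"
      have "openin ?P {z \<in> topspace ?P. z (bump x r) \<in> {0<..}}"
        by (rule openin_continuous_map_preimage[OF continuous_map_product_projection])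
           (use bump[OF xX r(1)] in auto)
      then have o: "openin (subtopology ?P ?E) ?T" by (auto simp: openin_subtopology)
      have "q \<in> ?T" using x xX r bv[OF xX r(1) xX] EP by auto
      moreover have "?T \<subseteq> ?e ` U"
      proof
        fix z assume z: "z \<in> ?T"
        then obtain y where y: "y \<in> mspace X" "z = ?e y" by blast
        with z have "mdist X x y < r" using bv[OF xX r(1) y(1)] by auto
        then have "y \<in> M.mball x r" using xX y by simp
        with r(2) y show "z \<in> ?e ` U" by blast
      qed
      ultimately show "\<exists>T. openin (subtopology ?P ?E) T \<and> q \<in> T \<and> T \<subseteq> ?e ` U" using o by blast
    qed
  qed
  have "homeomorphic_map (mtopology_of X) (subtopology ?P ?E) ?e"
  proof (rule bijective_open_imp_homeomorphic_map[OF _ opn])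
    show "continuous_map (mtopology_of X) (subtopology ?P ?E) ?e"
      using contP by (auto simp: continuous_map_in_subtopology)
  qed (use EP inj in auto)
  moreover have "?E \<subseteq> ?P closure_of ?E" using EP by (rule closure_of_subset)
  then have "?P closure_of ?E \<inter> ?E = ?E" by blast
  then have "subtopology (higson_compactification X) ?E = subtopology ?P ?E"
    unfolding higson_compactification_def Let_def subtopology_subtopology by (rule arg_cong)
  moreover have "topspace (mtopology_of X) = mspace X" by simp
  ultimately show ?thesis
    unfolding embedding_map_def by (simp only:)
qed


section \<open>Simplicial cohomology of an abstract simplicial complex\<close>

text \<open>A complex is given by its set of (finite, nonempty) simplices. Cochains are functions on
  ordered simplices, with repeated vertices allowed. As in \<^theory>\<open>HOL-Algebra.Group\<close>, the
  coefficient group \<open>G\<close> is written multiplicatively.\<close>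

definition ordered_simplices :: "nat \<Rightarrow> 'v set set \<Rightarrow> 'v list set" where
  "ordered_simplices n K = {\<sigma>. length \<sigma> = Suc n \<and> set \<sigma> \<in> K}"

definition face :: "nat \<Rightarrow> 'v list \<Rightarrow> 'v list" where
  "face i \<sigma> = take i \<sigma> @ drop (Suc i) \<sigma>"

definition cochain_group :: "nat \<Rightarrow> 'v set set \<Rightarrow> 'g monoid \<Rightarrow> ('v list \<Rightarrow> 'g) monoid" where
  "cochain_group n K G = product_group (ordered_simplices n K) (\<lambda>_. G)"

definition coboundary ::
    "nat \<Rightarrow> 'v set set \<Rightarrow> 'g monoid \<Rightarrow> ('v list \<Rightarrow> 'g) \<Rightarrow> ('v list \<Rightarrow> 'g)" where
  "coboundary n K G c =
     (\<lambda>\<sigma>\<in>ordered_simplices (Suc n) K.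
        \<Otimes>\<^bsub>G\<^esub>i\<in>{..Suc n}. c (face i \<sigma>) [^]\<^bsub>G\<^esub> ((-1) ^ i :: int))"

definition cocycles :: "nat \<Rightarrow> 'v set set \<Rightarrow> 'g monoid \<Rightarrow> ('v list \<Rightarrow> 'g) set" where
  "cocycles n K G = kernel (cochain_group n K G) (cochain_group (Suc n) K G) (coboundary n K G)"

definition coboundaries :: "nat \<Rightarrow> 'v set set \<Rightarrow> 'g monoid \<Rightarrow> ('v list \<Rightarrow> 'g) set" where
  "coboundaries n K G =
     (case n of 0 \<Rightarrow> {\<one>\<^bsub>cochain_group 0 K G\<^esub>}
      | Suc m \<Rightarrow> coboundary m K G ` carrier (cochain_group m K G))"

definition cohomology_group :: "nat \<Rightarrow> 'v set set \<Rightarrow> 'g monoid \<Rightarrow> ('v list \<Rightarrow> 'g) set monoid" where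
  "cohomology_group n K G =
     subgroup_generated (cochain_group n K G) (cocycles n K G) Mod coboundaries n K G"

definition cochain_pullback ::
    "nat \<Rightarrow> 'w set set \<Rightarrow> ('w \<Rightarrow> 'v) \<Rightarrow> ('v list \<Rightarrow> 'g) \<Rightarrow> ('w list \<Rightarrow> 'g)" where
  "cochain_pullback n L \<phi> c = (\<lambda>\<sigma>\<in>ordered_simplices n L. c (map \<phi> \<sigma>))"

text \<open>The map induced on cohomology by a simplicial map \<open>\<phi>\<close> into another complex and from \<open>L\<close>.
  All cochains \<open>c\<close> in the class \<open>A\<close> contribute the same coset to the union.\<close>

definition cohomology_induced ::
    "nat \<Rightarrow> 'w set set \<Rightarrow> 'g monoid \<Rightarrow> ('w \<Rightarrow> 'v) \<Rightarrow> ('v list \<Rightarrow> 'g) set \<Rightarrow> ('w list \<Rightarrow> 'g) set"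
  where
  "cohomology_induced n L G \<phi> A =
     (\<Union>c\<in>A. coboundaries n L G #>\<^bsub>cochain_group n L G\<^esub> cochain_pullback n L \<phi> c)"


section \<open>Direct limits of groups\<close>

text \<open>The limit of groups \<open>H i\<close> with transition maps \<open>\<phi> i j\<close> from \<open>H i\<close> to \<open>H j\<close> for \<open>prec i j\<close>, over
  an index set directed by \<open>prec\<close>. In the product and in the unit, all members of the respective
  unions are the same equivalence class.\<close>

definition direct_limit_rel ::
    "'i set \<Rightarrow> ('i \<Rightarrow> 'i \<Rightarrow> bool) \<Rightarrow> ('i \<Rightarrow> 'h monoid) \<Rightarrow> ('i \<Rightarrow> 'i \<Rightarrow> 'h \<Rightarrow> 'h)
      \<Rightarrow> (('i \<times> 'h) \<times> ('i \<times> 'h)) set" where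
  "direct_limit_rel I prec H \<phi> =
     {((i, a), (j, b)). i \<in> I \<and> j \<in> I \<and> a \<in> carrier (H i) \<and> b \<in> carrier (H j) \<and>
        (\<exists>k\<in>I. prec i k \<and> prec j k \<and> \<phi> i k a = \<phi> j k b)}"

definition direct_limit ::
    "'i set \<Rightarrow> ('i \<Rightarrow> 'i \<Rightarrow> bool) \<Rightarrow> ('i \<Rightarrow> 'h monoid) \<Rightarrow> ('i \<Rightarrow> 'i \<Rightarrow> 'h \<Rightarrow> 'h)
      \<Rightarrow> ('i \<times> 'h) set monoid" where
  "direct_limit I prec H \<phi> =
     (let R = direct_limit_rel I prec H \<phi> in
      \<lparr>carrier = (SIGMA i:I. carrier (H i)) // R,
       monoid.mult = (\<lambda>A B. \<Union>(i, a)\<in>A. \<Union>(j, b)\<in>B. \<Union>k\<in>{k\<in>I. prec i k \<and> prec j k}.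
                 R `` {(k, \<phi> i k a \<otimes>\<^bsub>H k\<^esub> \<phi> j k b)}),
       one = (\<Union>i\<in>I. R `` {(i, \<one>\<^bsub>H i\<^esub>)})\<rparr>)"


section \<open>Cech cohomology\<close>

definition nerve :: "'b set set \<Rightarrow> 'b set set set" where
  "nerve \<U> = {\<F>. finite \<F> \<and> \<F> \<noteq> {} \<and> \<F> \<subseteq> \<U> \<and> \<Inter>\<F> \<noteq> {}}"

definition cover_refines :: "'b set set \<Rightarrow> 'b set set \<Rightarrow> bool" where
  "cover_refines \<V> \<U> \<longleftrightarrow> (\<forall>V\<in>\<V>. \<exists>U\<in>\<U>. V \<subseteq> U)"

text \<open>Any two projections of a refinement are contiguous as maps of nerves, so the choice is
  irrelevant in cohomology.\<close>

definition refinement_projection :: "'b set set \<Rightarrow> 'b set set \<Rightarrow> 'b set \<Rightarrow> 'b set" where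
  "refinement_projection \<U> \<V> = (SOME \<pi>. \<forall>V\<in>\<V>. \<pi> V \<in> \<U> \<and> V \<subseteq> \<pi> V)"

definition cech_cohomology ::
    "nat \<Rightarrow> 'b topology \<Rightarrow> 'g monoid \<Rightarrow> ('b set set \<times> ('b set list \<Rightarrow> 'g) set) set monoid" where
  "cech_cohomology n T G =
     direct_limit (open_covers T) (\<lambda>\<U> \<V>. cover_refines \<V> \<U>)
       (\<lambda>\<U>. cohomology_group n (nerve \<U>) G)
       (\<lambda>\<U> \<V>. cohomology_induced n (nerve \<V>) G (refinement_projection \<U> \<V>))"

end

theory Submission
  imports Defs "HOL-Homology.Homology"
begin

text \<open>
  Restrict a cocycle \<open>c\<close> on an open cover of the Higson compactification to tuples of points of \<open>X\<close>:
  it is defined on all tuples that are small near a base point \<open>q\<close> but may be arbitrarily large near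
  infinity. Uniform contractibility fills any tuple, however large, by small singular simplices
  within a radius controlled by its diameter; comparing tuples with their fillings and coning the
  latter off from \<open>q\<close> shows that \<open>c\<close> is the coboundary of a cochain \<open>b\<close> on the tuples of a second,
  more slowly growing scale. As \<open>X\<close> need not be locally contractible, tiny tuples near \<open>q\<close> are
  compared with their fillings by discretised contractions of compact balls.

  The cochain \<open>b\<close> does not extend to the corona. But finite asymptotic dimension gives a cover of \<open>X\<close>
  of slowly growing scale and bounded multiplicity. Since the coefficients are finite, the simplices
  of its second barycentric subdivision carry only finitely many types, a type recording the values
  of \<open>b\<close> on all faces. The union of all pieces of one type has slowly oscillating bump functions, so
  these finitely many unions extend to an open cover of the compactification, and on it \<open>b\<close> becomes
  a Cech cochain bounding \<open>c\<close>.
\<close>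

section \<open>Chains of tuples\<close>

text \<open>Two requirements pull in opposite directions. To extend over the corona, sets have to
  grow without bound towards infinity, while a cocycle of a cover can be evaluated only on tuples
  that the cover regards as small. A \<open>slow_family\<close> records an admissible rate of
  growth. Filling, homotopy and choice of vertices enlarge a tuple by an amount controlled by its
  size alone, so each is paid for by passing to a family that grows more slowly.

  A Cech cochain on a finite cover has finitely many values, whereas \<open>b\<close> has
  independent values on infinitely many tuples; merging pieces with equal tables overcomes this. A
  single subdivision would not do: the vertices of a simplex of the original nerve carry no labels
  from a finite set, so a face could not be located in the table of a larger simplex. In the first
  subdivision the vertices of a simplex are labelled by cardinality, and the second subdivision
  turns simplices together with their tables into vertices.\<close>

definition tcone :: "'v \<Rightarrow> ('v list \<Rightarrow>\<^sub>0 int) \<Rightarrow> ('v list \<Rightarrow>\<^sub>0 int)" where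
  "tcone a = frag_extend (\<lambda>\<sigma>. frag_of (a # \<sigma>))"

text \<open>The empty tuple spans degree \<open>-1\<close>, so that the complex is augmented.\<close>

primrec bd :: "'v list \<Rightarrow> ('v list \<Rightarrow>\<^sub>0 int)" where
  "bd [] = 0"
| "bd (a # \<sigma>) = frag_of \<sigma> - tcone a (bd \<sigma>)"

definition Bd :: "('v list \<Rightarrow>\<^sub>0 int) \<Rightarrow> ('v list \<Rightarrow>\<^sub>0 int)" where
  "Bd = frag_extend bd"

lemma tcone_simps [simp]:
  "tcone a 0 = 0" "tcone a (frag_of \<sigma>) = frag_of (a # \<sigma>)"
  "tcone a (x + y) = tcone a x + tcone a y" "tcone a (x - y) = tcone a x - tcone a y"
  "tcone a (- x) = - tcone a x"
  by (simp_all add: tcone_def frag_extend_add frag_extend_diff frag_extend_minus)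

lemma Bd_simps [simp]:
  "Bd 0 = 0" "Bd (frag_of \<sigma>) = bd \<sigma>"
  "Bd (x + y) = Bd x + Bd y" "Bd (x - y) = Bd x - Bd y" "Bd (- x) = - Bd x"
  by (simp_all add: Bd_def frag_extend_add frag_extend_diff frag_extend_minus)

text \<open>Coning is a contracting homotopy. Since degree \<open>-1\<close> is included, the
  identity has no exceptional case in low degree, and every cycle is the boundary of its
  cone.\<close>

lemma Bd_tcone: "Bd (tcone a z) = z - tcone a (Bd z)"
proof (induction z rule: frag_induction[OF subset_UNIV])
  case (3 a b)
  then show ?case by (simp add: algebra_simps)
qed simp_all

lemma Bd_bd [simp]: "Bd (bd \<sigma>) = 0"
  by (induction \<sigma>) (simp_all add: Bd_tcone)

lemma Bd_Bd [simp]: "Bd (Bd z) = 0"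
  by (induction z rule: frag_induction[OF subset_UNIV]) simp_all

lemma keys_tcone: "Poly_Mapping.keys (tcone a z) \<subseteq> (#) a ` Poly_Mapping.keys z"
  using keys_frag_extend[of "\<lambda>\<sigma>. frag_of (a # \<sigma>)" z] unfolding tcone_def by auto

lemma keys_bd:
  "\<tau> \<in> Poly_Mapping.keys (bd \<sigma>) \<Longrightarrow> \<sigma> \<noteq> [] \<and> length \<sigma> = Suc (length \<tau>) \<and> set \<tau> \<subseteq> set \<sigma>"
proof (induction \<sigma> arbitrary: \<tau>)
  case (Cons a \<sigma>)
  then have "\<tau> = \<sigma> \<or> (\<exists>\<rho>. \<tau> = a # \<rho> \<and> \<rho> \<in> Poly_Mapping.keys (bd \<sigma>))"
    using keys_diff[of "frag_of \<sigma>" "tcone a (bd \<sigma>)"] keys_tcone[of a "bd \<sigma>"] by auto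
  then show ?case using Cons.IH by fastforce
qed simp

lemma bd_length_1:
  assumes "length \<sigma> = 1" shows "bd \<sigma> = frag_of []"
  using assms by (cases \<sigma>) auto

lemma frag_extend_frag_extend:
  "frag_extend f (frag_extend g z) = frag_extend (\<lambda>x. frag_extend f (g x)) z"
  by (induction z rule: frag_induction[OF subset_UNIV]) (simp_all add: frag_extend_diff)

lemma frag_extend_fun_diff:
  "frag_extend (\<lambda>x. f x - g x) z = frag_extend f z - frag_extend g z"
  by (induction z rule: frag_induction[OF subset_UNIV]) (simp_all add: frag_extend_diff)

lemma frag_extend_frag_of [simp]: "frag_extend frag_of z = z"
  by (rule frag_expansion[symmetric])

lemma keys_frag_extend_subset:
  "(\<And>x. x \<in> Poly_Mapping.keys z \<Longrightarrow> Poly_Mapping.keys (f x) \<subseteq> S) \<Longrightarrow>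
    Poly_Mapping.keys (frag_extend f z) \<subseteq> S"
  using keys_frag_extend[of f z] by blast

lemma keys_diff_subset:
  "Poly_Mapping.keys x \<subseteq> S \<Longrightarrow> Poly_Mapping.keys y \<subseteq> S \<Longrightarrow> Poly_Mapping.keys (x - y) \<subseteq> S"
  using keys_diff[of x y] by blast

lemma keys_add_subset:
  "Poly_Mapping.keys x \<subseteq> S \<Longrightarrow> Poly_Mapping.keys y \<subseteq> S \<Longrightarrow> Poly_Mapping.keys (x + y) \<subseteq> S"
  using keys_add[of x y] by blast

text \<open>Linear extension of an integer-valued cochain, obtained by mapping into the free abelian
  group on one point. Coefficients modulo \<open>m\<close> are represented by integers throughout,
  and equality modulo \<open>m\<close> by divisibility of differences.\<close>

definition eval_chain :: "('v \<Rightarrow> int) \<Rightarrow> ('v \<Rightarrow>\<^sub>0 int) \<Rightarrow> int" where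
  "eval_chain c z = poly_mapping.lookup (frag_extend (\<lambda>\<sigma>. frag_cmul (c \<sigma>) (frag_of ())) z) ()"

lemma eval_chain_simps [simp]:
  "eval_chain c 0 = 0" "eval_chain c (frag_of \<sigma>) = c \<sigma>"
  "eval_chain c (x + y) = eval_chain c x + eval_chain c y"
  "eval_chain c (x - y) = eval_chain c x - eval_chain c y"
  "eval_chain c (- x) = - eval_chain c x"
  by (simp_all add: eval_chain_def frag_extend_add frag_extend_diff frag_extend_minus
      lookup_add lookup_minus)

lemma eval_chain_frag_extend:
  "eval_chain c (frag_extend f z) = eval_chain (\<lambda>x. eval_chain c (f x)) z"
  by (induction z rule: frag_induction[OF subset_UNIV]) (simp_all add: frag_extend_diff)

lemma eval_chain_dvd:
  assumes "\<And>x. x \<in> Poly_Mapping.keys z \<Longrightarrow> m dvd c x"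
  shows "m dvd eval_chain c z"
proof -
  have "Poly_Mapping.keys z \<subseteq> {x. m dvd c x}" using assms by blast
  then show ?thesis
    by (induction z rule: frag_induction) (auto simp: dvd_diff)
qed

lemma eval_chain_fun_add: "eval_chain (\<lambda>x. c x + d x) z = eval_chain c z + eval_chain d z"
  by (induction z rule: frag_induction[OF subset_UNIV]) simp_all

lemma eval_chain_fun_diff: "eval_chain (\<lambda>x. c x - d x) z = eval_chain c z - eval_chain d z"
  by (induction z rule: frag_induction[OF subset_UNIV]) simp_all

lemma eval_chain_fun_minus: "eval_chain (\<lambda>x. - c x) z = - eval_chain c z"
  by (induction z rule: frag_induction[OF subset_UNIV]) simp_all

lemma eval_chain_cong:
  assumes "\<And>x. x \<in> Poly_Mapping.keys z \<Longrightarrow> c x = d x"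
  shows "eval_chain c z = eval_chain d z"
proof -
  have "Poly_Mapping.keys z \<subseteq> {x. c x = d x}" using assms by blast
  then show ?thesis
    by (induction z rule: frag_induction) auto
qed

section \<open>Alternating sums of faces\<close>

lemma face_Cons_0 [simp]: "face 0 (a # \<sigma>) = \<sigma>"
  and face_Cons_Suc [simp]: "face (Suc i) (a # \<sigma>) = a # face i \<sigma>"
  by (simp_all add: face_def)

lemma length_face: "i < length \<sigma> \<Longrightarrow> length (face i \<sigma>) = length \<sigma> - 1"
  by (auto simp: face_def)

lemma eval_chain_tcone: "eval_chain c (tcone a z) = eval_chain (\<lambda>\<tau>. c (a # \<tau>)) z"
  by (simp add: tcone_def eval_chain_frag_extend)

text \<open>Unfolding the cone recursion gives the usual alternating sum, the form in which
  \<open>coboundary\<close> is defined on nerves.\<close>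

lemma eval_chain_bd: "eval_chain c (bd \<sigma>) = (\<Sum>i<length \<sigma>. (-1) ^ i * c (face i \<sigma>))"
proof (induction \<sigma> arbitrary: c)
  case (Cons a \<sigma>)
  have "eval_chain c (bd (a # \<sigma>)) = c \<sigma> - (\<Sum>i<length \<sigma>. (-1) ^ i * c (a # face i \<sigma>))"
    by (simp add: eval_chain_tcone Cons.IH)
  then show ?case
    by (simp only: length_Cons sum.lessThan_Suc_shift) (simp add: sum_negf)
qed simp

section \<open>Chain maps and constructions by recursion on the length of a tuple\<close>

lemma frag_extend_map_bd:
  "frag_extend (\<lambda>\<tau>. frag_of (map f \<tau>)) (bd \<sigma>) = bd (map f \<sigma>)"
proof (induction \<sigma>)
  case (Cons a \<sigma>)
  have "frag_extend (\<lambda>\<tau>. frag_of (map f \<tau>)) (tcone a z) =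
      tcone (f a) (frag_extend (\<lambda>\<tau>. frag_of (map f \<tau>)) z)" for z
    by (simp add: tcone_def frag_extend_frag_extend)
  with Cons show ?case by (simp add: frag_extend_diff)
qed simp

text \<open>Serves both for filling singular boundaries and for constructing chain homotopies: the
  value over a tuple is chosen after the values over its faces, and \<open>R\<close> may refer to
  the extension of the latter to the boundary. Faces are one shorter, so recursion on the length
  suffices.\<close>

lemma chain_recursion:
  assumes "\<And>\<sigma> h. \<sigma> \<in> D \<Longrightarrow> (\<And>\<tau>. \<tau> \<in> Poly_Mapping.keys (bd \<sigma>) \<Longrightarrow> \<tau> \<in> D \<and> R \<tau> (frag_extend h (bd \<tau>)) (h \<tau>))
      \<Longrightarrow> \<exists>w. R \<sigma> (frag_extend h (bd \<sigma>)) w"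
    and D: "\<And>\<sigma> \<tau>. \<sigma> \<in> D \<Longrightarrow> \<tau> \<in> Poly_Mapping.keys (bd \<sigma>) \<Longrightarrow> \<tau> \<in> D"
  shows "\<exists>h. \<forall>\<sigma>\<in>D. R \<sigma> (frag_extend h (bd \<sigma>)) (h \<sigma>)"
proof -
  \<comment> \<open>Stage \<open>k\<close> of \<open>H\<close> looks at stage \<open>k - 1\<close>
    only and is meant for tuples of length \<open>k - 1\<close>; \<open>h\<close> therefore reads a
    tuple at the stage one above its length.\<close>
  define H where "H = rec_nat (\<lambda>\<sigma>. 0) (\<lambda>_ h \<sigma>. SOME w. R \<sigma> (frag_extend h (bd \<sigma>)) w)"
  define h where "h \<sigma> = H (Suc (length \<sigma>)) \<sigma>" for \<sigma>
  have ext: "frag_extend (H (length \<sigma>)) (bd \<sigma>) = frag_extend h (bd \<sigma>)" for \<sigma>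
    by (rule frag_extend_eq) (auto simp: h_def dest: keys_bd)
  have h: "h \<sigma> = (SOME w. R \<sigma> (frag_extend h (bd \<sigma>)) w)" for \<sigma>
    unfolding ext[symmetric] by (simp add: h_def H_def)
  have "R \<sigma> (frag_extend h (bd \<sigma>)) (h \<sigma>)" if "\<sigma> \<in> D" for \<sigma>
    using that
  proof (induction "length \<sigma>" arbitrary: \<sigma> rule: less_induct)
    case less
    have "\<exists>w. R \<sigma> (frag_extend h (bd \<sigma>)) w"
    proof (rule assms(1)[OF less.prems])
      fix \<tau> assume \<tau>: "\<tau> \<in> Poly_Mapping.keys (bd \<sigma>)"
      with keys_bd[OF \<tau>] less D show "\<tau> \<in> D \<and> R \<tau> (frag_extend h (bd \<tau>)) (h \<tau>)" by auto
    qed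
    then show ?case by (subst h) (rule someI_ex)
  qed
  then show ?thesis by blast
qed

text \<open>The sets \<open>Q' \<sigma>\<close> and \<open>Q \<sigma>\<close> control the supports of the cycle to be filled over \<open>\<sigma>\<close> and of
  its filling.\<close>

lemma chain_homotopy_exists:
  assumes T: "\<And>\<sigma>. \<sigma> \<in> D \<Longrightarrow> Bd (T \<sigma>) = frag_extend T (bd \<sigma>)"
    and TQ: "\<And>\<sigma>. \<sigma> \<in> D \<Longrightarrow> Poly_Mapping.keys (T \<sigma>) \<subseteq> Q' \<sigma>"
    and QQ: "\<And>\<sigma> \<tau>. \<sigma> \<in> D \<Longrightarrow> \<tau> \<in> Poly_Mapping.keys (bd \<sigma>) \<Longrightarrow> Q \<tau> \<subseteq> Q' \<sigma>"
    and fill: "\<And>\<sigma> z. \<sigma> \<in> D \<Longrightarrow> Poly_Mapping.keys z \<subseteq> Q' \<sigma> \<Longrightarrow> Bd z = 0 \<Longrightarrow>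
        \<exists>w. Poly_Mapping.keys w \<subseteq> Q \<sigma> \<and> Bd w = z"
    and D: "\<And>\<sigma> \<tau>. \<sigma> \<in> D \<Longrightarrow> \<tau> \<in> Poly_Mapping.keys (bd \<sigma>) \<Longrightarrow> \<tau> \<in> D"
  shows "\<exists>h. \<forall>\<sigma>\<in>D. Poly_Mapping.keys (h \<sigma>) \<subseteq> Q \<sigma> \<and> Bd (h \<sigma>) = T \<sigma> - frag_extend h (bd \<sigma>)"
proof (rule chain_recursion[where R="\<lambda>\<sigma> z w. Poly_Mapping.keys w \<subseteq> Q \<sigma> \<and> Bd w = T \<sigma> - z"])
  fix \<sigma> and h :: "'a list \<Rightarrow> ('b list \<Rightarrow>\<^sub>0 int)"
  assume \<sigma>: "\<sigma> \<in> D"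
    and IH: "\<And>\<tau>. \<tau> \<in> Poly_Mapping.keys (bd \<sigma>) \<Longrightarrow> \<tau> \<in> D \<and>
        Poly_Mapping.keys (h \<tau>) \<subseteq> Q \<tau> \<and> Bd (h \<tau>) = T \<tau> - frag_extend h (bd \<tau>)"
  \<comment> \<open>What remains to be filled over \<open>\<sigma>\<close> is a cycle:
    \<open>T\<close> commutes with boundaries, and the homotopy terms over faces of faces cancel
    because the boundary squares to zero.\<close>
  have "Bd (frag_extend h (bd \<sigma>)) = frag_extend (\<lambda>\<tau>. Bd (h \<tau>)) (bd \<sigma>)"
    by (simp add: Bd_def frag_extend_frag_extend)
  also have "\<dots> = frag_extend (\<lambda>\<tau>. T \<tau> - frag_extend h (bd \<tau>)) (bd \<sigma>)"
    by (rule frag_extend_eq) (simp add: IH)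
  also have "\<dots> = frag_extend T (bd \<sigma>) - frag_extend h (Bd (bd \<sigma>))"
    unfolding frag_extend_fun_diff by (simp only: Bd_def frag_extend_frag_extend)
  finally have "Bd (T \<sigma> - frag_extend h (bd \<sigma>)) = 0" by (simp add: T[OF \<sigma>])
  moreover have "Poly_Mapping.keys (T \<sigma> - frag_extend h (bd \<sigma>)) \<subseteq> Q' \<sigma>"
    by (intro keys_diff_subset keys_frag_extend_subset TQ \<sigma>) (use IH QQ \<sigma> in blast)
  ultimately show "\<exists>w. Poly_Mapping.keys w \<subseteq> Q \<sigma> \<and> Bd w = T \<sigma> - frag_extend h (bd \<sigma>)"
    using fill[OF \<sigma>] by blast
qed (rule D)

lemma fill_by_cone:
  assumes "Bd z = 0" "a \<in> S" "Poly_Mapping.keys z \<subseteq> {\<tau>. set \<tau> \<subseteq> S \<and> length \<tau> = k}"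
  shows "\<exists>w. Poly_Mapping.keys w \<subseteq> {\<tau>. set \<tau> \<subseteq> S \<and> length \<tau> = Suc k} \<and> Bd w = z"
proof (intro exI conjI)
  show "Poly_Mapping.keys (tcone a z) \<subseteq> {\<tau>. set \<tau> \<subseteq> S \<and> length \<tau> = Suc k}"
    using keys_tcone[of a z] assms by fastforce
  show "Bd (tcone a z) = z" using assms by (simp add: Bd_tcone)
qed

text \<open>Acyclic carriers: over \<open>\<sigma>\<close> everything happens in the full simplex
  spanned by both images, where a cone from \<open>f (hd \<sigma>)\<close> fills any cycle. The
  result is the prism operator. The carrier of the empty tuple is empty, as there is no cone point;
  both maps agree there, so nothing has to be filled.\<close>

lemma contiguous_chain_homotopy:
  fixes f g :: "'v \<Rightarrow> 'w"
  shows "\<exists>P. \<forall>\<sigma>. Poly_Mapping.keys (P \<sigma>) \<subseteq> {\<tau>. set \<tau> \<subseteq> f ` set \<sigma> \<union> g ` set \<sigma> \<and> length \<tau> = Suc (length \<sigma>)}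
      \<and> Bd (P \<sigma>) = (frag_of (map f \<sigma>) - frag_of (map g \<sigma>)) - frag_extend P (bd \<sigma>)"
proof -
  define D :: "'v list set" where "D = UNIV"
  define S where "S \<sigma> = f ` set \<sigma> \<union> g ` set \<sigma>" for \<sigma>
  have "\<exists>P. \<forall>\<sigma>\<in>D. Poly_Mapping.keys (P \<sigma>) \<subseteq> {\<tau>. \<sigma> \<noteq> [] \<and> set \<tau> \<subseteq> S \<sigma> \<and> length \<tau> = Suc (length \<sigma>)}
      \<and> Bd (P \<sigma>) = (frag_of (map f \<sigma>) - frag_of (map g \<sigma>)) - frag_extend P (bd \<sigma>)"
  proof (rule chain_homotopy_exists[where Q'="\<lambda>\<sigma>. {\<tau>. \<sigma> \<noteq> [] \<and> set \<tau> \<subseteq> S \<sigma> \<and> length \<tau> = length \<sigma>}"])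
    fix \<sigma>
    show "Bd (frag_of (map f \<sigma>) - frag_of (map g \<sigma>)) =
        frag_extend (\<lambda>\<sigma>. frag_of (map f \<sigma>) - frag_of (map g \<sigma>)) (bd \<sigma>)"
      by (simp add: frag_extend_fun_diff frag_extend_map_bd)
    show "Poly_Mapping.keys (frag_of (map f \<sigma>) - frag_of (map g \<sigma>))
        \<subseteq> {\<tau>. \<sigma> \<noteq> [] \<and> set \<tau> \<subseteq> S \<sigma> \<and> length \<tau> = length \<sigma>}"
    proof (cases "\<sigma> = []")
      case False
      then show ?thesis by (intro keys_diff_subset) (auto simp: S_def)
    qed simp
  next
    fix \<sigma> \<tau> :: "'v list" assume "\<tau> \<in> Poly_Mapping.keys (bd \<sigma>)"
    then show "{\<rho>. \<tau> \<noteq> [] \<and> set \<rho> \<subseteq> S \<tau> \<and> length \<rho> = Suc (length \<tau>)}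
        \<subseteq> {\<rho>. \<sigma> \<noteq> [] \<and> set \<rho> \<subseteq> S \<sigma> \<and> length \<rho> = length \<sigma>}"
      using keys_bd[of \<tau> \<sigma>] by (fastforce simp: S_def)
  next
    fix \<sigma> :: "'v list" and z :: "'w list \<Rightarrow>\<^sub>0 int"
    assume z: "Poly_Mapping.keys z \<subseteq> {\<tau>. \<sigma> \<noteq> [] \<and> set \<tau> \<subseteq> S \<sigma> \<and> length \<tau> = length \<sigma>}" "Bd z = 0"
    show "\<exists>w. Poly_Mapping.keys w \<subseteq> {\<tau>. \<sigma> \<noteq> [] \<and> set \<tau> \<subseteq> S \<sigma> \<and> length \<tau> = Suc (length \<sigma>)} \<and> Bd w = z"
    proof (cases "\<sigma> = []")
      case True
      with z have "z = 0" by simp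
      then show ?thesis by (intro exI[of _ 0]) simp
    next
      case False
      then have "f (hd \<sigma>) \<in> S \<sigma>" by (simp add: S_def)
      from fill_by_cone[OF z(2) this] z(1) False show ?thesis by simp
    qed
  qed (simp add: D_def)
  then show ?thesis unfolding D_def S_def by blast
qed

text \<open>The alternating sum in the group of chains itself, for comparison with
  \<open>chain_boundary\<close> of singular chains.\<close>

lemma bd_eq_sum: "bd \<sigma> = (\<Sum>i<length \<sigma>. frag_cmul ((-1) ^ i) (frag_of (face i \<sigma>)))"
proof (induction \<sigma>)
  case (Cons a \<sigma>)
  have c: "tcone a (sum g I) = (\<Sum>i\<in>I. tcone a (g i))" for g and I :: "nat set"
    by (induction I rule: infinite_finite_induct) simp_all
  have m: "tcone a (frag_cmul k z) = frag_cmul k (tcone a z)" for k z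
    by (simp add: tcone_def frag_extend_cmul)
  have "bd (a # \<sigma>) = frag_of \<sigma> - (\<Sum>i<length \<sigma>. frag_cmul ((-1) ^ i) (frag_of (a # face i \<sigma>)))"
    by (simp add: Cons.IH c m)
  also have "\<dots> = frag_of \<sigma> + (\<Sum>i<length \<sigma>. - frag_cmul ((-1) ^ i) (frag_of (a # face i \<sigma>)))"
    unfolding sum_negf by simp
  also have "\<dots> = (\<Sum>i<length (a # \<sigma>). frag_cmul ((-1) ^ i) (frag_of (face i (a # \<sigma>))))"
    unfolding length_Cons sum.lessThan_Suc_shift by simp
  finally show ?case .
qed simp

section \<open>Filling small singular cycles\<close>

definition small_chain :: "nat \<Rightarrow> 'a topology \<Rightarrow> 'a set set \<Rightarrow> 'a chain \<Rightarrow> bool" where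
  "small_chain p X \<C> c \<longleftrightarrow> singular_chain p X c \<and>
     (\<forall>f\<in>Poly_Mapping.keys c. \<exists>V\<in>\<C>. f ` standard_simplex p \<subseteq> V)"

lemma small_chain_diff: "small_chain p X \<C> a \<Longrightarrow> small_chain p X \<C> b \<Longrightarrow> small_chain p X \<C> (a - b)"
  unfolding small_chain_def by (meson UnE keys_diff singular_chain_diff subsetD)

lemma small_chain_0 [simp]: "small_chain p X \<C> 0"
  by (simp add: small_chain_def)

lemma small_chain_extend:
  assumes "\<And>x. x \<in> Poly_Mapping.keys z \<Longrightarrow> small_chain p X \<C> (f x)"
  shows "small_chain p X \<C> (frag_extend f z)"
proof -
  have "Poly_Mapping.keys z \<subseteq> {x. small_chain p X \<C> (f x)}" using assms by blast
  then show ?thesis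
    by (induction z rule: frag_induction) (auto simp: frag_extend_diff small_chain_diff)
qed

lemma small_chain_mono:
  "small_chain p (subtopology X A) \<C> c \<Longrightarrow> A \<subseteq> B \<Longrightarrow> small_chain p (subtopology X B) \<C> c"
  unfolding small_chain_def using singular_chain_mono by blast

lemma chain_boundary_iterated_singular_subdivision:
  assumes "singular_chain p X c"
  shows "chain_boundary p ((singular_subdivision p ^^ n) c) =
    (singular_subdivision (p - Suc 0) ^^ n) (chain_boundary p c)"
proof -
  have "singular_chain p X ((singular_subdivision p ^^ n) c)" for n
    by (induction n) (simp_all add: assms singular_chain_singular_subdivision)
  note sc = this
  show ?thesis
  proof (induction n)
    case (Suc n)
    with chain_boundary_singular_subdivision[OF sc[of n]] show ?case by simp
  qed simp
qed

text \<open>\<open>chain_boundary\<close> is zero in degree 0 by convention, so there the vanishing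
  of the augmentation has to be required separately.\<close>

definition reduced_cycle :: "nat \<Rightarrow> 'a chain \<Rightarrow> bool" where
  "reduced_cycle p z \<longleftrightarrow> chain_boundary p z = 0 \<and> (p = 0 \<longrightarrow> eval_chain (\<lambda>_. 1) z = 0)"

lemma frag_extend_const:
  "frag_extend (\<lambda>_. frag_of s) z = frag_cmul (eval_chain (\<lambda>_. 1) z) (frag_of s)"
  by (induction z rule: frag_induction[OF subset_UNIV])
    (simp_all add: frag_extend_diff frag_cmul_diff_distrib)

text \<open>Homotopy invariance replaces \<open>z\<close>, up to a boundary, by its image under the
  constant map. That image bounds: in positive degree because it is a cycle in a one-point space, in
  degree 0 because it is the augmentation, which is zero, times a point.\<close>

lemma singular_fill_nullhomotopic:
  assumes hom: "homotopic_with (\<lambda>_. True) (subtopology X A) (subtopology X B) (\<lambda>y. y) (\<lambda>_. c)"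
    and z: "singular_chain p (subtopology X A) z" "reduced_cycle p z"
  shows "\<exists>w. singular_chain (Suc p) (subtopology X B) w \<and> chain_boundary (Suc p) w = z"
proof (cases "topspace (subtopology X A) = {}")
  case True
  with z have "z = 0" using singular_chain_empty by blast
  then show ?thesis by (intro exI[of _ 0]) simp
next
  case False
  have conts: "continuous_map (subtopology X A) (subtopology X B) (\<lambda>_. c)"
    using homotopic_with_imp_continuous_maps[OF hom] by simp
  obtain x where "x \<in> topspace (subtopology X A)" using False by blast
  then have "c \<in> topspace (subtopology X B)"
    using continuous_map_image_subset_topspace[OF conts] by blast
  then have c: "c \<in> topspace X" "c \<in> B" by auto
  have hom': "homotopic_with (\<lambda>h. h \<in> {} \<rightarrow> {}) (subtopology X A) (subtopology X B) (\<lambda>y. y) (\<lambda>_. c)"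
    using hom by (simp only: empty_iff Pi_empty UNIV_I Pi_UNIV HOL.simp_thms)
  have zc: "singular_relcycle p (subtopology X A) {} z"
    using z by (simp add: singular_cycle reduced_cycle_def)
  have "homologous_rel p (subtopology X B) {} (chain_map p (\<lambda>y. y) z) (chain_map p (\<lambda>_. c) z)"
    by (rule homotopic_imp_homologous_rel_chain_maps[OF hom' zc])
  moreover have "chain_map p (\<lambda>y. y) z = z" using z(1) by (rule chain_map_id_gen) simp
  ultimately have "singular_relboundary p (subtopology X B) {} (z - chain_map p (\<lambda>_. c) z)"
    by (simp add: homologous_rel_def)
  then obtain w1 where w1: "singular_chain (Suc p) (subtopology X B) w1"
      "chain_boundary (Suc p) w1 = z - chain_map p (\<lambda>_. c) z"
    by (auto simp: singular_boundary)
  have "\<exists>w2. singular_chain (Suc p) (subtopology X B) w2 \<and> chain_boundary (Suc p) w2 = chain_map p (\<lambda>_. c) z"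
  proof (cases "p = 0")
    case True
    have "chain_map p (\<lambda>_. c) z = frag_extend (\<lambda>_. frag_of (restrict (\<lambda>_. c) (standard_simplex p))) z"
      unfolding chain_map_def by (rule frag_extend_eq) (auto simp: simplex_map_def)
    also have "\<dots> = 0" using z(2) True by (simp add: frag_extend_const reduced_cycle_def)
    finally show ?thesis by (intro exI[of _ 0]) simp
  next
    case False
    have "singular_relcycle p (subtopology X {c}) {} (chain_map p (\<lambda>_. c) z)"
      by (rule singular_relcycle_chain_map[OF zc]) (use c in auto)
    moreover have "topspace (subtopology X {c}) = {c}" using c by auto
    ultimately have "singular_relboundary p (subtopology X {c}) {} (chain_map p (\<lambda>_. c) z)"
      using False by (simp add: singular_boundary_eq_cycle_singleton)
    then obtain w2 where "singular_chain (Suc p) (subtopology X {c}) w2"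
        "chain_boundary (Suc p) w2 = chain_map p (\<lambda>_. c) z"
      by (auto simp: singular_boundary)
    with c(2) show ?thesis by (intro exI[of _ w2]) (auto elim: singular_chain_mono)
  qed
  then obtain w2 where w2: "singular_chain (Suc p) (subtopology X B) w2"
      "chain_boundary (Suc p) w2 = chain_map p (\<lambda>_. c) z" by blast
  show ?thesis
    by (rule exI[of _ "w1 + w2"]) (simp add: w1 w2 singular_chain_add chain_boundary_add)
qed

text \<open>Iterated subdivision makes a singular filling small but subdivides its boundary too. The
  homotopy between subdivision and identity, applied to the already small \<open>z\<close>, corrects
  the boundary.\<close>

lemma small_fill_nullhomotopic:
  assumes hom: "homotopic_with (\<lambda>_. True) (subtopology X A) (subtopology X B) (\<lambda>y. y) (\<lambda>_. c)"
    and AB: "A \<subseteq> B"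
    and \<C>: "\<And>U. U \<in> \<C> \<Longrightarrow> openin X U" "topspace X \<subseteq> \<Union>\<C>"
    and z: "small_chain p (subtopology X A) \<C> z" "reduced_cycle p z"
  shows "\<exists>w. small_chain (Suc p) (subtopology X B) \<C> w \<and> chain_boundary (Suc p) w = z"
proof -
  obtain w where w: "singular_chain (Suc p) (subtopology X B) w" "chain_boundary (Suc p) w = z"
    using singular_fill_nullhomotopic[OF hom _ z(2)] z(1) unfolding small_chain_def by blast
  let ?\<C> = "(\<lambda>V. B \<inter> V) ` \<C>"
  have o: "\<And>U. U \<in> ?\<C> \<Longrightarrow> openin (subtopology X B) U"
    using \<C>(1) by (auto intro: openin_subtopology_Int2)
  have cov: "topspace (subtopology X B) \<subseteq> \<Union>?\<C>" using \<C>(2) by auto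
  obtain n where n: "\<And>m f. \<lbrakk>n \<le> m; f \<in> Poly_Mapping.keys ((singular_subdivision (Suc p) ^^ m) w)\<rbrakk>
                      \<Longrightarrow> \<exists>V \<in> ?\<C>. f \<in> (standard_simplex (Suc p)) \<rightarrow> V"
  proof (rule sufficient_iterated_singular_subdivision_exists[OF _ cov w(1)])
    fix n assume n: "\<And>m f. \<lbrakk>n \<le> m; f \<in> Poly_Mapping.keys ((singular_subdivision (Suc p) ^^ m) w)\<rbrakk>
                      \<Longrightarrow> \<exists>V \<in> ?\<C>. f \<in> (standard_simplex (Suc p)) \<rightarrow> V"
    show thesis by (rule that) (rule n)
  qed (rule o)
  let ?w = "(singular_subdivision (Suc p) ^^ n) w"
  have "singular_chain (Suc p) (subtopology X B) ((singular_subdivision (Suc p) ^^ k) w)" for k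
    by (induction k) (simp_all add: w singular_chain_singular_subdivision)
  moreover have "\<exists>V\<in>\<C>. f ` standard_simplex (Suc p) \<subseteq> V" if "f \<in> Poly_Mapping.keys ?w" for f
  proof -
    from n[OF order_refl that] obtain V where "V \<in> \<C>" "f \<in> standard_simplex (Suc p) \<rightarrow> B \<inter> V" by blast
    then show ?thesis by (intro bexI[of _ V]) auto
  qed
  ultimately have sw: "small_chain (Suc p) (subtopology X B) \<C> ?w"
    unfolding small_chain_def by simp
  obtain h where h: "\<And>p. h p 0 = (0 :: 'a chain)"
        "\<And>p c1 c2. h p (c1-c2) = h p c1 - h p c2"
        "\<And>p X c. singular_chain p X c \<Longrightarrow> singular_chain (Suc p) X (h p c)"
        "\<And>p X c. singular_chain p X c
                 \<Longrightarrow> chain_boundary (Suc p) (h p c) + h (p - Suc 0) (chain_boundary p c)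
                   = (singular_subdivision p ^^ n) c - c"
  proof (rule chain_homotopic_iterated_singular_subdivision[of n])
    fix h :: "nat \<Rightarrow> 'a chain \<Rightarrow> 'a chain"
    assume h: "\<And>p. h p 0 = 0"
        "\<And>p c1 c2. h p (c1-c2) = h p c1 - h p c2"
        "\<And>p X c. singular_chain p X c \<Longrightarrow> singular_chain (Suc p) X (h p c)"
        "\<And>p X c. singular_chain p X c
                 \<Longrightarrow> chain_boundary (Suc p) (h p c) + h (p - Suc 0) (chain_boundary p c)
                   = (singular_subdivision p ^^ n) c - c"
    show thesis by (rule that) (fact h)+
  qed
  have zS: "singular_chain p (subtopology X B) z"
    by (rule singular_chain_mono[OF _ AB]) (use z(1) in \<open>simp add: small_chain_def\<close>)
  have "Poly_Mapping.keys z \<subseteq> {f. singular_simplex p (subtopology X B) f \<and> (\<exists>V\<in>\<C>. f ` standard_simplex p \<subseteq> V)}"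
    using zS z(1) unfolding small_chain_def singular_chain_def by blast
  \<comment> \<open>The homotopy \<open>h\<close> respects subspaces: on a simplex inside
    \<open>V\<close> it yields a chain inside \<open>V\<close>, hence it keeps small chains
    small.\<close>
  then have sh: "small_chain (Suc p) (subtopology X B) \<C> (h p z)"
  proof (induction z rule: frag_induction)
    case (one f)
    then obtain V where V: "V \<in> \<C>" "f ` standard_simplex p \<subseteq> V" "singular_simplex p (subtopology X B) f" by blast
    then have "singular_chain p (subtopology (subtopology X B) V) (frag_of f)"
      by (simp add: singular_chain_of singular_simplex_subtopology[of p "subtopology X B"])
    from h(3)[OF this] show ?case
      unfolding small_chain_def singular_chain_subtopology[of _ "subtopology X B"] using V(1) by blast
  qed (simp_all add: h small_chain_diff)
  have "chain_boundary (Suc p) (h p z) = (singular_subdivision p ^^ n) z - z"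
    using h(4)[OF zS] z(2) by (simp add: reduced_cycle_def h)
  moreover have "chain_boundary (Suc p) ?w = (singular_subdivision p ^^ n) z"
    using chain_boundary_iterated_singular_subdivision[OF w(1), of n] w(2) by simp
  ultimately have "chain_boundary (Suc p) (?w - h p z) = z" by (simp add: chain_boundary_diff)
  with small_chain_diff[OF sw sh] show ?thesis by blast
qed

section \<open>From singular simplices to tuples of their vertices\<close>

definition vertices_of :: "nat \<Rightarrow> ((nat \<Rightarrow> real) \<Rightarrow> 'a) \<Rightarrow> 'a list" where
  "vertices_of p s = map (\<lambda>i. s (\<lambda>j. if j = i then 1 else 0)) [0..<Suc p]"

lemma vertices_of_singular_face:
  assumes "k \<le> Suc p"
  shows "vertices_of p (singular_face (Suc p) k s) = face k (vertices_of (Suc p) s)"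
proof (rule nth_equalityI)
  show "length (vertices_of p (singular_face (Suc p) k s)) = length (face k (vertices_of (Suc p) s))"
    using assms by (simp add: length_face vertices_of_def del: upt_Suc)
  fix i assume "i < length (vertices_of p (singular_face (Suc p) k s))"
  then have i: "i \<le> p" by (simp add: vertices_of_def del: upt_Suc)
  have e: "simplical_face k (\<lambda>j. if j = i then 1 else (0::real)) =
      (\<lambda>j. if j = (if i < k then i else Suc i) then 1 else 0)"
    by (auto simp: simplical_face_def fun_eq_iff)
  show "vertices_of p (singular_face (Suc p) k s) ! i = face k (vertices_of (Suc p) s) ! i"
  proof (cases "i < k")
    case True
    with i assms e show ?thesis
      by (simp add: vertices_of_def face_def singular_face_def nth_append min_def del: upt_Suc)
  next
    case False
    with i assms e show ?thesis
      by (simp add: vertices_of_def face_def singular_face_def nth_append min_def del: upt_Suc)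
  qed
qed

lemma frag_extend_sum_cmul:
  "frag_extend f (\<Sum>i<n. frag_cmul (c i) (frag_of (x i))) = (\<Sum>i<(n::nat). frag_cmul (c i) (f (x i)))"
  by (induction n) (simp_all add: frag_extend_add frag_extend_cmul)

text \<open>Taking vertices is a chain map, so a singular filling turns into a filling by
  tuples.\<close>

lemma bd_vertices_of:
  "frag_extend (\<lambda>s. frag_of (vertices_of p s)) (chain_boundary (Suc p) c) =
    frag_extend (\<lambda>s. bd (vertices_of (Suc p) s)) c"
proof (induction c rule: frag_induction[OF subset_UNIV])
  case (2 s)
  have "frag_extend (\<lambda>s. frag_of (vertices_of p s)) (chain_boundary (Suc p) (frag_of s)) =
      (\<Sum>k<Suc (Suc p). frag_cmul ((-1) ^ k) (frag_of (vertices_of p (singular_face (Suc p) k s))))"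
    by (simp only: chain_boundary_of lessThan_Suc_atMost[symmetric] frag_extend_sum_cmul nat.simps if_False)
  also have "\<dots> = bd (vertices_of (Suc p) s)"
  proof -
    have "length (vertices_of (Suc p) s) = Suc (Suc p)"
      by (simp add: vertices_of_def del: upt_Suc)
    then show ?thesis
      unfolding bd_eq_sum by (intro sum.cong) (simp_all only: vertices_of_singular_face lessThan_iff less_Suc_eq_le)
  qed
  finally show ?case by simp
qed (simp_all add: frag_extend_diff chain_boundary_diff)

section \<open>Contraction radii\<close>

lemma mdist_self [simp]: "x \<in> mspace X \<Longrightarrow> mdist X x x = 0"
  by (simp only: mdist_zero)

lemma mcball_of_mono:
  assumes "x \<in> mspace X" "mdist X x y + r \<le> s"
  shows "mcball_of X y r \<subseteq> mcball_of X x s"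
proof
  fix z assume "z \<in> mcball_of X y r"
  with mdist_triangle[of x X y z] assms show "z \<in> mcball_of X x s" by auto
qed

text \<open>Monotonicity and \<open>r \<le> S r\<close> provide the nesting of balls in iterated
  fillings; the function witnessing \<open>uniformly_contractible\<close> may lack both.\<close>

definition contraction_radius :: "'a metric \<Rightarrow> (real \<Rightarrow> real) \<Rightarrow> bool" where
  "contraction_radius X S \<longleftrightarrow> mono S \<and> (\<forall>r. r \<le> S r) \<and>
     (\<forall>r\<ge>0. \<forall>x\<in>mspace X. \<exists>c.
          homotopic_with (\<lambda>_. True)
            (subtopology (mtopology_of X) (mcball_of X x r))
            (subtopology (mtopology_of X) (mcball_of X x (S r)))
            (\<lambda>y. y) (\<lambda>_. c))"

lemma homotopic_with_subtopology_mono: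
  assumes "homotopic_with (\<lambda>_. True) (subtopology X A) (subtopology X B) f g" "A' \<subseteq> A" "B \<subseteq> B'"
  shows "homotopic_with (\<lambda>_. True) (subtopology X A') (subtopology X B') f g"
proof -
  from assms(1) obtain h where h: "continuous_map (prod_topology (top_of_set {0..1}) (subtopology X A)) (subtopology X B) h"
      "\<forall>x. h (0::real, x) = f x" "\<forall>x. h (1, x) = g x"
    unfolding homotopic_with_def by blast
  have eq: "prod_topology (top_of_set {0..1}) (subtopology X A') =
      subtopology (prod_topology (top_of_set {0..1}) (subtopology X A)) (UNIV \<times> A')"
    using assms(2) by (simp add: prod_topology_subtopology subtopology_subtopology)
      (auto intro!: arg_cong[where f="subtopology _"])
  have "continuous_map (prod_topology (top_of_set {0..1}) (subtopology X A')) (subtopology X B) h"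
    unfolding eq by (rule continuous_map_from_subtopology[OF h(1)])
  then have "continuous_map (prod_topology (top_of_set {0..1}) (subtopology X A')) (subtopology X B') h"
    using assms(3) by (auto simp: continuous_map_in_subtopology)
  with h(2,3) show ?thesis unfolding homotopic_with_def by blast
qed

lemma contraction_radius_exists:
  assumes "uniformly_contractible X"
  shows "\<exists>S. contraction_radius X S"
proof -
  obtain S where S: "\<And>r. r \<ge> 0 \<Longrightarrow> S r \<ge> (0::real)"
    and hom: "\<And>r x. r \<ge> 0 \<Longrightarrow> x \<in> mspace X \<Longrightarrow> \<exists>c. homotopic_with (\<lambda>_. True)
            (subtopology (mtopology_of X) (mcball_of X x r))
            (subtopology (mtopology_of X) (mcball_of X x (S r))) (\<lambda>y. y) (\<lambda>_. c)"
    using assms unfolding uniformly_contractible_def by metis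
  \<comment> \<open>Summing the given radii over all integers up to the ceiling of \<open>r\<close>
    is monotone in \<open>r\<close> and dominates the radius belonging to that ceiling; the term
    \<open>max 0 r\<close> makes the result dominate \<open>r\<close>.\<close>
  define S' where "S' r = max 0 r + (\<Sum>m\<le>nat \<lceil>r\<rceil>. S (real m))" for r
  have "contraction_radius X S'"
    unfolding contraction_radius_def
  proof (intro conjI allI impI ballI)
    show "mono S'"
    proof (rule monoI)
      fix r r' :: real assume "r \<le> r'"
      then have "nat \<lceil>r\<rceil> \<le> nat \<lceil>r'\<rceil>" by (intro nat_mono ceiling_mono)
      then have "(\<Sum>m\<le>nat \<lceil>r\<rceil>. S (real m)) \<le> (\<Sum>m\<le>nat \<lceil>r'\<rceil>. S (real m))"
        by (intro sum_mono2) (auto simp: S)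
      with \<open>r \<le> r'\<close> show "S' r \<le> S' r'" by (simp add: S'_def)
    qed
    show "r \<le> S' r" for r
      using sum_nonneg[of "{..nat \<lceil>r\<rceil>}" "\<lambda>m. S (real m)"] by (simp add: S'_def S)
    fix r :: real and x assume r: "r \<ge> 0" "x \<in> mspace X"
    let ?m = "nat \<lceil>r\<rceil>"
    have rm: "r \<le> real ?m" by linarith
    obtain c where c: "homotopic_with (\<lambda>_. True)
            (subtopology (mtopology_of X) (mcball_of X x (real ?m)))
            (subtopology (mtopology_of X) (mcball_of X x (S (real ?m)))) (\<lambda>y. y) (\<lambda>_. c)"
      using hom[of "real ?m" x] r by auto
    have "S (real ?m) \<le> (\<Sum>m\<le>?m. S (real m))"
      by (rule member_le_sum) (auto simp: S)
    then have "S (real ?m) \<le> S' r" by (simp add: S'_def)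
    then have "mcball_of X x (S (real ?m)) \<subseteq> mcball_of X x (S' r)"
      by (intro mcball_of_mono) (simp_all add: r)
    moreover have "mcball_of X x r \<subseteq> mcball_of X x (real ?m)"
      using rm by (intro mcball_of_mono) (simp_all add: r)
    ultimately show "\<exists>c. homotopic_with (\<lambda>_. True)
            (subtopology (mtopology_of X) (mcball_of X x r))
            (subtopology (mtopology_of X) (mcball_of X x (S' r))) (\<lambda>y. y) (\<lambda>_. c)"
      using homotopic_with_subtopology_mono[OF c] by blast
  qed
  then show ?thesis by blast
qed

text \<open>Leaves room for moving the centre of a ball by at most 1, which costs 1 before and 1
  after the contraction. With the shifted radius, singular fillings and fillings of tiny tuples obey
  the same bounds.\<close>

lemma contraction_radius_shift:
  assumes "contraction_radius X S"
  shows "contraction_radius X (\<lambda>r. S (r + 1) + 1)"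
  unfolding contraction_radius_def
proof (intro conjI allI impI ballI)
  have S: "mono S" "\<And>r. r \<le> S r" using assms by (auto simp: contraction_radius_def)
  show "mono (\<lambda>r. S (r + 1) + 1)" using S(1) by (simp add: mono_def)
  show "r \<le> S (r + 1) + 1" for r using S(2)[of "r + 1"] by simp
  fix r :: real and x assume r: "r \<ge> 0" "x \<in> mspace X"
  then obtain c where c: "homotopic_with (\<lambda>_. True)
            (subtopology (mtopology_of X) (mcball_of X x r))
            (subtopology (mtopology_of X) (mcball_of X x (S r))) (\<lambda>y. y) (\<lambda>_. c)"
    using assms unfolding contraction_radius_def by blast
  have "S r \<le> S (r + 1)" using S(1) by (simp add: mono_def)
  then have "mcball_of X x (S r) \<subseteq> mcball_of X x (S (r + 1) + 1)"
    by (intro mcball_of_mono) (simp_all add: r)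
  then show "\<exists>c. homotopic_with (\<lambda>_. True)
            (subtopology (mtopology_of X) (mcball_of X x r))
            (subtopology (mtopology_of X) (mcball_of X x (S (r + 1) + 1))) (\<lambda>y. y) (\<lambda>_. c)"
    using homotopic_with_subtopology_mono[OF c] by blast
qed

section \<open>Filling small cycles of tuples\<close>

text \<open>The ordered simplices of the Vietoris-Rips complex of a ball at scale
  \<open>\<eta>\<close>; \<open>k\<close> counts vertices and is not the dimension.\<close>

definition rips :: "'a metric \<Rightarrow> 'a \<Rightarrow> real \<Rightarrow> real \<Rightarrow> nat \<Rightarrow> 'a list set" where
  "rips X x r \<eta> k = {\<tau>. length \<tau> = k \<and> set \<tau> \<subseteq> mcball_of X x r \<and>
     (\<forall>a\<in>set \<tau>. \<forall>b\<in>set \<tau>. mdist X a b \<le> \<eta>)}"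

lemma rips_mono:
  assumes "mcball_of X x r \<subseteq> mcball_of X y s" "\<eta> \<le> \<eta>'"
  shows "rips X x r \<eta> k \<subseteq> rips X y s \<eta>' k"
  using assms unfolding rips_def by fastforce

text \<open>The prisms between consecutive slices \<open>f j\<close> and \<open>f (Suc j)\<close>
  telescope. \<open>E\<close> is the smallness of the sets that are moved, \<open>E'\<close> that of
  the union of two consecutive images, which contains the prism.\<close>

lemma homotopy_chain_contiguous:
  fixes f :: "nat \<Rightarrow> 'v \<Rightarrow> 'w" and z :: "'v list \<Rightarrow>\<^sub>0 int"
  assumes "Bd z = 0" and z: "Poly_Mapping.keys z \<subseteq> {\<sigma>. length \<sigma> = k \<and> E (set \<sigma>)}"
    and f: "\<And>j A. j < m \<Longrightarrow> E A \<Longrightarrow> E' (f j ` A \<union> f (Suc j) ` A)"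
    and E': "\<And>A B. E' B \<Longrightarrow> A \<subseteq> B \<Longrightarrow> E' A"
  shows "\<exists>w. Poly_Mapping.keys w \<subseteq> {\<tau>. length \<tau> = Suc k \<and> E' (set \<tau>)} \<and>
    Bd w = frag_extend (\<lambda>\<sigma>. frag_of (map (f 0) \<sigma>)) z - frag_extend (\<lambda>\<sigma>. frag_of (map (f m) \<sigma>)) z"
  using f
proof (induction m)
  case 0
  show ?case by (intro exI[of _ 0]) simp
next
  case (Suc m)
  let ?F = "\<lambda>j. frag_extend (\<lambda>\<sigma>. frag_of (map (f j) \<sigma>)) z"
  obtain w where w: "Poly_Mapping.keys w \<subseteq> {\<tau>. length \<tau> = Suc k \<and> E' (set \<tau>)}" "Bd w = ?F 0 - ?F m"
    using Suc by auto
  obtain P where P: "\<And>\<sigma>. Poly_Mapping.keys (P \<sigma>) \<subseteq>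
        {\<tau>. set \<tau> \<subseteq> f m ` set \<sigma> \<union> f (Suc m) ` set \<sigma> \<and> length \<tau> = Suc (length \<sigma>)}"
      "\<And>\<sigma>. Bd (P \<sigma>) = (frag_of (map (f m) \<sigma>) - frag_of (map (f (Suc m)) \<sigma>)) - frag_extend P (bd \<sigma>)"
    using contiguous_chain_homotopy[of "f m" "f (Suc m)"] by blast
  have "Poly_Mapping.keys (frag_extend P z) \<subseteq> {\<tau>. length \<tau> = Suc k \<and> E' (set \<tau>)}"
  proof (rule keys_frag_extend_subset, rule subsetI)
    fix \<sigma> \<tau> assume "\<sigma> \<in> Poly_Mapping.keys z" "\<tau> \<in> Poly_Mapping.keys (P \<sigma>)"
    then have "length \<tau> = Suc k" "set \<tau> \<subseteq> f m ` set \<sigma> \<union> f (Suc m) ` set \<sigma>" "E (set \<sigma>)"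
      using P(1)[of \<sigma>] z by auto
    with E'[OF Suc.prems[of m "set \<sigma>"]] show "\<tau> \<in> {\<tau>. length \<tau> = Suc k \<and> E' (set \<tau>)}" by blast
  qed
  moreover have "Bd (frag_extend P z) = ?F m - ?F (Suc m)"
  proof -
    have "Bd (frag_extend P z) = frag_extend (\<lambda>\<sigma>. Bd (P \<sigma>)) z"
      by (simp add: Bd_def frag_extend_frag_extend)
    also have "\<dots> = ?F m - ?F (Suc m) - frag_extend P (Bd z)"
      unfolding P(2) frag_extend_fun_diff by (simp only: Bd_def frag_extend_frag_extend)
    finally show ?thesis using assms(1) by simp
  qed
  ultimately show ?case
    using w by (intro exI[of _ "w + frag_extend P z"]) (simp add: keys_add_subset)
qed

text \<open>A contraction of a compact ball is uniformly continuous on the cylinder over it, so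
  small tuples and fine time steps make consecutive slices jointly \<open>\<eta>\<close>-small. At
  time 1 every tuple is constant at \<open>c\<close>, and constant cycles are coned off from
  \<open>c\<close>.\<close>

lemma rips_fill:
  fixes X :: "'a metric"
  assumes X: "proper_metric X" and x: "x \<in> mspace X" and "\<eta> > 0"
    and hom: "homotopic_with (\<lambda>_. True)
            (subtopology (mtopology_of X) (mcball_of X x r))
            (subtopology (mtopology_of X) (mcball_of X x s)) (\<lambda>y. y) (\<lambda>_. c)"
  shows "\<exists>\<delta>>0. \<forall>k>0. \<forall>z. Poly_Mapping.keys z \<subseteq> rips X x r \<delta> k \<longrightarrow> Bd z = 0 \<longrightarrow>
    (\<exists>w. Poly_Mapping.keys w \<subseteq> rips X x s \<eta> (Suc k) \<and> Bd w = z)"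
proof -
  let ?B = "mcball_of X x r" and ?B' = "mcball_of X x s"
  let ?I = "submetric euclidean_metric {0..1::real}"
  obtain h where h: "continuous_map (prod_topology (top_of_set {0..1}) (subtopology (mtopology_of X) ?B))
        (subtopology (mtopology_of X) ?B') h"
      "\<And>y. h (0::real, y) = y" "\<And>y. h (1, y) = c"
    using hom unfolding homotopic_with_def by metis
  let ?P = "prod_metric ?I (submetric X ?B)"
  have tP: "mtopology_of ?P = prod_topology (top_of_set {0..1}) (subtopology (mtopology_of X) ?B)"
    by (simp add: mtopology_of_submetric)
  have "compact_space (mtopology_of ?P)"
    unfolding tP using X x
    by (simp add: compact_space_prod_topology compact_space_subtopology proper_metric_def)
  moreover have "continuous_map (mtopology_of ?P) (mtopology_of (submetric X ?B')) h"
    unfolding tP using h(1) by (simp add: mtopology_of_submetric)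
  ultimately have "uniformly_continuous_map ?P (submetric X ?B') h"
    by (intro continuous_imp_uniformly_continuous_map conjI)
  then obtain \<delta> where \<delta>: "\<delta> > 0" and uc: "\<And>u v. u \<in> mspace ?P \<Longrightarrow> v \<in> mspace ?P \<Longrightarrow>
        mdist ?P v u < \<delta> \<Longrightarrow> mdist X (h v) (h u) < \<eta>"
    and hB: "h \<in> mspace ?P \<rightarrow> mspace (submetric X ?B')"
    using \<open>\<eta> > 0\<close> unfolding uniformly_continuous_map_def mdist_submetric by metis
  \<comment> \<open>Of the modulus \<open>\<delta>\<close>, one half is reserved for the time step
    and one quarter for the diameter of the tuples.\<close>
  obtain m where m: "1 / real (Suc m) < \<delta> / 2"
    using \<delta> reals_Archimedean[of "\<delta> / 2"] by (auto simp: inverse_eq_divide)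
  have close: "mdist X (h (t, a)) (h (t', b)) \<le> \<eta>"
    if "a \<in> ?B" "b \<in> ?B" "mdist X a b \<le> \<delta> / 4" "t \<in> {0..1}" "t' \<in> {0..1}" "\<bar>t - t'\<bar> \<le> 1 / real (Suc m)" for a b t t'
  proof -
    interpret Metric_space12 "mspace ?I" "mdist ?I" "mspace (submetric X ?B)" "mdist (submetric X ?B)"
      by (rule Metric_space12_mspace_mdist)
    have "mdist ?P (t, a) (t', b) \<le> mdist ?I t t' + mdist (submetric X ?B) a b"
      unfolding mdist_prod_metric by (rule prod_metric_le_components) (use that in auto)
    also have "\<dots> < \<delta>" using that m by (simp add: dist_real_def)
    finally show ?thesis
      by (intro less_imp_le uc) (use that in auto)
  qed
  define f where "f j a = h (real j / real (Suc m), a)" for j a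
  define E where "E A \<longleftrightarrow> A \<subseteq> ?B \<and> (\<forall>a\<in>A. \<forall>b\<in>A. mdist X a b \<le> \<delta> / 4)" for A
  define E' where "E' A \<longleftrightarrow> A \<subseteq> ?B' \<and> (\<forall>a\<in>A. \<forall>b\<in>A. mdist X a b \<le> \<eta>)" for A
  have step: "E' (f j ` A \<union> f (Suc j) ` A)" if j: "j < Suc m" and A: "E A" for j A
  proof -
    let ?t = "real j / real (Suc m)" and ?t' = "real (Suc j) / real (Suc m)"
    have t: "?t \<in> {0..1}" "?t' \<in> {0..1}" using j by (auto simp: field_simps)
    have d: "\<bar>?t - ?t'\<bar> \<le> 1 / real (Suc m)" "\<bar>?t' - ?t\<bar> \<le> 1 / real (Suc m)"
      by (auto simp: diff_divide_distrib[symmetric] abs_if)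
    have d0: "\<bar>t - t\<bar> \<le> 1 / real (Suc m)" for t by simp
    have "h (t, a) \<in> ?B'" if "a \<in> A" "t \<in> {0..1}" for t a
      using hB that A by (auto simp: E_def Pi_iff)
    then have "f j ` A \<union> f (Suc j) ` A \<subseteq> ?B'" using t by (auto simp only: f_def)
    moreover have "mdist X u v \<le> \<eta>" if "u \<in> f j ` A \<union> f (Suc j) ` A" "v \<in> f j ` A \<union> f (Suc j) ` A" for u v
    proof -
      have A': "a \<in> ?B" "mdist X a b \<le> \<delta> / 4" if "a \<in> A" "b \<in> A" for a b
        using A that by (auto simp only: E_def)
      from that show ?thesis
        unfolding f_def using close[OF A'(1) A'(1) A'(2)] t d d0 by (auto simp only: Un_iff image_iff)
    qed
    ultimately show ?thesis by (simp only: E'_def) blast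
  qed
  have "\<exists>w. Poly_Mapping.keys w \<subseteq> rips X x s \<eta> (Suc k) \<and> Bd w = z"
    if k: "k > 0" and z: "Poly_Mapping.keys z \<subseteq> rips X x r (\<delta> / 4) k" "Bd z = 0" for z k
  proof (cases "z = 0")
    case True
    then show ?thesis by (intro exI[of _ 0]) simp
  next
    case False
    \<comment> \<open>The cone point must lie in the target ball: a nonzero \<open>z\<close>
      involves a tuple with a vertex, since \<open>k > 0\<close>, and the homotopy carries this
      vertex to \<open>c\<close>.\<close>
    then obtain \<sigma> where "\<sigma> \<in> Poly_Mapping.keys z" by fastforce
    then have "length \<sigma> = k" "set \<sigma> \<subseteq> ?B" using z(1) by (auto simp: rips_def)
    with k have "hd \<sigma> \<in> ?B" by (cases \<sigma>) auto
    then have "h (1, hd \<sigma>) \<in> ?B'" using hB by (auto simp: Pi_iff)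
    then have c: "c \<in> ?B'" by (simp add: h)
    have z': "Poly_Mapping.keys z \<subseteq> {\<sigma>. length \<sigma> = k \<and> E (set \<sigma>)}"
      using z(1) by (auto simp: rips_def E_def)
    obtain w1 where w1: "Poly_Mapping.keys w1 \<subseteq> {\<tau>. length \<tau> = Suc k \<and> E' (set \<tau>)}"
        "Bd w1 = frag_extend (\<lambda>\<sigma>. frag_of (map (f 0) \<sigma>)) z - frag_extend (\<lambda>\<sigma>. frag_of (map (f (Suc m)) \<sigma>)) z"
    proof -
      have "\<exists>w. Poly_Mapping.keys w \<subseteq> {\<tau>. length \<tau> = Suc k \<and> E' (set \<tau>)} \<and>
        Bd w = frag_extend (\<lambda>\<sigma>. frag_of (map (f 0) \<sigma>)) z - frag_extend (\<lambda>\<sigma>. frag_of (map (f (Suc m)) \<sigma>)) z"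
      proof (rule homotopy_chain_contiguous[where E=E and E'=E' and f=f and m="Suc m", OF z(2) z'])
        show "E' (f j ` A \<union> f (Suc j) ` A)" if "j < Suc m" "E A" for j A
          using that by (rule step)
        show "E' A" if "E' B" "A \<subseteq> B" for A B using that unfolding E'_def by blast
      qed
      then show thesis by (elim exE conjE) (rule that)
    qed
    have f0: "f 0 = (\<lambda>a. a)" and fm: "f (Suc m) = (\<lambda>a. c)"
      using h by (auto simp: f_def)
    let ?zc = "frag_extend (\<lambda>\<sigma>. frag_of (map (\<lambda>a. c) \<sigma>)) z"
    have "Bd ?zc = frag_extend (\<lambda>\<sigma>. bd (map (\<lambda>a. c) \<sigma>)) z"
      by (simp add: Bd_def frag_extend_frag_extend)
    also have "\<dots> = frag_extend (\<lambda>\<sigma>. frag_of (map (\<lambda>a. c) \<sigma>)) (Bd z)"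
      by (simp only: frag_extend_map_bd[symmetric] Bd_def frag_extend_frag_extend)
    finally have Bzc: "Bd ?zc = 0" using z(2) by simp
    have "Poly_Mapping.keys ?zc \<subseteq> {\<tau>. set \<tau> \<subseteq> {c} \<and> length \<tau> = k}"
      by (rule keys_frag_extend_subset) (use z' in auto)
    then obtain w2 where w2: "Poly_Mapping.keys w2 \<subseteq> {\<tau>. set \<tau> \<subseteq> {c} \<and> length \<tau> = Suc k}" "Bd w2 = ?zc"
      using fill_by_cone[OF Bzc, of c "{c}" k] by auto
    have "{\<tau>. length \<tau> = Suc k \<and> E' (set \<tau>)} \<subseteq> rips X x s \<eta> (Suc k)"
      by (auto simp: E'_def rips_def)
    moreover have "{\<tau>. set \<tau> \<subseteq> {c} \<and> length \<tau> = Suc k} \<subseteq> rips X x s \<eta> (Suc k)"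
    proof -
      have "mdist X a b \<le> \<eta>" if "a \<in> {c}" "b \<in> {c}" for a b using that c \<open>\<eta> > 0\<close> by auto
      moreover have "{c} \<subseteq> mcball_of X x s" using c by blast
      ultimately show ?thesis unfolding rips_def by blast
    qed
    ultimately have "Poly_Mapping.keys (w1 + w2) \<subseteq> rips X x s \<eta> (Suc k)"
      using w1(1) w2(1) by (intro keys_add_subset) blast+
    moreover have "Bd (w1 + w2) = z" by (simp add: w1 w2 f0 fm)
    ultimately show ?thesis by blast
  qed
  then show ?thesis using \<delta> by (intro exI[of _ "\<delta> / 4"]) auto
qed

text \<open>A finite net of \<open>K\<close> provides the centres: a ball about \<open>x\<close>
  sits in the ball of radius \<open>r + 1\<close> about a nearby centre, and the filling found there
  lies in a ball about \<open>x\<close> at the cost of 1 more. The least of finitely many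
  \<open>\<delta>\<close> works for all of them.\<close>

lemma rips_fill_uniform:
  fixes X :: "'a metric"
  assumes X: "proper_metric X" and S: "contraction_radius X S"
    and K: "compactin (mtopology_of X) K" and "r \<ge> 0" "\<eta> > 0"
  shows "\<exists>\<delta>>0. \<forall>x\<in>K. \<forall>k>0. \<forall>z. Poly_Mapping.keys z \<subseteq> rips X x r \<delta> k \<longrightarrow> Bd z = 0 \<longrightarrow>
    (\<exists>w. Poly_Mapping.keys w \<subseteq> rips X x (S (r + 1) + 1) \<eta> (Suc k) \<and> Bd w = z)"
proof -
  interpret M: Metric_space "mspace X" "mdist X" by simp
  have KX: "K \<subseteq> mspace X" using compactin_subset_topspace[OF K] by simp
  have "M.mtotally_bounded K"
    using K M.compactin_imp_mtotally_bounded by (simp add: mtopology_of_def)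
  then obtain C where C: "finite C" "C \<subseteq> K" "K \<subseteq> (\<Union>x\<in>C. M.mball x 1)"
    unfolding M.mtotally_bounded_def by (meson zero_less_one)
  have "\<exists>\<delta>>0. \<forall>k>0. \<forall>z. Poly_Mapping.keys z \<subseteq> rips X x (r + 1) \<delta> k \<longrightarrow> Bd z = 0 \<longrightarrow>
    (\<exists>w. Poly_Mapping.keys w \<subseteq> rips X x (S (r + 1)) \<eta> (Suc k) \<and> Bd w = z)" if "x \<in> C" for x
  proof -
    have x: "x \<in> mspace X" using that C KX by blast
    then obtain c where "homotopic_with (\<lambda>_. True)
            (subtopology (mtopology_of X) (mcball_of X x (r + 1)))
            (subtopology (mtopology_of X) (mcball_of X x (S (r + 1)))) (\<lambda>y. y) (\<lambda>_. c)"
      using S \<open>r \<ge> 0\<close> unfolding contraction_radius_def by force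
    from rips_fill[OF X x \<open>\<eta> > 0\<close> this] show ?thesis .
  qed
  then obtain \<delta> where \<delta>: "\<And>x. x \<in> C \<Longrightarrow> \<delta> x > 0"
    and fill: "\<And>x k z. x \<in> C \<Longrightarrow> k > 0 \<Longrightarrow> Poly_Mapping.keys z \<subseteq> rips X x (r + 1) (\<delta> x) k \<Longrightarrow> Bd z = 0 \<Longrightarrow>
    \<exists>w. Poly_Mapping.keys w \<subseteq> rips X x (S (r + 1)) \<eta> (Suc k) \<and> Bd w = z"
    by metis
  define d where "d = Min (insert 1 (\<delta> ` C))"
  have d: "d > 0" "\<And>x. x \<in> C \<Longrightarrow> d \<le> \<delta> x" using C(1) \<delta> by (auto simp: d_def)
  have "\<exists>w. Poly_Mapping.keys w \<subseteq> rips X x (S (r + 1) + 1) \<eta> (Suc k) \<and> Bd w = z"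
    if x: "x \<in> K" and k: "k > 0" and z: "Poly_Mapping.keys z \<subseteq> rips X x r d k" "Bd z = 0" for x k z
  proof -
    obtain y where y: "y \<in> C" "mdist X y x < 1" using C(3) x by auto
    have yX: "y \<in> mspace X" "x \<in> mspace X" using y C KX x by auto
    have "rips X x r d k \<subseteq> rips X y (r + 1) (\<delta> y) k"
      using y d yX by (intro rips_mono mcball_of_mono) auto
    then obtain w where w: "Poly_Mapping.keys w \<subseteq> rips X y (S (r + 1)) \<eta> (Suc k)" "Bd w = z"
      using fill[OF y(1) k _ z(2)] z(1) by blast
    have "rips X y (S (r + 1)) \<eta> (Suc k) \<subseteq> rips X x (S (r + 1) + 1) \<eta> (Suc k)"
      using y yX by (intro rips_mono mcball_of_mono) (auto simp: mdist_commute)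
    with w show ?thesis by blast
  qed
  with d(1) show ?thesis by blast
qed

text \<open>Bound for filling \<open>k\<close> points of diameter \<open>r\<close> near the first of
  them: faces are filled within the previous radius of their own heads, these heads lie within
  \<open>r\<close> of the first point, and contracting the resulting ball applies
  \<open>S\<close>.\<close>

primrec fill_radius :: "(real \<Rightarrow> real) \<Rightarrow> nat \<Rightarrow> real \<Rightarrow> real" where
  "fill_radius S 0 r = 0"
| "fill_radius S (Suc k) r = S (fill_radius S k r + r)"

lemma fill_radius_mono:
  assumes "mono S" "r \<le> r'"
  shows "fill_radius S k r \<le> fill_radius S k r'"
  using assms by (induction k) (simp_all add: monoD add_mono)

lemma fill_radius_Suc_ge:
  assumes "\<And>r. r \<le> S r" shows "fill_radius S k r + r \<le> fill_radius S (Suc k) r"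
  by (simp add: assms)

lemma fill_radius_nonneg:
  assumes "\<And>r. r \<le> S r" "0 \<le> r" shows "0 \<le> fill_radius S k r"
proof (induction k)
  case (Suc k)
  then show ?case using assms(1)[of "fill_radius S k r + r"] assms(2) by simp
qed simp

definition tdiam :: "'a metric \<Rightarrow> 'a set \<Rightarrow> real" where
  "tdiam X A = Max (insert 0 ((\<lambda>(a, b). mdist X a b) ` (A \<times> A)))"

lemma tdiam_upper: "finite A \<Longrightarrow> a \<in> A \<Longrightarrow> b \<in> A \<Longrightarrow> mdist X a b \<le> tdiam X A"
  unfolding tdiam_def by (rule Max_ge) auto

lemma tdiam_nonneg: "finite A \<Longrightarrow> 0 \<le> tdiam X A"
  unfolding tdiam_def by (rule Max_ge) auto

lemma tdiam_least: "finite A \<Longrightarrow> 0 \<le> d \<Longrightarrow> (\<And>a b. a \<in> A \<Longrightarrow> b \<in> A \<Longrightarrow> mdist X a b \<le> d) \<Longrightarrow> tdiam X A \<le> d"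
  unfolding tdiam_def by (subst Max_le_iff) auto

lemma tdiam_mono: "finite B \<Longrightarrow> A \<subseteq> B \<Longrightarrow> tdiam X A \<le> tdiam X B"
  by (intro tdiam_least tdiam_nonneg tdiam_upper) (auto intro: finite_subset)

lemma vertices_of_subset:
  assumes "s ` standard_simplex p \<subseteq> V" shows "set (vertices_of p s) \<subseteq> V"
  using assms by (auto simp: vertices_of_def image_subset_iff simp del: upt_Suc)

lemma length_vertices_of [simp]: "length (vertices_of p s) = Suc p"
  by (simp add: vertices_of_def del: upt_Suc)

text \<open>The fillings of the faces of \<open>\<sigma>\<close> add up to a reduced cycle in a ball
  about \<open>hd \<sigma>\<close>, which is contractible in the next larger ball. Only the pieces
  of the filling are small, the tuple itself may have any diameter.\<close>

lemma small_singular_filling: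
  fixes X :: "'a metric"
  assumes S: "contraction_radius X S"
    and \<C>: "\<And>V. V \<in> \<C> \<Longrightarrow> openin (mtopology_of X) V" "mspace X \<subseteq> \<Union>\<C>"
  shows "\<exists>F. \<forall>\<sigma>. set \<sigma> \<subseteq> mspace X \<longrightarrow> \<sigma> \<noteq> [] \<longrightarrow>
     small_chain (length \<sigma> - 1) (subtopology (mtopology_of X)
        (mcball_of X (hd \<sigma>) (fill_radius S (length \<sigma>) (tdiam X (set \<sigma>))))) \<C> (F \<sigma>) \<and>
     (length \<sigma> = 1 \<longrightarrow> (\<exists>x. F \<sigma> = frag_of x)) \<and>
     (length \<sigma> \<ge> 2 \<longrightarrow> chain_boundary (length \<sigma> - 1) (F \<sigma>) = frag_extend F (bd \<sigma>))"
proof -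
  let ?B = "\<lambda>\<sigma>. mcball_of X (hd \<sigma>) (fill_radius S (length \<sigma>) (tdiam X (set \<sigma>)))"
  let ?T = "\<lambda>B. subtopology (mtopology_of X) B"
  \<comment> \<open>A vertex is filled by a single singular simplex, not by an arbitrary 0-chain;
    this normalisation makes the augmentation vanish over the boundary of an edge. No boundary
    condition is imposed below length 2.\<close>
  define R where "R \<sigma> z w \<longleftrightarrow> (\<sigma> \<noteq> [] \<longrightarrow> small_chain (length \<sigma> - 1) (?T (?B \<sigma>)) \<C> w \<and>
     (length \<sigma> = 1 \<longrightarrow> (\<exists>x. w = frag_of x)) \<and>
     (length \<sigma> \<ge> 2 \<longrightarrow> chain_boundary (length \<sigma> - 1) w = z))" for \<sigma> z w
  define D where "D = {\<sigma>. set \<sigma> \<subseteq> mspace X}"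
  have S': "mono S" "\<And>r. r \<le> S r" using S by (auto simp: contraction_radius_def)
  have "\<exists>h. \<forall>\<sigma>\<in>D. R \<sigma> (frag_extend h (bd \<sigma>)) (h \<sigma>)"
  proof (rule chain_recursion)
    fix \<sigma> \<tau> :: "'a list" assume "\<sigma> \<in> D" "\<tau> \<in> Poly_Mapping.keys (bd \<sigma>)"
    then show "\<tau> \<in> D" using keys_bd[of \<tau> \<sigma>] by (auto simp: D_def)
  next
    fix \<sigma> and h :: "'a list \<Rightarrow> 'a chain"
    assume "\<sigma> \<in> D" and IH: "\<And>\<tau>. \<tau> \<in> Poly_Mapping.keys (bd \<sigma>) \<Longrightarrow> \<tau> \<in> D \<and> R \<tau> (frag_extend h (bd \<tau>)) (h \<tau>)"
    then have \<sigma>: "set \<sigma> \<subseteq> mspace X" by (simp add: D_def)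
    let ?d = "tdiam X (set \<sigma>)"
    have d: "0 \<le> ?d" by (simp add: tdiam_nonneg)
    consider "\<sigma> = []" | "length \<sigma> = 1" | p where "length \<sigma> = Suc (Suc p)"
      by (metis One_nat_def length_0_conv not0_implies_Suc)
    then show "\<exists>w. R \<sigma> (frag_extend h (bd \<sigma>)) w"
    proof cases
      case 1
      then show ?thesis by (simp add: R_def)
    next
      case 2
      let ?x = "hd \<sigma>"
      have x: "?x \<in> mspace X" using \<sigma> 2 by (cases \<sigma>) auto
      let ?s = "restrict (\<lambda>_. ?x) (standard_simplex 0)"
      have "?x \<in> ?B \<sigma>" using x d fill_radius_nonneg[of S ?d, OF S'(2) d] by simp
      then have "singular_simplex 0 (?T (?B \<sigma>)) ?s"
        using x by (auto simp: singular_simplex_def)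
      moreover obtain V where "V \<in> \<C>" "?x \<in> V" using \<C>(2) x by blast
      ultimately have "small_chain 0 (?T (?B \<sigma>)) \<C> (frag_of ?s)"
        by (auto simp: small_chain_def singular_chain_of)
      with 2 show ?thesis by (intro exI[of _ "frag_of ?s"]) (auto simp: R_def)
    next
      case 3
      let ?z = "frag_extend h (bd \<sigma>)"
      have hd\<sigma>: "hd \<sigma> \<in> set \<sigma>" using 3 by (cases \<sigma>) auto
      then have x: "hd \<sigma> \<in> mspace X" using \<sigma> by blast
      let ?r = "fill_radius S (Suc p) ?d + ?d"
      have r: "0 \<le> ?r" using d fill_radius_nonneg[of S ?d, OF S'(2) d] by (simp del: fill_radius.simps)
      have f: "length \<tau> = Suc p \<and> set \<tau> \<subseteq> set \<sigma> \<and> \<tau> \<noteq> [] \<and>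
          small_chain p (?T (?B \<tau>)) \<C> (h \<tau>) \<and> ?B \<tau> \<subseteq> mcball_of X (hd \<sigma>) ?r \<and>
          (p = 0 \<longrightarrow> (\<exists>x. h \<tau> = frag_of x)) \<and> (p > 0 \<longrightarrow> chain_boundary p (h \<tau>) = frag_extend h (bd \<tau>))"
        if \<tau>: "\<tau> \<in> Poly_Mapping.keys (bd \<sigma>)" for \<tau>
      proof -
        have l: "length \<tau> = Suc p" "set \<tau> \<subseteq> set \<sigma>" "\<tau> \<noteq> []" using keys_bd[OF \<tau>] 3 by auto
        then have "hd \<tau> \<in> set \<sigma>" using hd_in_set by blast
        then have "mdist X (hd \<sigma>) (hd \<tau>) \<le> ?d" using hd\<sigma> by (intro tdiam_upper) auto
        moreover have "fill_radius S (Suc p) (tdiam X (set \<tau>)) \<le> fill_radius S (Suc p) ?d"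
          by (intro fill_radius_mono S' tdiam_mono l) simp
        ultimately have "?B \<tau> \<subseteq> mcball_of X (hd \<sigma>) ?r"
          using l x by (intro mcball_of_mono) simp_all
        moreover have "R \<tau> (frag_extend h (bd \<tau>)) (h \<tau>)" using IH \<tau> by blast
        ultimately show ?thesis using l by (auto simp: R_def)
      qed
      have sz: "small_chain p (?T (mcball_of X (hd \<sigma>) ?r)) \<C> ?z"
        by (rule small_chain_extend) (use f small_chain_mono in blast)
      have rz: "reduced_cycle p ?z"
      proof (cases "p = 0")
        case True
        \<comment> \<open>The two vertices of an edge contribute augmentation 1 each, with opposite
          signs.\<close>
        have "eval_chain (\<lambda>_. 1) ?z = eval_chain (\<lambda>\<tau>. 1) (bd \<sigma>)"
          unfolding eval_chain_frag_extend
        proof (rule eval_chain_cong)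
          fix \<tau> assume "\<tau> \<in> Poly_Mapping.keys (bd \<sigma>)"
          then obtain x where "h \<tau> = frag_of x" using f True by blast
          then show "eval_chain (\<lambda>_. 1) (h \<tau>) = 1" by simp
        qed
        also have "\<dots> = 0" using 3 True by (simp add: eval_chain_bd)
        finally show ?thesis using True by (simp add: reduced_cycle_def chain_boundary_def)
      next
        case False
        have cb: "chain_boundary p (frag_extend h u) = frag_extend (\<lambda>\<tau>. chain_boundary p (h \<tau>)) u" for u :: "'a list \<Rightarrow>\<^sub>0 int"
          by (induction u rule: frag_induction[OF subset_UNIV]) (simp_all add: frag_extend_diff chain_boundary_diff)
        have "chain_boundary p ?z = frag_extend (\<lambda>\<tau>. chain_boundary p (h \<tau>)) (bd \<sigma>)"
          by (rule cb)
        also have "\<dots> = frag_extend (\<lambda>\<tau>. frag_extend h (bd \<tau>)) (bd \<sigma>)"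
          by (rule frag_extend_eq) (use f False in auto)
        also have "\<dots> = frag_extend h (Bd (bd \<sigma>))"
          by (simp only: Bd_def frag_extend_frag_extend)
        finally show ?thesis using False by (simp add: reduced_cycle_def)
      qed
      obtain c where c: "homotopic_with (\<lambda>_. True) (?T (mcball_of X (hd \<sigma>) ?r))
          (?T (mcball_of X (hd \<sigma>) (S ?r))) (\<lambda>y. y) (\<lambda>_. c)"
        using S x r unfolding contraction_radius_def by blast
      have "mcball_of X (hd \<sigma>) ?r \<subseteq> mcball_of X (hd \<sigma>) (S ?r)"
        using x S'(2)[of ?r] by (intro mcball_of_mono) simp_all
      from small_fill_nullhomotopic[OF c this \<C>(1) _ sz rz] \<C>(2) 
      obtain w where "small_chain (Suc p) (?T (mcball_of X (hd \<sigma>) (S ?r))) \<C> w" "chain_boundary (Suc p) w = ?z"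
        by auto
      with 3 show ?thesis by (intro exI[of _ w]) (simp add: R_def)
    qed
  qed
  then show ?thesis unfolding R_def D_def by blast
qed

text \<open>The singular fillings read off on vertices give an augmented chain map defined on tuples
  of every size, with values supported on \<open>\<C>\<close>-small tuples. The augmentation is
  preserved because a vertex is sent to a single vertex.\<close>

lemma small_filling_map:
  fixes X :: "'a metric"
  assumes S: "contraction_radius X S"
    and \<C>: "\<And>V. V \<in> \<C> \<Longrightarrow> openin (mtopology_of X) V" "mspace X \<subseteq> \<Union>\<C>"
  shows "\<exists>\<Phi>. \<Phi> [] = frag_of [] \<and> (\<forall>\<sigma>. set \<sigma> \<subseteq> mspace X \<longrightarrow>
     Poly_Mapping.keys (\<Phi> \<sigma>) \<subseteq> {\<tau>. length \<tau> = length \<sigma> \<and> (\<sigma> \<noteq> [] \<longrightarrow>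
        set \<tau> \<subseteq> mcball_of X (hd \<sigma>) (fill_radius S (length \<sigma>) (tdiam X (set \<sigma>))) \<and> (\<exists>V\<in>\<C>. set \<tau> \<subseteq> V))} \<and>
     Bd (\<Phi> \<sigma>) = frag_extend \<Phi> (bd \<sigma>))"
proof -
  let ?B = "\<lambda>\<sigma>. mcball_of X (hd \<sigma>) (fill_radius S (length \<sigma>) (tdiam X (set \<sigma>)))"
  obtain F where F: "\<And>\<sigma>. set \<sigma> \<subseteq> mspace X \<Longrightarrow> \<sigma> \<noteq> [] \<Longrightarrow>
     small_chain (length \<sigma> - 1) (subtopology (mtopology_of X) (?B \<sigma>)) \<C> (F \<sigma>)"
     "\<And>\<sigma>. set \<sigma> \<subseteq> mspace X \<Longrightarrow> length \<sigma> = 1 \<Longrightarrow> \<exists>x. F \<sigma> = frag_of x"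
     "\<And>\<sigma>. set \<sigma> \<subseteq> mspace X \<Longrightarrow> length \<sigma> \<ge> 2 \<Longrightarrow>
        chain_boundary (length \<sigma> - 1) (F \<sigma>) = frag_extend F (bd \<sigma>)"
  proof -
    obtain F where F: "\<And>\<sigma>. set \<sigma> \<subseteq> mspace X \<Longrightarrow> \<sigma> \<noteq> [] \<Longrightarrow>
       small_chain (length \<sigma> - 1) (subtopology (mtopology_of X) (?B \<sigma>)) \<C> (F \<sigma>) \<and>
       (length \<sigma> = 1 \<longrightarrow> (\<exists>x. F \<sigma> = frag_of x)) \<and>
       (length \<sigma> \<ge> 2 \<longrightarrow> chain_boundary (length \<sigma> - 1) (F \<sigma>) = frag_extend F (bd \<sigma>))"
      using small_singular_filling[OF S \<C>] by blast
    show thesis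
    proof (rule that)
      fix \<sigma> assume \<sigma>: "set \<sigma> \<subseteq> mspace X"
      show "\<sigma> \<noteq> [] \<Longrightarrow> small_chain (length \<sigma> - 1) (subtopology (mtopology_of X) (?B \<sigma>)) \<C> (F \<sigma>)"
        using F[OF \<sigma>] by blast
      show "length \<sigma> = 1 \<Longrightarrow> \<exists>x. F \<sigma> = frag_of x" using F[OF \<sigma>] by (cases \<sigma>) auto
      show "length \<sigma> \<ge> 2 \<Longrightarrow> chain_boundary (length \<sigma> - 1) (F \<sigma>) = frag_extend F (bd \<sigma>)"
        using F[OF \<sigma>] by (cases \<sigma>) auto
    qed
  qed
  define \<Phi> where "\<Phi> \<sigma> = (if \<sigma> = [] then frag_of [] else
      frag_extend (\<lambda>s. frag_of (vertices_of (length \<sigma> - 1) s)) (F \<sigma>))" for \<sigma>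
  have keys: "length \<tau> = length \<sigma> \<and> (\<sigma> \<noteq> [] \<longrightarrow> set \<tau> \<subseteq> ?B \<sigma> \<and> (\<exists>V\<in>\<C>. set \<tau> \<subseteq> V))"
    if \<sigma>: "set \<sigma> \<subseteq> mspace X" and \<tau>: "\<tau> \<in> Poly_Mapping.keys (\<Phi> \<sigma>)" for \<sigma> \<tau>
  proof (cases "\<sigma> = []")
    case True
    with \<tau> show ?thesis by (simp add: \<Phi>_def)
  next
    case False
    then obtain s where s: "s \<in> Poly_Mapping.keys (F \<sigma>)" "\<tau> = vertices_of (length \<sigma> - 1) s"
      using \<tau> keys_frag_extend[of "\<lambda>s. frag_of (vertices_of (length \<sigma> - 1) s)" "F \<sigma>"] by (auto simp: \<Phi>_def)
    have "s ` standard_simplex (length \<sigma> - 1) \<subseteq> ?B \<sigma>"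
      using F(1)[OF \<sigma> False] s(1) unfolding small_chain_def singular_chain_subtopology by blast
    moreover obtain V where "V \<in> \<C>" "s ` standard_simplex (length \<sigma> - 1) \<subseteq> V"
      using F(1)[OF \<sigma> False] s(1) unfolding small_chain_def by blast
    ultimately have "set \<tau> \<subseteq> ?B \<sigma>" "set \<tau> \<subseteq> V" "V \<in> \<C>"
      unfolding s(2) by (simp_all only: vertices_of_subset)
    with s(2) False show ?thesis by auto
  qed
  have "Bd (\<Phi> \<sigma>) = frag_extend \<Phi> (bd \<sigma>)" if \<sigma>: "set \<sigma> \<subseteq> mspace X" for \<sigma>
  proof -
    consider "\<sigma> = []" | "length \<sigma> = 1" | p where "length \<sigma> = Suc (Suc p)"
      by (metis One_nat_def length_0_conv not0_implies_Suc)
    then show ?thesis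
    proof cases
      case 1
      then show ?thesis by (simp add: \<Phi>_def)
    next
      case 2
      then obtain s where "F \<sigma> = frag_of s" using F(2)[OF \<sigma>] by blast
      moreover have "length (vertices_of 0 s) = 1" by simp
      ultimately show ?thesis using 2 by (auto simp: \<Phi>_def bd_length_1)
    next
      case 3
      then have "Bd (\<Phi> \<sigma>) = frag_extend (\<lambda>s. bd (vertices_of (Suc p) s)) (F \<sigma>)"
        by (auto simp: \<Phi>_def Bd_def frag_extend_frag_extend)
      also have "\<dots> = frag_extend (\<lambda>s. frag_of (vertices_of p s)) (frag_extend F (bd \<sigma>))"
        using F(3)[OF \<sigma>] 3 by (simp add: bd_vertices_of[symmetric])
      also have "\<dots> = frag_extend (\<lambda>\<tau>. frag_extend (\<lambda>s. frag_of (vertices_of p s)) (F \<tau>)) (bd \<sigma>)"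
        by (rule frag_extend_frag_extend)
      also have "\<dots> = frag_extend \<Phi> (bd \<sigma>)"
      proof (rule frag_extend_eq)
        fix \<tau> assume "\<tau> \<in> Poly_Mapping.keys (bd \<sigma>)"
        then have "length \<tau> = Suc p" using keys_bd[of \<tau> \<sigma>] 3 by auto
        then show "frag_extend (\<lambda>s. frag_of (vertices_of p s)) (F \<tau>) = \<Phi> \<tau>"
          by (auto simp: \<Phi>_def)
      qed
      finally show ?thesis .
    qed
  qed
  moreover have "\<Phi> [] = frag_of []" by (simp add: \<Phi>_def)
  ultimately show ?thesis using keys by (intro exI[of _ \<Phi>]) blast
qed

section \<open>Families of sets that are small at every place and arbitrarily large at infinity\<close>

text \<open>The clauses abstract the behaviour of the sets on which finitely many Higson functions
  vary by less than a fixed amount: the second is uniform continuity on bounded sets, the third is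
  vanishing oscillation at infinity.\<close>

definition slow_family :: "'a metric \<Rightarrow> 'a \<Rightarrow> 'a set set \<Rightarrow> bool" where
  "slow_family X q \<K> \<longleftrightarrow>
     (\<forall>A\<in>\<K>. \<forall>B\<subseteq>A. B \<in> \<K>) \<and>
     (\<forall>R. \<exists>\<eta>>0. \<forall>A. finite A \<longrightarrow> A \<subseteq> mcball_of X q R \<longrightarrow>
        (\<forall>a\<in>A. \<forall>b\<in>A. mdist X a b \<le> \<eta>) \<longrightarrow> A \<in> \<K>) \<and>
     (\<forall>R. \<exists>R'. \<forall>x\<in>mspace X. mdist X q x > R' \<longrightarrow>
        (\<forall>A. finite A \<longrightarrow> A \<subseteq> mcball_of X x R \<longrightarrow> A \<in> \<K>))"

lemma slow_familyI:
  assumes "\<And>A B. A \<in> \<K> \<Longrightarrow> B \<subseteq> A \<Longrightarrow> B \<in> \<K>"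
    and "\<And>R. \<exists>\<eta>>0. \<forall>A. finite A \<longrightarrow> A \<subseteq> mcball_of X q R \<longrightarrow>
        (\<forall>a\<in>A. \<forall>b\<in>A. mdist X a b \<le> \<eta>) \<longrightarrow> A \<in> \<K>"
    and "\<And>R. \<exists>R'. \<forall>x\<in>mspace X. mdist X q x > R' \<longrightarrow>
        (\<forall>A. finite A \<longrightarrow> A \<subseteq> mcball_of X x R \<longrightarrow> A \<in> \<K>)"
  shows "slow_family X q \<K>"
  unfolding slow_family_def
proof (intro conjI ballI allI impI)
  show "B \<in> \<K>" if "A \<in> \<K>" "B \<subseteq> A" for A B using that by (rule assms(1))
qed (fact assms(2), fact assms(3))

lemma slow_family_subset:
  assumes "slow_family X q \<K>" "A \<in> \<K>" "B \<subseteq> A" shows "B \<in> \<K>"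
proof -
  have "\<forall>A\<in>\<K>. \<forall>B\<subseteq>A. B \<in> \<K>" using assms(1) unfolding slow_family_def by (elim conjE)
  with assms(2,3) show ?thesis by blast
qed

lemma slow_family_local:
  assumes "slow_family X q \<K>"
  obtains \<eta> where "\<eta> > 0"
    "\<And>A. finite A \<Longrightarrow> A \<subseteq> mcball_of X q R \<Longrightarrow> \<forall>a\<in>A. \<forall>b\<in>A. mdist X a b \<le> \<eta> \<Longrightarrow> A \<in> \<K>"
proof -
  have "\<exists>\<eta>>0. \<forall>A. finite A \<longrightarrow> A \<subseteq> mcball_of X q R \<longrightarrow>
        (\<forall>a\<in>A. \<forall>b\<in>A. mdist X a b \<le> \<eta>) \<longrightarrow> A \<in> \<K>"
    using assms unfolding slow_family_def by (elim conjE) (erule_tac x=R in allE, assumption)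
  then obtain \<eta> where "\<eta> > 0" "\<forall>A. finite A \<longrightarrow> A \<subseteq> mcball_of X q R \<longrightarrow>
        (\<forall>a\<in>A. \<forall>b\<in>A. mdist X a b \<le> \<eta>) \<longrightarrow> A \<in> \<K>" by (elim exE conjE)
  then show thesis by (intro that[of \<eta>]) simp_all
qed

lemma slow_family_far:
  assumes "slow_family X q \<K>"
  obtains R' where "\<And>x A. x \<in> mspace X \<Longrightarrow> mdist X q x > R' \<Longrightarrow> finite A \<Longrightarrow> A \<subseteq> mcball_of X x R \<Longrightarrow> A \<in> \<K>"
proof -
  have "\<exists>R'. \<forall>x\<in>mspace X. mdist X q x > R' \<longrightarrow>
        (\<forall>A. finite A \<longrightarrow> A \<subseteq> mcball_of X x R \<longrightarrow> A \<in> \<K>)"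
    using assms unfolding slow_family_def by (elim conjE) (erule_tac x=R in allE, assumption)
  then obtain R' where "\<forall>x\<in>mspace X. mdist X q x > R' \<longrightarrow>
        (\<forall>A. finite A \<longrightarrow> A \<subseteq> mcball_of X x R \<longrightarrow> A \<in> \<K>)" by (elim exE)
  then show thesis by (intro that[of R']) simp
qed

lemma slow_family_Int:
  assumes "slow_family X q \<K>" "slow_family X q \<L>"
  shows "slow_family X q (\<K> \<inter> \<L>)"
proof (rule slow_familyI)
  fix A B assume "A \<in> \<K> \<inter> \<L>" "B \<subseteq> A"
  then show "B \<in> \<K> \<inter> \<L>"
    using slow_family_subset[OF assms(1), of A B] slow_family_subset[OF assms(2), of A B] by simp
next
  fix R
  obtain \<eta>1 where 1: "\<eta>1 > 0"
    "\<And>A. finite A \<Longrightarrow> A \<subseteq> mcball_of X q R \<Longrightarrow> \<forall>a\<in>A. \<forall>b\<in>A. mdist X a b \<le> \<eta>1 \<Longrightarrow> A \<in> \<K>"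
    by (rule slow_family_local[OF assms(1), of R]) (rule that)
  obtain \<eta>2 where 2: "\<eta>2 > 0"
    "\<And>A. finite A \<Longrightarrow> A \<subseteq> mcball_of X q R \<Longrightarrow> \<forall>a\<in>A. \<forall>b\<in>A. mdist X a b \<le> \<eta>2 \<Longrightarrow> A \<in> \<L>"
    by (rule slow_family_local[OF assms(2), of R]) (rule that)
  show "\<exists>\<eta>>0. \<forall>A. finite A \<longrightarrow> A \<subseteq> mcball_of X q R \<longrightarrow>
        (\<forall>a\<in>A. \<forall>b\<in>A. mdist X a b \<le> \<eta>) \<longrightarrow> A \<in> \<K> \<inter> \<L>"
    by (rule exI[of _ "min \<eta>1 \<eta>2"]) (use 1 2 in auto)
next
  fix R
  obtain R1 where 1: "\<And>x A. x \<in> mspace X \<Longrightarrow> mdist X q x > R1 \<Longrightarrow> finite A \<Longrightarrow> A \<subseteq> mcball_of X x R \<Longrightarrow> A \<in> \<K>"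
    by (rule slow_family_far[OF assms(1), of R]) (rule that)
  obtain R2 where 2: "\<And>x A. x \<in> mspace X \<Longrightarrow> mdist X q x > R2 \<Longrightarrow> finite A \<Longrightarrow> A \<subseteq> mcball_of X x R \<Longrightarrow> A \<in> \<L>"
    by (rule slow_family_far[OF assms(2), of R]) (rule that)
  show "\<exists>R'. \<forall>x\<in>mspace X. mdist X q x > R' \<longrightarrow>
        (\<forall>A. finite A \<longrightarrow> A \<subseteq> mcball_of X x R \<longrightarrow> A \<in> \<K> \<inter> \<L>)"
    by (rule exI[of _ "max R1 R2"]) (use 1 2 in auto)
qed

text \<open>A cycle of \<open>k\<close>-tuples at scale \<open>\<delta> k\<close> is to be filled at
  scale \<open>\<delta> (Suc k)\<close>, so the scale for longer tuples dictates the one for shorter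
  tuples and the choice runs downwards from \<open>N\<close>.\<close>

lemma fill_scales_exist:
  fixes X :: "'a metric"
  assumes X: "proper_metric X" and S: "contraction_radius X S"
    and K: "compactin (mtopology_of X) K" and "\<eta> > 0"
  defines "S2 \<equiv> \<lambda>r. S (r + 1) + 1"
  shows "\<exists>\<delta> :: nat \<Rightarrow> real. (\<forall>k. 0 < \<delta> k \<and> \<delta> k \<le> 1 \<and> \<delta> k \<le> \<eta>) \<and> (\<forall>k l. 0 < k \<longrightarrow> k \<le> l \<longrightarrow> l \<le> N \<longrightarrow> \<delta> k \<le> \<delta> l) \<and>
    (\<forall>k x z. 0 < k \<longrightarrow> k < N \<longrightarrow> x \<in> K \<longrightarrow>
      Poly_Mapping.keys z \<subseteq> rips X x (fill_radius S2 k 1 + 1) (\<delta> k) k \<longrightarrow> Bd z = 0 \<longrightarrow>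
      (\<exists>w. Poly_Mapping.keys w \<subseteq> rips X x (fill_radius S2 (Suc k) 1) (\<delta> (Suc k)) (Suc k) \<and> Bd w = z))"
proof -
  have S2: "\<And>r. r \<le> S2 r" using contraction_radius_shift[OF S] by (auto simp: contraction_radius_def S2_def)
  define fills where "fills k d e \<longleftrightarrow> (\<forall>x\<in>K. \<forall>z. 0 < k \<longrightarrow>
      Poly_Mapping.keys z \<subseteq> rips X x (fill_radius S2 k 1 + 1) d k \<longrightarrow> Bd z = 0 \<longrightarrow>
      (\<exists>w. Poly_Mapping.keys w \<subseteq> rips X x (fill_radius S2 (Suc k) 1) e (Suc k) \<and> Bd w = z))" for k and d e :: real
  \<comment> \<open>\<open>e j\<close> is the scale for tuples of length \<open>N - j\<close>; the
    reversal turns the downward choice into a forward recursion.\<close>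
  have "\<exists>e. \<forall>j. (0 < e j \<and> e j \<le> 1 \<and> e j \<le> \<eta>) \<and> (e (Suc j) \<le> e j \<and> fills (N - Suc j) (e (Suc j)) (e j))"
  proof (rule dependent_nat_choice)
    show "\<exists>x. 0 < x \<and> x \<le> 1 \<and> x \<le> \<eta>" using \<open>\<eta> > 0\<close> by (intro exI[of _ "min 1 \<eta>"]) auto
    fix e :: real and j assume e: "0 < e \<and> e \<le> 1 \<and> e \<le> \<eta>"
    let ?k = "N - Suc j"
    have r: "0 \<le> fill_radius S2 ?k 1 + 1" using fill_radius_nonneg[of S2 1 ?k] S2 by simp
    obtain d where d: "d > 0" "\<forall>x\<in>K. \<forall>k>0. \<forall>z. Poly_Mapping.keys z \<subseteq> rips X x (fill_radius S2 ?k 1 + 1) d k \<longrightarrow> Bd z = 0 \<longrightarrow>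
      (\<exists>w. Poly_Mapping.keys w \<subseteq> rips X x (S ((fill_radius S2 ?k 1 + 1) + 1) + 1) e (Suc k) \<and> Bd w = z)"
      using rips_fill_uniform[OF X S K r, of e] e by blast
    have "fill_radius S2 (Suc ?k) 1 = S ((fill_radius S2 ?k 1 + 1) + 1) + 1"
      by (simp add: S2_def)
    with d(2) have f: "fills ?k d e" unfolding fills_def by simp
    have "fills ?k (min d e) e"
      unfolding fills_def
    proof (intro ballI allI impI)
      fix x z assume "x \<in> K" "0 < ?k" "Poly_Mapping.keys z \<subseteq> rips X x (fill_radius S2 ?k 1 + 1) (min d e) ?k" "Bd z = 0"
      moreover have "rips X x (fill_radius S2 ?k 1 + 1) (min d e) ?k \<subseteq> rips X x (fill_radius S2 ?k 1 + 1) d ?k"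
        by (rule rips_mono) auto
      ultimately show "\<exists>w. Poly_Mapping.keys w \<subseteq> rips X x (fill_radius S2 (Suc ?k) 1) e (Suc ?k) \<and> Bd w = z"
        using f unfolding fills_def by blast
    qed
    with d(1) e show "\<exists>d. (0 < d \<and> d \<le> 1 \<and> d \<le> \<eta>) \<and> (d \<le> e \<and> fills ?k d e)"
      by (intro exI[of _ "min d e"]) auto
  qed
  then obtain e where e: "\<And>j. 0 < e j" "\<And>j. e j \<le> 1" "\<And>j. e j \<le> \<eta>" "\<And>j. e (Suc j) \<le> e j"
    "\<And>j. fills (N - Suc j) (e (Suc j)) (e j)" by blast
  have mono: "e j \<le> e i" if "i \<le> j" for i j using lift_Suc_antimono_le[of e, OF e(4) that] .
  show ?thesis
  proof (rule exI[of _ "\<lambda>k. e (N - k)"], intro conjI allI impI)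
    fix k x z assume k: "0 < k" "k < N" "x \<in> K"
      and z: "Poly_Mapping.keys z \<subseteq> rips X x (fill_radius S2 k 1 + 1) (e (N - k)) k" "Bd z = 0"
    define j where "j = N - Suc k"
    have j: "N - k = Suc j" "N - Suc j = k" "N - Suc k = j" using k by (auto simp: j_def)
    have "fills k (e (N - k)) (e (N - Suc k))" using e(5)[of j] j by simp
    with k z show "\<exists>w. Poly_Mapping.keys w \<subseteq> rips X x (fill_radius S2 (Suc k) 1) (e (N - Suc k)) (Suc k) \<and> Bd w = z"
      unfolding fills_def by blast
  qed (auto intro: e mono)
qed

text \<open>The complex of all tuples is acyclic, being a cone from \<open>q\<close>, but the
  cocycle condition for \<open>c\<close> is available only on \<open>\<K>\<close>. Composed with
  \<open>\<Phi>\<close>, the cochain \<open>c\<close> can be used on tuples of any size, in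
  particular on \<open>q # \<sigma>\<close>. The loss from \<open>\<K>\<close> to
  \<open>\<L>\<close> comes from the homotopy between \<open>\<sigma>\<close> and
  \<open>\<Phi> \<sigma>\<close>, whose tuples must still belong to \<open>\<K>\<close>.\<close>

lemma slow_cocycle_trivial:
  fixes X :: "'a metric" and c :: "'a list \<Rightarrow> int" and m :: int
  assumes X: "proper_metric X" and S0: "contraction_radius X S0" and q: "q \<in> mspace X"
    and \<K>: "slow_family X q \<K>"
    and cocycle: "\<And>\<sigma>. length \<sigma> = n + 2 \<Longrightarrow> set \<sigma> \<in> \<K> \<Longrightarrow> m dvd eval_chain c (bd \<sigma>)"
  shows "\<exists>\<L> b. \<L> \<subseteq> \<K> \<and> slow_family X q \<L> \<and>
    (\<forall>\<sigma>. length \<sigma> = n + 1 \<longrightarrow> set \<sigma> \<subseteq> mspace X \<longrightarrow> set \<sigma> \<in> \<L> \<longrightarrow> m dvd c \<sigma> - eval_chain b (bd \<sigma>))"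
proof -
  define S where "S r = S0 (r + 1) + 1" for r
  have S_eq: "S = (\<lambda>r. S0 (r + 1) + 1)" by (simp add: fun_eq_iff S_def)
  have S: "contraction_radius X S" using contraction_radius_shift[OF S0] unfolding S_def .
  have S': "mono S" "\<And>r. r \<le> S r" using S by (auto simp: contraction_radius_def)
  define \<rho> where "\<rho> = fill_radius S"
  have \<rho>_mono: "\<rho> k r \<le> \<rho> k r'" if "r \<le> r'" for k r r'
    unfolding \<rho>_def by (rule fill_radius_mono[OF S'(1) that])
  have \<rho>_Suc: "\<rho> k r + r \<le> \<rho> (Suc k) r" for k r
    unfolding \<rho>_def by (rule fill_radius_Suc_ge[OF S'(2)])
  have \<rho>_nn: "0 \<le> \<rho> k r" if "0 \<le> r" for k r
    unfolding \<rho>_def by (rule fill_radius_nonneg[OF S'(2) that])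
  have \<rho>_le: "\<rho> k r \<le> \<rho> l r" if "0 \<le> r" "k \<le> l" for k l r
  proof (rule lift_Suc_mono_le[of "\<lambda>k. \<rho> k r", OF _ that(2)])
    show "\<rho> n r \<le> \<rho> (Suc n) r" for n using \<rho>_Suc[of n r] that(1) by linarith
  qed
  obtain R' where far: "\<And>x A. x \<in> mspace X \<Longrightarrow> mdist X q x > R' \<Longrightarrow> finite A \<Longrightarrow>
      A \<subseteq> mcball_of X x (\<rho> (n + 2) 1) \<Longrightarrow> A \<in> \<K>"
    by (rule slow_family_far[OF \<K>, of "\<rho> (n + 2) 1"]) (rule that)
  \<comment> \<open>A set of diameter at most 1 with a point at distance more than \<open>R1\<close>
    from \<open>q\<close> lies entirely beyond \<open>R'\<close>, where \<open>far\<close>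
    applies.\<close>
  define R1 where "R1 = R' + 1"
  \<comment> \<open>Everything that fillings of tuples of diameter at most 1 in the central ball can
    reach.\<close>
  define C where "C = mcball_of X q (R1 + \<rho> (n + 2) 1)"
  obtain \<eta> where \<eta>: "\<eta> > 0" "\<And>A. finite A \<Longrightarrow> A \<subseteq> C \<Longrightarrow> \<forall>a\<in>A. \<forall>b\<in>A. mdist X a b \<le> \<eta> \<Longrightarrow> A \<in> \<K>"
    by (rule slow_family_local[OF \<K>, of "R1 + \<rho> (n + 2) 1", folded C_def]) (rule that)
  have compB: "compactin (mtopology_of X) (mcball_of X q R1)"
    using X q by (auto simp: proper_metric_def)
  obtain \<delta> :: "nat \<Rightarrow> real" where \<delta>: "\<And>k. 0 < \<delta> k" "\<And>k. \<delta> k \<le> 1" "\<And>k. \<delta> k \<le> \<eta>"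
      "\<And>k l. 0 < k \<Longrightarrow> k \<le> l \<Longrightarrow> l \<le> n + 2 \<Longrightarrow> \<delta> k \<le> \<delta> l"
    and \<delta>_fill: "\<And>k x z. 0 < k \<Longrightarrow> k < n + 2 \<Longrightarrow> x \<in> mcball_of X q R1 \<Longrightarrow>
      Poly_Mapping.keys z \<subseteq> rips X x (\<rho> k 1 + 1) (\<delta> k) k \<Longrightarrow> Bd z = 0 \<Longrightarrow>
      (\<exists>w. Poly_Mapping.keys w \<subseteq> rips X x (\<rho> (Suc k) 1) (\<delta> (Suc k)) (Suc k) \<and> Bd w = z)"
  proof -
    obtain \<delta> :: "nat \<Rightarrow> real" where \<delta>: "\<forall>k. 0 < \<delta> k \<and> \<delta> k \<le> 1 \<and> \<delta> k \<le> \<eta>"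
      "\<forall>k l. 0 < k \<longrightarrow> k \<le> l \<longrightarrow> l \<le> n + 2 \<longrightarrow> \<delta> k \<le> \<delta> l"
      "\<forall>k x z. 0 < k \<longrightarrow> k < n + 2 \<longrightarrow> x \<in> mcball_of X q R1 \<longrightarrow>
      Poly_Mapping.keys z \<subseteq> rips X x (\<rho> k 1 + 1) (\<delta> k) k \<longrightarrow> Bd z = 0 \<longrightarrow>
      (\<exists>w. Poly_Mapping.keys w \<subseteq> rips X x (\<rho> (Suc k) 1) (\<delta> (Suc k)) (Suc k) \<and> Bd w = z)"
      using fill_scales_exist[OF X S0 compB \<eta>(1), of "n + 2", unfolded S_eq[symmetric] \<rho>_def[symmetric]]
      by (elim exE conjE) (rule that)
    show thesis by (rule that[of \<delta>]) (use \<delta> in \<open>simp_all\<close>)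
  qed
  \<comment> \<open>Finite subsets of a member always belong to \<open>\<K>\<close>. Members meeting
    \<open>C\<close> are moreover so small that the tuples of a filling enter the Rips fillings at
    the lowest scale \<open>\<delta> 1\<close>.\<close>
  define \<C> where "\<C> = {V. openin (mtopology_of X) V \<and> (\<forall>A. finite A \<longrightarrow> A \<subseteq> V \<longrightarrow> A \<in> \<K>) \<and>
      (V \<inter> C \<noteq> {} \<longrightarrow> (\<forall>a\<in>V. \<forall>b\<in>V. mdist X a b \<le> \<delta> 1))}"
  have \<C>_cover: "mspace X \<subseteq> \<Union>\<C>"
  proof
    fix x assume x: "x \<in> mspace X"
    interpret M: Metric_space "mspace X" "mdist X" by simp
    obtain e where e: "e > 0" "\<And>A. finite A \<Longrightarrow> A \<subseteq> mcball_of X q (mdist X q x + 1) \<Longrightarrow>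
        \<forall>a\<in>A. \<forall>b\<in>A. mdist X a b \<le> e \<Longrightarrow> A \<in> \<K>"
      by (rule slow_family_local[OF \<K>, of "mdist X q x + 1"]) (rule that)
    define r where "r = Min {e / 2, \<delta> 1 / 2, 1}"
    have r: "r > 0" "r \<le> e / 2" "r \<le> \<delta> 1 / 2" "r \<le> 1" using e \<delta>(1) by (auto simp: r_def)
    have d: "mdist X a b \<le> 2 * r" if "a \<in> M.mball x r" "b \<in> M.mball x r" for a b
      using that M.triangle[of a x b] by (auto simp: M.commute)
    have "M.mball x r \<in> \<C>"
      unfolding \<C>_def mem_Collect_eq
    proof (intro conjI allI impI ballI)
      show "openin (mtopology_of X) (M.mball x r)" by (simp add: mtopology_of_def)
      fix A assume "finite A" and A: "A \<subseteq> M.mball x r"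
      then show "A \<in> \<K>"
      proof (intro e(2))
        show "A \<subseteq> mcball_of X q (mdist X q x + 1)"
        proof
          fix a assume "a \<in> A"
          then have "a \<in> M.mball x r" using A by blast
          then show "a \<in> mcball_of X q (mdist X q x + 1)"
            using q r M.triangle[of q x a] by auto
        qed
        show "\<forall>a\<in>A. \<forall>b\<in>A. mdist X a b \<le> e"
        proof (intro ballI)
          fix a b assume "a \<in> A" "b \<in> A"
          then have "mdist X a b \<le> 2 * r" using A by (intro d) blast+
          with r show "mdist X a b \<le> e" by linarith
        qed
      qed
    next
      fix a b assume "a \<in> M.mball x r" "b \<in> M.mball x r"
      then show "mdist X a b \<le> \<delta> 1" using d[of a b] r by linarith
    qed
    then show "x \<in> \<Union>\<C>" using x r(1) by (auto intro!: bexI[of _ "M.mball x r"])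
  qed
  obtain \<Phi> where \<Phi>0: "\<Phi> [] = frag_of []"
    and \<Phi>_keys: "\<And>\<sigma>. set \<sigma> \<subseteq> mspace X \<Longrightarrow> Poly_Mapping.keys (\<Phi> \<sigma>) \<subseteq> {\<tau>. length \<tau> = length \<sigma> \<and> (\<sigma> \<noteq> [] \<longrightarrow>
        set \<tau> \<subseteq> mcball_of X (hd \<sigma>) (\<rho> (length \<sigma>) (tdiam X (set \<sigma>))) \<and> (\<exists>V\<in>\<C>. set \<tau> \<subseteq> V))}"
    and \<Phi>_Bd: "\<And>\<sigma>. set \<sigma> \<subseteq> mspace X \<Longrightarrow> Bd (\<Phi> \<sigma>) = frag_extend \<Phi> (bd \<sigma>)"
  proof -
    have "\<exists>\<Phi>. \<Phi> [] = frag_of [] \<and> (\<forall>\<sigma>. set \<sigma> \<subseteq> mspace X \<longrightarrow>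
     Poly_Mapping.keys (\<Phi> \<sigma>) \<subseteq> {\<tau>. length \<tau> = length \<sigma> \<and> (\<sigma> \<noteq> [] \<longrightarrow>
        set \<tau> \<subseteq> mcball_of X (hd \<sigma>) (\<rho> (length \<sigma>) (tdiam X (set \<sigma>))) \<and> (\<exists>V\<in>\<C>. set \<tau> \<subseteq> V))} \<and>
     Bd (\<Phi> \<sigma>) = frag_extend \<Phi> (bd \<sigma>))"
      unfolding \<rho>_def
    proof (rule small_filling_map[OF S _ \<C>_cover])
      show "openin (mtopology_of X) V" if "V \<in> \<C>" for V using that by (simp add: \<C>_def)
    qed
    then obtain \<Phi> where 1: "\<Phi> [] = frag_of []" and 2: "\<forall>\<sigma>. set \<sigma> \<subseteq> mspace X \<longrightarrow>
     Poly_Mapping.keys (\<Phi> \<sigma>) \<subseteq> {\<tau>. length \<tau> = length \<sigma> \<and> (\<sigma> \<noteq> [] \<longrightarrow>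
        set \<tau> \<subseteq> mcball_of X (hd \<sigma>) (\<rho> (length \<sigma>) (tdiam X (set \<sigma>))) \<and> (\<exists>V\<in>\<C>. set \<tau> \<subseteq> V))} \<and>
     Bd (\<Phi> \<sigma>) = frag_extend \<Phi> (bd \<sigma>)" by (elim exE conjE)
    show thesis
      by (rule that[of \<Phi>, OF 1]) (drule 2[rule_format]; elim conjE; assumption)+
  qed
  have \<Phi>\<K>: "set \<tau> \<in> \<K>" if \<sigma>: "set \<sigma> \<subseteq> mspace X" "\<sigma> \<noteq> []" "\<tau> \<in> Poly_Mapping.keys (\<Phi> \<sigma>)" for \<sigma> \<tau>
  proof -
    obtain V where "V \<in> \<C>" "set \<tau> \<subseteq> V" using \<Phi>_keys[OF \<sigma>(1)] \<sigma>(2,3) by blast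
    then show ?thesis by (simp add: \<C>_def)
  qed

  \<comment> \<open>The lower bound 1 gives all relevant tuples inside the central ball the same
    radii, those for which the scales \<open>\<delta>\<close> were chosen.\<close>
  define d where "d A = max 1 (tdiam X A)" for A
  have d_mono: "d A \<le> d B" if "finite B" "A \<subseteq> B" for A B
    using tdiam_mono[OF that, of X] by (auto simp: d_def)
  have d1: "1 \<le> d A" "tdiam X A \<le> d A" for A by (auto simp: d_def)
  let ?K = "mcball_of X q R1"
  txt \<open>Tuples inside the ball are tiny and get filled by the contraction of balls; every other tuple
    lies where \<open>\<K>\<close> contains all subsets of a large ball, and gets filled by a cone.\<close>
  define \<L> where "\<L> = {A. finite A \<and> A \<subseteq> mspace X \<and>
      (A \<inter> ?K \<noteq> {} \<longrightarrow> (\<forall>a\<in>A. \<forall>b\<in>A. mdist X a b \<le> \<delta> 1)) \<and>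
      (\<not> A \<subseteq> ?K \<longrightarrow> (\<forall>x\<in>A. \<forall>B. finite B \<longrightarrow> B \<subseteq> mcball_of X x (\<rho> (n + 2) (d A)) \<longrightarrow> B \<in> \<K>))}"
  have \<L>D: "finite A" "A \<inter> ?K \<noteq> {} \<Longrightarrow> \<forall>a\<in>A. \<forall>b\<in>A. mdist X a b \<le> \<delta> 1"
      "\<not> A \<subseteq> ?K \<Longrightarrow> x \<in> A \<Longrightarrow> finite B \<Longrightarrow> B \<subseteq> mcball_of X x (\<rho> (n + 2) (d A)) \<Longrightarrow> B \<in> \<K>"
    if A: "A \<in> \<L>" for A B x
  proof -
    have 1: "finite A \<and> A \<subseteq> mspace X \<and>
      (A \<inter> ?K \<noteq> {} \<longrightarrow> (\<forall>a\<in>A. \<forall>b\<in>A. mdist X a b \<le> \<delta> 1)) \<and>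
      (\<not> A \<subseteq> ?K \<longrightarrow> (\<forall>x\<in>A. \<forall>B. finite B \<longrightarrow> B \<subseteq> mcball_of X x (\<rho> (n + 2) (d A)) \<longrightarrow> B \<in> \<K>))"
      using A unfolding \<L>_def mem_Collect_eq .
    show "finite A" using 1 by (rule conjunct1)
    show "A \<inter> ?K \<noteq> {} \<Longrightarrow> \<forall>a\<in>A. \<forall>b\<in>A. mdist X a b \<le> \<delta> 1"
      using 1[THEN conjunct2, THEN conjunct2, THEN conjunct1] by (rule mp)
    show "\<not> A \<subseteq> ?K \<Longrightarrow> x \<in> A \<Longrightarrow> finite B \<Longrightarrow> B \<subseteq> mcball_of X x (\<rho> (n + 2) (d A)) \<Longrightarrow> B \<in> \<K>"
      by (rule 1[THEN conjunct2, THEN conjunct2, THEN conjunct2, rule_format])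
  qed
  have \<L>_slow: "slow_family X q \<L>"
  proof (rule slow_familyI)
    fix A B assume A: "A \<in> \<L>" and B: "B \<subseteq> A"
    have fA: "finite A" using A by (simp add: \<L>_def)
    show "B \<in> \<L>"
      unfolding \<L>_def mem_Collect_eq
    proof (intro conjI impI)
      show "finite B" "B \<subseteq> mspace X" using A B by (auto simp: \<L>_def intro: finite_subset)
      show "\<forall>a\<in>B. \<forall>b\<in>B. mdist X a b \<le> \<delta> 1" if "B \<inter> ?K \<noteq> {}"
        proof -
        have "A \<inter> ?K \<noteq> {}" using that B by (auto simp del: in_mcball_of)
        with \<L>D(2)[OF A] B show ?thesis by (simp add: subset_iff)
      qed
      assume nB: "\<not> B \<subseteq> ?K"
      show "\<forall>x\<in>B. \<forall>D. finite D \<longrightarrow> D \<subseteq> mcball_of X x (\<rho> (n + 2) (d B)) \<longrightarrow> D \<in> \<K>"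
      proof (intro ballI allI impI)
        fix x D assume x: "x \<in> B" and D: "finite D" "D \<subseteq> mcball_of X x (\<rho> (n + 2) (d B))"
        have "mcball_of X x (\<rho> (n + 2) (d B)) \<subseteq> mcball_of X x (\<rho> (n + 2) (d A))"
        proof (rule mcball_of_mono)
          show x': "x \<in> mspace X" using x A B by (auto simp: \<L>_def)
          show "mdist X x x + \<rho> (n + 2) (d B) \<le> \<rho> (n + 2) (d A)"
            using \<rho>_mono[OF d_mono[OF fA B], of "n + 2"] x' by simp
        qed
        then have "D \<subseteq> mcball_of X x (\<rho> (n + 2) (d A))" using D(2) by (rule order_trans[rotated])
        moreover have "\<not> A \<subseteq> ?K" "x \<in> A" using nB B x by auto
        ultimately show "D \<in> \<K>" using \<L>D(3)[OF A] D(1) by simp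
      qed
    qed
  next
    fix R :: real
    have "A \<in> \<L>" if A: "finite A" "A \<subseteq> mcball_of X q R" "\<forall>a\<in>A. \<forall>b\<in>A. mdist X a b \<le> \<delta> 1" for A
      unfolding \<L>_def mem_Collect_eq
    proof (intro conjI impI)
      show "finite A" "A \<subseteq> mspace X" "\<forall>a\<in>A. \<forall>b\<in>A. mdist X a b \<le> \<delta> 1" using A by auto
      assume "\<not> A \<subseteq> ?K"
      then obtain y where y: "y \<in> A" "mdist X q y > R1" using A(2) q by fastforce
      have "tdiam X A \<le> 1" using A \<delta>(2)[of 1] by (intro tdiam_least) force+
      then have dA: "d A = 1" by (simp add: d_def)
      show "\<forall>x\<in>A. \<forall>B. finite B \<longrightarrow> B \<subseteq> mcball_of X x (\<rho> (n + 2) (d A)) \<longrightarrow> B \<in> \<K>"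
      proof (intro ballI allI impI)
        fix x B assume x: "x \<in> A" and B: "finite B" "B \<subseteq> mcball_of X x (\<rho> (n + 2) (d A))"
        have X': "x \<in> mspace X" "y \<in> mspace X" using x y A(2) by auto
        have "mdist X x y \<le> 1" using A(3) x y \<delta>(2)[of 1] by force
        then have "mdist X q x > R'" using y mdist_triangle[OF q X'] by (simp add: R1_def)
        from far[OF X'(1) this B(1)] B(2) show "B \<in> \<K>" by (simp add: dA)
      qed
    qed
    then show "\<exists>\<eta>>0. \<forall>A. finite A \<longrightarrow> A \<subseteq> mcball_of X q R \<longrightarrow>
        (\<forall>a\<in>A. \<forall>b\<in>A. mdist X a b \<le> \<eta>) \<longrightarrow> A \<in> \<L>"
      using \<delta>(1) by blast
  next
    fix R :: real
    \<comment> \<open>Bounds \<open>d A\<close> for every subset \<open>A\<close> of a ball of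
      radius \<open>R\<close>.\<close>
    define D where "D = max 1 (2 * R)"
    obtain R2 where R2: "\<And>x A. x \<in> mspace X \<Longrightarrow> mdist X q x > R2 \<Longrightarrow> finite A \<Longrightarrow>
        A \<subseteq> mcball_of X x (\<rho> (n + 2) D) \<Longrightarrow> A \<in> \<K>"
      by (rule slow_family_far[OF \<K>, of "\<rho> (n + 2) D"]) (rule that)
    have "A \<in> \<L>" if x: "x \<in> mspace X" "mdist X q x > max R1 R2 + R" and A: "finite A" "A \<subseteq> mcball_of X x R" for x A
    proof -
      have y: "y \<in> mspace X \<and> mdist X q y > R1 \<and> mdist X q y > R2" if "y \<in> A" for y
      proof -
        have "y \<in> mspace X" "mdist X x y \<le> R" using A that by auto
        moreover have "mdist X q x \<le> mdist X q y + mdist X y x" by (rule mdist_triangle) (use q x calculation in auto)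
        ultimately show ?thesis using x by (auto simp: mdist_commute)
      qed
      have dA: "d A \<le> D" if "a \<in> A" for a
      proof -
        have "0 \<le> R" using that A x mdist_nonneg[of X x a] by (smt (verit) in_mcball_of subsetD)
        have "mdist X u v \<le> 2 * R" if "u \<in> A" "v \<in> A" for u v
        proof -
          have "u \<in> mcball_of X x R" "v \<in> mcball_of X x R" using that A by auto
          then show ?thesis using mdist_triangle[of u X x v] by (auto simp: mdist_commute)
        qed
        with A(1) \<open>0 \<le> R\<close> have "tdiam X A \<le> 2 * R" by (intro tdiam_least) auto
        then show ?thesis by (auto simp: d_def D_def)
      qed
      show ?thesis
        unfolding \<L>_def mem_Collect_eq
      proof (intro conjI impI)
        show "finite A" "A \<subseteq> mspace X" using A y by auto
        show "\<forall>a\<in>A. \<forall>b\<in>A. mdist X a b \<le> \<delta> 1" if "A \<inter> ?K \<noteq> {}" using that y by fastforce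
        show "\<forall>x\<in>A. \<forall>B. finite B \<longrightarrow> B \<subseteq> mcball_of X x (\<rho> (n + 2) (d A)) \<longrightarrow> B \<in> \<K>"
        proof (intro ballI allI impI)
          fix x B assume x: "x \<in> A" and B: "finite B" "B \<subseteq> mcball_of X x (\<rho> (n + 2) (d A))"
          have "mcball_of X x (\<rho> (n + 2) (d A)) \<subseteq> mcball_of X x (\<rho> (n + 2) D)"
            using \<rho>_mono[OF dA[OF x], of "n + 2"] y[OF x] by (intro mcball_of_mono) auto
          with B(2) have "B \<subseteq> mcball_of X x (\<rho> (n + 2) D)" by (rule order_trans)
          with B(1) y[OF x] show "B \<in> \<K>" by (intro R2[of x]) simp_all
        qed
      qed
    qed
    then show "\<exists>R'. \<forall>x\<in>mspace X. mdist X q x > R' \<longrightarrow>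
        (\<forall>A. finite A \<longrightarrow> A \<subseteq> mcball_of X x R \<longrightarrow> A \<in> \<L>)" by blast
  qed

  define D where "D = {\<sigma>. set \<sigma> \<subseteq> mspace X \<and> set \<sigma> \<in> \<L> \<and> length \<sigma> \<le> n + 1}"
  define tiny where "tiny k \<tau> \<longleftrightarrow> (\<forall>a\<in>set \<tau>. \<forall>b\<in>set \<tau>. mdist X a b \<le> \<delta> k)" for k and \<tau> :: "'a list"
  \<comment> \<open>\<open>Q'\<close> carries the cycle to be filled over \<open>\<sigma>\<close>,
    with as many vertices as \<open>\<sigma>\<close>, and \<open>Q\<close> its filling, with one
    more. Both are empty over the empty tuple, so the homotopy vanishes there. Inside the central
    ball the scale index goes up by one, as in \<open>\<delta>_fill\<close>.\<close>
  define Q' where "Q' \<sigma> = {\<tau>. \<sigma> \<noteq> [] \<and> length \<tau> = length \<sigma> \<and>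
      set \<tau> \<subseteq> mcball_of X (hd \<sigma>) (\<rho> (length \<sigma>) (d (set \<sigma>)) + d (set \<sigma>)) \<and>
      (set \<sigma> \<subseteq> ?K \<longrightarrow> tiny (length \<sigma>) \<tau>)}" for \<sigma>
  define Q where "Q \<sigma> = {\<tau>. \<sigma> \<noteq> [] \<and> length \<tau> = Suc (length \<sigma>) \<and>
      set \<tau> \<subseteq> mcball_of X (hd \<sigma>) (\<rho> (Suc (length \<sigma>)) (d (set \<sigma>))) \<and>
      (set \<sigma> \<subseteq> ?K \<longrightarrow> tiny (Suc (length \<sigma>)) \<tau>)}" for \<sigma>
  have Kd: "tiny 1 \<sigma> \<and> d (set \<sigma>) = 1" if "\<sigma> \<in> D" "\<sigma> \<noteq> []" "set \<sigma> \<subseteq> ?K" for \<sigma>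
  proof -
    have "set \<sigma> \<inter> ?K \<noteq> {}" using that by (cases \<sigma>) auto
    then have t: "\<forall>a\<in>set \<sigma>. \<forall>b\<in>set \<sigma>. mdist X a b \<le> \<delta> 1" using that(1) by (auto simp: D_def \<L>_def)
    then have "tdiam X (set \<sigma>) \<le> 1" using \<delta>(2)[of 1] by (intro tdiam_least) force+
    with t show ?thesis by (simp add: tiny_def d_def)
  qed
  have tiny_mono: "tiny l \<tau>" if "tiny k \<tau>" "0 < k" "k \<le> l" "l \<le> n + 2" for k l \<tau>
    using that \<delta>(4)[of k l] unfolding tiny_def by force
  have "\<exists>h. \<forall>\<sigma>\<in>D. Poly_Mapping.keys (h \<sigma>) \<subseteq> Q \<sigma> \<and> Bd (h \<sigma>) = (frag_of \<sigma> - \<Phi> \<sigma>) - frag_extend h (bd \<sigma>)"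
  proof (rule chain_homotopy_exists[where Q'=Q'])
    fix \<sigma> assume \<sigma>: "\<sigma> \<in> D"
    then have \<sigma>X: "set \<sigma> \<subseteq> mspace X" and len: "length \<sigma> \<le> n + 1" by (auto simp: D_def)
    show "Bd (frag_of \<sigma> - \<Phi> \<sigma>) = frag_extend (\<lambda>\<sigma>. frag_of \<sigma> - \<Phi> \<sigma>) (bd \<sigma>)"
      by (simp add: frag_extend_fun_diff \<Phi>_Bd[OF \<sigma>X])
    show "Poly_Mapping.keys (frag_of \<sigma> - \<Phi> \<sigma>) \<subseteq> Q' \<sigma>"
    proof (cases "\<sigma> = []")
      case True
      then show ?thesis by (simp add: \<Phi>0)
    next
      case False
      have hd: "hd \<sigma> \<in> set \<sigma>" using False by simp
      then have hdX: "hd \<sigma> \<in> mspace X" using \<sigma>X by blast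
      have l: "0 < length \<sigma>" using False by simp
      have \<rho>d: "0 \<le> \<rho> (length \<sigma>) (d (set \<sigma>))" using \<rho>_nn d1(1)[of "set \<sigma>"] by simp
      have "\<sigma> \<in> Q' \<sigma>"
        unfolding Q'_def mem_Collect_eq
      proof (intro conjI impI subsetI)
        fix x assume x: "x \<in> set \<sigma>"
        have "mdist X (hd \<sigma>) x \<le> d (set \<sigma>)"
          using tdiam_upper[of "set \<sigma>" "hd \<sigma>" x X] hd x d1(2)[of "set \<sigma>"] by simp
        then show "x \<in> mcball_of X (hd \<sigma>) (\<rho> (length \<sigma>) (d (set \<sigma>)) + d (set \<sigma>))"
          using hdX x \<sigma>X \<rho>d by auto
      next
        assume "set \<sigma> \<subseteq> ?K"
        then show "tiny (length \<sigma>) \<sigma>" using Kd[OF \<sigma> False] tiny_mono[of 1 \<sigma> "length \<sigma>"] l len by simp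
      qed (use False in auto)
      moreover have "\<tau> \<in> Q' \<sigma>" if \<tau>: "\<tau> \<in> Poly_Mapping.keys (\<Phi> \<sigma>)" for \<tau>
      proof -
        have len\<tau>: "length \<tau> = length \<sigma>" and \<tau>B: "set \<tau> \<subseteq> mcball_of X (hd \<sigma>) (\<rho> (length \<sigma>) (tdiam X (set \<sigma>)))"
          using \<Phi>_keys[OF \<sigma>X] \<tau> False by blast+
        obtain V where V: "V \<in> \<C>" "set \<tau> \<subseteq> V"
          using \<Phi>_keys[OF \<sigma>X] \<tau> False by blast
        show ?thesis
          unfolding Q'_def mem_Collect_eq
        proof (intro conjI impI)
          have "\<rho> (length \<sigma>) (tdiam X (set \<sigma>)) \<le> \<rho> (length \<sigma>) (d (set \<sigma>)) + d (set \<sigma>)"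
            using \<rho>_mono[OF d1(2)[of "set \<sigma>"], of "length \<sigma>"] d1(1)[of "set \<sigma>"] by linarith
          then have "mcball_of X (hd \<sigma>) (\<rho> (length \<sigma>) (tdiam X (set \<sigma>)))
              \<subseteq> mcball_of X (hd \<sigma>) (\<rho> (length \<sigma>) (d (set \<sigma>)) + d (set \<sigma>))"
            using hdX by (intro mcball_of_mono) auto
          with \<tau>B show "set \<tau> \<subseteq> mcball_of X (hd \<sigma>) (\<rho> (length \<sigma>) (d (set \<sigma>)) + d (set \<sigma>))" by blast
          assume K: "set \<sigma> \<subseteq> ?K"
          \<comment> \<open>The filling stays in \<open>C\<close>, so the member of
            \<open>\<C>\<close> that contains its vertices meets \<open>C\<close> and is
            tiny.\<close>
          have "tdiam X (set \<sigma>) \<le> 1" using Kd[OF \<sigma> False K] d1(2)[of "set \<sigma>"] by simp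
          then have "\<rho> (length \<sigma>) (tdiam X (set \<sigma>)) \<le> \<rho> (length \<sigma>) 1" by (rule \<rho>_mono)
          also have "\<dots> \<le> \<rho> (n + 2) 1" using len by (intro \<rho>_le) auto
          finally have "mcball_of X (hd \<sigma>) (\<rho> (length \<sigma>) (tdiam X (set \<sigma>))) \<subseteq> C"
            using K hd q unfolding C_def by (intro mcball_of_mono) auto
          moreover obtain x where "x \<in> set \<tau>" using len\<tau> False by (cases \<tau>) auto
          ultimately have "V \<inter> C \<noteq> {}" using \<tau>B V by blast
          then have "tiny 1 \<tau>" using V unfolding tiny_def \<C>_def by blast
          then show "tiny (length \<sigma>) \<tau>" using tiny_mono[of 1 \<tau> "length \<sigma>"] l len by simp
        qed (use len\<tau> False in auto)
      qed
      ultimately show ?thesis by (intro keys_diff_subset) auto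
    qed
    fix z assume z: "Poly_Mapping.keys z \<subseteq> Q' \<sigma>" "Bd z = 0"
    show "\<exists>w. Poly_Mapping.keys w \<subseteq> Q \<sigma> \<and> Bd w = z"
    proof (cases "\<sigma> = []")
      case True
      then have "z = 0" using z(1) by (simp add: Q'_def)
      then show ?thesis by (intro exI[of _ 0]) simp
    next
      case False
      have hd: "hd \<sigma> \<in> set \<sigma>" using False by simp
      then have hdX: "hd \<sigma> \<in> mspace X" using \<sigma>X by blast
      have l: "0 < length \<sigma>" using False by simp
      show ?thesis
      proof (cases "set \<sigma> \<subseteq> ?K")
        case True
        have "d (set \<sigma>) = 1" using Kd[OF \<sigma> False True] by simp
        then have Q': "Q' \<sigma> \<subseteq> rips X (hd \<sigma>) (\<rho> (length \<sigma>) 1 + 1) (\<delta> (length \<sigma>)) (length \<sigma>)"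
          and Q: "rips X (hd \<sigma>) (\<rho> (Suc (length \<sigma>)) 1) (\<delta> (Suc (length \<sigma>))) (Suc (length \<sigma>)) \<subseteq> Q \<sigma>"
          using True False unfolding Q'_def Q_def rips_def tiny_def by auto
        have "hd \<sigma> \<in> ?K" using hd True by blast
        then obtain w where w: "Poly_Mapping.keys w \<subseteq> rips X (hd \<sigma>) (\<rho> (Suc (length \<sigma>)) 1) (\<delta> (Suc (length \<sigma>))) (Suc (length \<sigma>))"
            "Bd w = z"
          using \<delta>_fill[OF l _ _ order_trans[OF z(1) Q'] z(2)] len by auto
        have "Poly_Mapping.keys w \<subseteq> Q \<sigma>" using w(1) Q by (rule order_trans)
        with w(2) show ?thesis by blast
      next
        case nK: False
        let ?r = "\<rho> (length \<sigma>) (d (set \<sigma>)) + d (set \<sigma>)"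
        have "0 \<le> ?r" using \<rho>_nn d1(1)[of "set \<sigma>"] by (intro add_nonneg_nonneg) auto
        then have hB: "hd \<sigma> \<in> mcball_of X (hd \<sigma>) ?r" using hdX by simp
        have "Poly_Mapping.keys z \<subseteq> {\<tau>. set \<tau> \<subseteq> mcball_of X (hd \<sigma>) ?r \<and> length \<tau> = length \<sigma>}"
          using z(1) by (auto simp: Q'_def)
        from fill_by_cone[OF z(2) hB this] obtain w where
          w: "Poly_Mapping.keys w \<subseteq> {\<tau>. set \<tau> \<subseteq> mcball_of X (hd \<sigma>) ?r \<and> length \<tau> = Suc (length \<sigma>)}" "Bd w = z"
          by blast
        have "mcball_of X (hd \<sigma>) ?r \<subseteq> mcball_of X (hd \<sigma>) (\<rho> (Suc (length \<sigma>)) (d (set \<sigma>)))"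
          using \<rho>_Suc hdX by (intro mcball_of_mono) auto
        with w(1) nK False have "Poly_Mapping.keys w \<subseteq> Q \<sigma>" unfolding Q_def by blast
        with w(2) show ?thesis by blast
      qed
    qed
  next
    fix \<sigma> \<tau> assume \<sigma>: "\<sigma> \<in> D" and \<tau>: "\<tau> \<in> Poly_Mapping.keys (bd \<sigma>)"
    then have \<sigma>X: "set \<sigma> \<subseteq> mspace X" by (simp add: D_def)
    have ne: "\<sigma> \<noteq> []" and l: "length \<sigma> = Suc (length \<tau>)" and sub: "set \<tau> \<subseteq> set \<sigma>" using keys_bd[OF \<tau>] by auto
    show "\<tau> \<in> D" using \<sigma> l sub slow_family_subset[OF \<L>_slow] by (auto simp: D_def)
    show "Q \<tau> \<subseteq> Q' \<sigma>"
    proof (cases "\<tau> = []")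
      case True
      then show ?thesis by (simp add: Q_def)
    next
      case False
      have hd: "hd \<sigma> \<in> set \<sigma>" "hd \<tau> \<in> set \<sigma>" using ne False sub by auto
      have "mdist X (hd \<sigma>) (hd \<tau>) \<le> d (set \<sigma>)"
        using tdiam_upper[of "set \<sigma>" "hd \<sigma>" "hd \<tau>" X] hd d1(2)[of "set \<sigma>"] by simp
      moreover have "\<rho> (length \<sigma>) (d (set \<tau>)) \<le> \<rho> (length \<sigma>) (d (set \<sigma>))"
        by (intro \<rho>_mono d_mono sub) simp
      ultimately have "mcball_of X (hd \<tau>) (\<rho> (length \<sigma>) (d (set \<tau>)))
          \<subseteq> mcball_of X (hd \<sigma>) (\<rho> (length \<sigma>) (d (set \<sigma>)) + d (set \<sigma>))"
        using hd \<sigma>X by (intro mcball_of_mono) auto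
      then show ?thesis using ne l sub unfolding Q_def Q'_def by auto
    qed
  qed
  then obtain h where h_keys: "\<And>\<sigma>. \<sigma> \<in> D \<Longrightarrow> Poly_Mapping.keys (h \<sigma>) \<subseteq> Q \<sigma>"
    and h_Bd: "\<And>\<sigma>. \<sigma> \<in> D \<Longrightarrow> Bd (h \<sigma>) = (frag_of \<sigma> - \<Phi> \<sigma>) - frag_extend h (bd \<sigma>)" by blast

  txt \<open>Every \<open>\<sigma>\<close> is homologous to \<open>\<Phi> \<sigma>\<close> through \<open>h\<close>, and \<open>\<Phi> (q # \<sigma>)\<close> cones off \<open>\<Phi> \<sigma>\<close>.\<close>
  define b where "b \<tau> = eval_chain c (\<Phi> (q # \<tau>)) + eval_chain c (h \<tau>)" for \<tau>
  have cBd: "m dvd eval_chain c (Bd w)" if "Poly_Mapping.keys w \<subseteq> {\<tau>. length \<tau> = n + 2 \<and> set \<tau> \<in> \<K>}" for w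
    unfolding Bd_def eval_chain_frag_extend by (rule eval_chain_dvd) (use that cocycle in blast)
  have "m dvd c \<sigma> - eval_chain b (bd \<sigma>)" if \<sigma>: "length \<sigma> = n + 1" "set \<sigma> \<subseteq> mspace X" "set \<sigma> \<in> \<L>" for \<sigma>
  proof -
    have ne: "\<sigma> \<noteq> []" using \<sigma> by auto
    have D: "\<sigma> \<in> D" using \<sigma> by (simp add: D_def)
    have hd: "hd \<sigma> \<in> set \<sigma>" using ne by simp
    have "set \<tau> \<in> \<K>" if "\<tau> \<in> Q \<sigma>" for \<tau>
    proof (cases "set \<sigma> \<subseteq> ?K")
      case True
      have "d (set \<sigma>) = 1" using Kd[OF D ne True] by simp
      then have \<tau>: "set \<tau> \<subseteq> mcball_of X (hd \<sigma>) (\<rho> (n + 2) 1)" "tiny (n + 2) \<tau>"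
        using that True \<sigma> by (auto simp: Q_def)
      have "mcball_of X (hd \<sigma>) (\<rho> (n + 2) 1) \<subseteq> C"
        unfolding C_def using True hd q by (intro mcball_of_mono) auto
      with \<tau> show ?thesis using \<delta>(3)[of "n + 2"] by (intro \<eta>(2)) (force simp: tiny_def)+
    next
      case False
      have "set \<tau> \<subseteq> mcball_of X (hd \<sigma>) (\<rho> (n + 2) (d (set \<sigma>)))"
        using that \<sigma> by (auto simp: Q_def)
      with \<L>D(3)[OF \<sigma>(3) False hd] show ?thesis by simp
    qed
    then have "Q \<sigma> \<subseteq> {\<tau>. length \<tau> = n + 2 \<and> set \<tau> \<in> \<K>}"
      using \<sigma>(1) by (auto simp: Q_def)
    then have 1: "m dvd eval_chain c (Bd (h \<sigma>))" using h_keys[OF D] by (intro cBd) blast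
    have q\<sigma>: "set (q # \<sigma>) \<subseteq> mspace X" using q \<sigma>(2) by simp
    have "Poly_Mapping.keys (\<Phi> (q # \<sigma>)) \<subseteq> {\<tau>. length \<tau> = n + 2 \<and> set \<tau> \<in> \<K>}"
      using \<Phi>_keys[OF q\<sigma>] \<Phi>\<K>[OF q\<sigma>] \<sigma>(1) by auto
    then have 2: "m dvd eval_chain c (Bd (\<Phi> (q # \<sigma>)))" by (rule cBd)
    have "Bd (\<Phi> (q # \<sigma>)) = \<Phi> \<sigma> - frag_extend (\<lambda>\<tau>. \<Phi> (q # \<tau>)) (bd \<sigma>)"
      unfolding \<Phi>_Bd[OF q\<sigma>] by (simp add: frag_extend_diff tcone_def frag_extend_frag_extend)
    then have 3: "eval_chain c (Bd (\<Phi> (q # \<sigma>))) =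
        eval_chain c (\<Phi> \<sigma>) - eval_chain (\<lambda>\<tau>. eval_chain c (\<Phi> (q # \<tau>))) (bd \<sigma>)"
      by (simp add: eval_chain_frag_extend)
    have 4: "eval_chain c (Bd (h \<sigma>)) = c \<sigma> - eval_chain c (\<Phi> \<sigma>) - eval_chain (\<lambda>\<tau>. eval_chain c (h \<tau>)) (bd \<sigma>)"
      by (simp add: h_Bd[OF D] eval_chain_frag_extend)
    have "c \<sigma> - eval_chain b (bd \<sigma>) = eval_chain c (Bd (h \<sigma>)) + eval_chain c (Bd (\<Phi> (q # \<sigma>)))"
      unfolding b_def eval_chain_fun_add 3 4 by simp
    with 1 2 show ?thesis by simp
  qed
  then show ?thesis
    using slow_family_Int[OF \<K> \<L>_slow] by (intro exI[of _ "\<K> \<inter> \<L>"] exI[of _ b]) blast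
qed

section \<open>Covers of slowly growing scale\<close>

definition one_lipschitz :: "'a metric \<Rightarrow> ('a \<Rightarrow> real) \<Rightarrow> bool" where
  "one_lipschitz X f \<longleftrightarrow> (\<forall>x\<in>mspace X. \<forall>y\<in>mspace X. f x \<le> f y + mdist X x y)"

lemma one_lipschitzD: "one_lipschitz X f \<Longrightarrow> x \<in> mspace X \<Longrightarrow> y \<in> mspace X \<Longrightarrow> f x \<le> f y + mdist X x y"
  by (simp add: one_lipschitz_def)

lemma one_lipschitz_max: "one_lipschitz X f \<Longrightarrow> one_lipschitz X g \<Longrightarrow> one_lipschitz X (\<lambda>x. max (f x) (g x))"
  unfolding one_lipschitz_def by (smt (verit))

lemma one_lipschitz_min: "one_lipschitz X f \<Longrightarrow> one_lipschitz X g \<Longrightarrow> one_lipschitz X (\<lambda>x. min (f x) (g x))"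
  unfolding one_lipschitz_def by (smt (verit))

lemma one_lipschitz_const [simp]: "one_lipschitz X (\<lambda>x. c)"
  by (simp add: one_lipschitz_def)

lemma one_lipschitz_mdist: "q \<in> mspace X \<Longrightarrow> one_lipschitz X (\<lambda>x. mdist X q x - c)"
  "q \<in> mspace X \<Longrightarrow> one_lipschitz X (\<lambda>x. c - mdist X q x)"
  unfolding one_lipschitz_def
  using mdist_triangle[of q X] by (fastforce simp: mdist_commute)+

text \<open>The cutoff \<open>s\<close> keeps the infimum meaningful when \<open>U\<close> is the whole space.\<close>

definition depth :: "'a metric \<Rightarrow> real \<Rightarrow> 'a set \<Rightarrow> 'a \<Rightarrow> real" where
  "depth X s U x = Inf (insert s (mdist X x ` (mspace X - U)))"

lemma depth_ge: "0 \<le> s \<Longrightarrow> r \<le> s \<Longrightarrow> (\<And>y. y \<in> mspace X - U \<Longrightarrow> r \<le> mdist X x y) \<Longrightarrow> r \<le> depth X s U x"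
  unfolding depth_def by (rule cInf_greatest) auto

lemma depth_pos:
  assumes "0 \<le> s" "x \<in> mspace X" "0 < depth X s U x"
  shows "x \<in> U"
proof (rule ccontr)
  assume "x \<notin> U"
  have "mdist X x x \<in> mdist X x ` (mspace X - U)" by (rule imageI) (use assms \<open>x \<notin> U\<close> in simp)
  then have "depth X s U x \<le> mdist X x x"
    unfolding depth_def by (intro cInf_lower) (use assms in \<open>auto intro!: bdd_belowI[of _ 0]\<close>)
  with assms show False by simp
qed

lemma one_lipschitz_depth: "0 \<le> s \<Longrightarrow> one_lipschitz X (depth X s U)"
  unfolding one_lipschitz_def
proof (intro ballI)
  fix x y assume s: "0 \<le> s" and x: "x \<in> mspace X" "y \<in> mspace X"
  have "depth X s U x - mdist X x y \<le> depth X s U y"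
    unfolding depth_def[of X s U y]
  proof (rule cInf_greatest)
    fix t assume t: "t \<in> insert s (mdist X y ` (mspace X - U))"
    have bb: "bdd_below (insert s (mdist X x ` (mspace X - U)))"
      using s by (auto intro!: bdd_belowI[of _ 0])
    from t consider "t = s" | z where "z \<in> mspace X - U" "t = mdist X y z" by blast
    then show "depth X s U x - mdist X x y \<le> t"
    proof cases
      case 1
      have "depth X s U x \<le> s" unfolding depth_def using bb by (rule cInf_lower[rotated]) simp
      with 1 show ?thesis using mdist_nonneg[of X x y] by linarith
    next
      case 2
      have "depth X s U x \<le> mdist X x z" unfolding depth_def using bb by (rule cInf_lower[rotated]) (use 2 in auto)
      with 2 show ?thesis using mdist_triangle[of x X y z] x by auto
    qed
  qed simp
  then show "depth X s U x \<le> depth X s U y + mdist X x y" by linarith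
qed

text \<open>The cover with Lebesgue number at least \<open>j + 1\<close> is used on an annulus so
  far out that its members are small for \<open>\<L>\<close>; only two consecutive covers are active
  at a point, so the multiplicity stays bounded. The centre is covered by finitely many tiny balls.
  The bumps are left unnormalised: that their maximum tends to infinity later makes their quotients
  slowly oscillating.\<close>

lemma slow_partition_exists:
  fixes X :: "'a metric"
  assumes X: "proper_metric X" and "asdim_le X D" and q: "q \<in> mspace X"
    and \<L>: "slow_family X q \<L>"
  obtains \<phi> :: "nat \<times> 'a set \<Rightarrow> 'a \<Rightarrow> real" and pt :: "nat \<times> 'a set \<Rightarrow> 'a" and N :: nat
  where "\<And>\<alpha>. one_lipschitz X (\<phi> \<alpha>)" "\<And>\<alpha> x. 0 \<le> \<phi> \<alpha> x"
    "\<And>x. x \<in> mspace X \<Longrightarrow> finite {\<alpha>. 0 < \<phi> \<alpha> x} \<and> card {\<alpha>. 0 < \<phi> \<alpha> x} \<le> N"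
    "\<And>x. x \<in> mspace X \<Longrightarrow> \<exists>\<alpha>. 0 < \<phi> \<alpha> x"
    "\<And>r. \<exists>R. \<forall>x\<in>mspace X. R < mdist X q x \<longrightarrow> (\<exists>\<alpha>. r \<le> \<phi> \<alpha> x)"
    "\<And>x. x \<in> mspace X \<Longrightarrow> insert x (pt ` {\<alpha>. 0 < \<phi> \<alpha> x}) \<in> \<L>"
    "\<And>\<alpha> x. x \<in> mspace X \<Longrightarrow> 0 < \<phi> \<alpha> x \<Longrightarrow> pt \<alpha> \<in> mspace X"
proof -
  interpret M: Metric_space "mspace X" "mdist X" by simp
  have "\<forall>j::nat. \<exists>\<U> E. \<U> \<in> open_covers (mtopology_of X) \<and> (\<forall>U\<in>\<U>. \<forall>x\<in>U. \<forall>y\<in>U. mdist X x y \<le> E) \<and>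
      multiplicity_le X \<U> (D + 1) \<and> lebesgue_number_ge X \<U> (real j + 1)"
    using assms(2) unfolding asdim_le_def uniformly_bounded_def by (metis of_nat_0_le_iff add_nonneg_pos zero_less_one)
  then obtain \<U> E where \<U>: "\<And>j. \<U> j \<in> open_covers (mtopology_of X)"
    and E: "\<And>j U x y. U \<in> \<U> j \<Longrightarrow> x \<in> U \<Longrightarrow> y \<in> U \<Longrightarrow> mdist X x y \<le> E j"
    and mult: "\<And>j. multiplicity_le X (\<U> j) (D + 1)"
    and leb: "\<And>j::nat. lebesgue_number_ge X (\<U> j) (real j + 1)"
    by metis
  have \<U>X: "U \<subseteq> mspace X" if "U \<in> \<U> j" for U j
    using \<U>[of j] that unfolding open_covers_def by auto
  \<comment> \<open>Size of the sets that can be active between \<open>R k\<close> and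
    \<open>R (Suc k)\<close>: members of the covers \<open>k\<close> and \<open>Suc k\<close>, and
    balls of radius at most 1 about the central net.\<close>
  define B where "B k = max 1 (max (E k) (E (Suc k)))" for k
  have "\<forall>k. \<exists>R'. \<forall>x A. x \<in> mspace X \<longrightarrow> mdist X q x > R' \<longrightarrow> finite A \<longrightarrow> A \<subseteq> mcball_of X x (B k) \<longrightarrow> A \<in> \<L>"
  proof
    fix k
    obtain R' where "\<And>x A. x \<in> mspace X \<Longrightarrow> mdist X q x > R' \<Longrightarrow> finite A \<Longrightarrow> A \<subseteq> mcball_of X x (B k) \<Longrightarrow> A \<in> \<L>"
      by (rule slow_family_far[OF \<L>, of "B k"]) (rule that)
    then show "\<exists>R'. \<forall>x A. x \<in> mspace X \<longrightarrow> mdist X q x > R' \<longrightarrow> finite A \<longrightarrow> A \<subseteq> mcball_of X x (B k) \<longrightarrow> A \<in> \<L>"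
      by (intro exI[of _ R']) simp
  qed
  then obtain R' where R': "\<And>k x A. x \<in> mspace X \<Longrightarrow> mdist X q x > R' k \<Longrightarrow> finite A \<Longrightarrow>
      A \<subseteq> mcball_of X x (B k) \<Longrightarrow> A \<in> \<L>" by metis
  \<comment> \<open>The gap \<open>2 * (real k + 2)\<close> makes room for the tents on overlapping
    annuli; the second entry pushes the annulus to where finite subsets of \<open>B k\<close>-balls
    belong to \<open>\<L>\<close>.\<close>
  define R where "R = rec_nat (max 0 (R' 0 + 1)) (\<lambda>k r. max (r + 2 * (real k + 2)) (R' (Suc k) + 1))"
  have R_Suc: "R k + 2 * (real k + 2) \<le> R (Suc k)" for k by (simp add: R_def)
  have R_R': "R' k < R k" for k by (cases k) (simp_all add: R_def less_max_iff_disj)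
  have R_mono: "R i \<le> R j" if "i \<le> j" for i j
  proof (rule lift_Suc_mono_le[of R, OF _ that])
    show "R n \<le> R (Suc n)" for n using R_Suc[of n] of_nat_0_le_iff[of n, where ?'a=real] by argo
  qed
  have R_ge: "real k \<le> R k" for k
  proof (induction k)
    case 0
    then show ?case by (simp add: R_def)
  next
    case (Suc k)
    then show ?case using R_Suc[of k] by simp
  qed
  have locate: "\<exists>k. R k \<le> t \<and> t < R (Suc k)" if "R 0 \<le> t" for t
  proof -
    let ?P = "\<lambda>k. t < R k"
    obtain j where "t < real j" using reals_Archimedean2 by blast
    then have j: "?P j" using R_ge[of j] by linarith
    define l where "l = (LEAST k. ?P k)"
    have l: "?P l" unfolding l_def by (rule LeastI[of ?P, OF j])
    with that have "l \<noteq> 0" by (cases l) auto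
    then obtain k where k: "l = Suc k" by (cases l) auto
    have "\<not> ?P k" using not_less_Least[of k ?P] k unfolding l_def by simp
    with l k show ?thesis by (intro exI[of _ k]) auto
  qed
  obtain \<eta>0 where \<eta>0: "\<eta>0 > 0" "\<And>A. finite A \<Longrightarrow> A \<subseteq> mcball_of X q (R 0 + 2) \<Longrightarrow>
      \<forall>a\<in>A. \<forall>b\<in>A. mdist X a b \<le> \<eta>0 \<Longrightarrow> A \<in> \<L>"
    by (rule slow_family_local[OF \<L>, of "R 0 + 2"]) (rule that)
  \<comment> \<open>Halved, because two vertices within \<open>\<eta>\<close> of \<open>x\<close>
    have to be within \<open>\<eta>0\<close> of each other.\<close>
  define \<eta> where "\<eta> = min 1 (\<eta>0 / 2)"
  have \<eta>: "0 < \<eta>" "\<eta> \<le> 1" "2 * \<eta> \<le> \<eta>0" using \<eta>0(1) by (auto simp: \<eta>_def)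
  have "compactin (mtopology_of X) (mcball_of X q (R 1))"
    using X q by (auto simp: proper_metric_def)
  then have "M.mtotally_bounded (mcball_of X q (R 1))"
    using M.compactin_imp_mtotally_bounded by (simp add: mtopology_of_def)
  \<comment> \<open>The net reaches up to \<open>R 1\<close>, past the radius \<open>R 0\<close> at
    which the annular bumps set in, so no point in between is left out.\<close>
  then obtain C where C: "finite C" "C \<subseteq> mcball_of X q (R 1)" "mcball_of X q (R 1) \<subseteq> (\<Union>x\<in>C. M.mball x (\<eta> / 2))"
    unfolding M.mtotally_bounded_def using \<eta>(1) by (meson half_gt_zero)
  have CX: "y \<in> mspace X" if "y \<in> C" for y using C(2) that by auto
  define cut where "cut j x = min (mdist X q x - R (j - 1)) (R (Suc j) - mdist X q x)" for j x
  \<comment> \<open>Level 0 consists of bumps about net points, indexed by singletons. Level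
    \<open>j > 0\<close> measures depth in the members of the cover \<open>j\<close>, cut off by a
    tent on the annulus from \<open>R (j - 1)\<close> to \<open>R (Suc j)\<close>.\<close>
  define \<phi> where "\<phi> \<alpha> x = (case \<alpha> of (j, U) \<Rightarrow>
      if j = 0 then (if \<exists>y\<in>C. U = {y} then max 0 (\<eta> - mdist X (the_elem U) x) else 0)
      else if U \<in> \<U> j then max 0 (min (depth X (real j) U x) (cut j x)) else 0)" for \<alpha> x
  define pt where "pt \<alpha> = (SOME y. y \<in> snd \<alpha>)" for \<alpha> :: "nat \<times> 'a set"
  have lip: "one_lipschitz X (\<phi> \<alpha>)" for \<alpha>
  proof -
    obtain j U where \<alpha>: "\<alpha> = (j, U)" by (cases \<alpha>)
    consider "j = 0" "\<exists>y\<in>C. U = {y}" | "j \<noteq> 0" "U \<in> \<U> j" | "\<And>x. \<phi> \<alpha> x = 0"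
      unfolding \<phi>_def \<alpha> by fastforce
    then show ?thesis
    proof cases
      case 1
      then have "\<phi> \<alpha> = (\<lambda>x. max 0 (\<eta> - mdist X (the_elem U) x))" by (simp add: \<phi>_def \<alpha> fun_eq_iff)
      moreover have "the_elem U \<in> mspace X" using 1 CX by auto
      ultimately show ?thesis by (simp add: one_lipschitz_max one_lipschitz_mdist)
    next
      case 2
      then have "\<phi> \<alpha> = (\<lambda>x. max 0 (min (depth X (real j) U x) (cut j x)))" by (simp add: \<phi>_def \<alpha> fun_eq_iff)
      then show ?thesis unfolding cut_def
        by (simp add: one_lipschitz_max one_lipschitz_min one_lipschitz_mdist[OF q] one_lipschitz_depth)
    next
      case 3
      then show ?thesis by (simp add: one_lipschitz_def)
    qed
  qed
  have pos0: "\<exists>y\<in>C. U = {y} \<and> mdist X y x < \<eta>" if "0 < \<phi> (0, U) x" for U x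
    using that by (auto simp: \<phi>_def split: if_splits)
  have posS: "U \<in> \<U> j \<and> x \<in> U \<and> R (j - 1) < mdist X q x \<and> mdist X q x < R (Suc j)"
    if "0 < \<phi> (j, U) x" "j \<noteq> 0" "x \<in> mspace X" for j U x
  proof -
    have "U \<in> \<U> j" "0 < depth X (real j) U x" "0 < cut j x" using that by (auto simp: \<phi>_def split: if_splits)
    with depth_pos[of "real j" x X U] that show ?thesis by (auto simp: cut_def)
  qed
  have levels: "j = k \<or> j = Suc k" if "0 < \<phi> (j, U) x" "j \<noteq> 0" "x \<in> mspace X" "R k \<le> mdist X q x" "mdist X q x < R (Suc k)" for j k U x
  proof -
    have "R (j - 1) < R (Suc k)" "R k < R (Suc j)" using posS[OF that(1-3)] that by linarith+
    then have "j - 1 < Suc k" "k < Suc j"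
      using R_mono[of "Suc k" "j - 1"] R_mono[of "Suc j" k] by (meson not_less)+
    then show ?thesis using that(2) by linarith
  qed
  have nolevel: "j = 0" if "0 < \<phi> (j, U) x" "x \<in> mspace X" "mdist X q x \<le> R 0" for j U x
  proof (rule ccontr)
    assume "j \<noteq> 0"
    then have "R (j - 1) < R 0" using posS[OF that(1) _ that(2)] that(3) by linarith
    then show False using R_mono[of 0 "j - 1"] by simp
  qed
  have supp: "finite {\<alpha>. 0 < \<phi> \<alpha> x} \<and> card {\<alpha>. 0 < \<phi> \<alpha> x} \<le> card C + ((D + 1) + (D + 1))" if x: "x \<in> mspace X" for x
  proof -
    have fin: "finite {U \<in> \<U> j. x \<in> U}" "card {U \<in> \<U> j. x \<in> U} \<le> D + 1" for j
      using mult[of j] x unfolding multiplicity_le_def by auto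
    obtain k where k: "R 0 \<le> mdist X q x \<Longrightarrow> R k \<le> mdist X q x \<and> mdist X q x < R (Suc k)"
      using locate[of "mdist X q x"] by blast
    let ?S0 = "(\<lambda>y. (0::nat, {y})) ` C"
    let ?S1 = "Pair k ` {U \<in> \<U> k. x \<in> U}" and ?S2 = "Pair (Suc k) ` {U \<in> \<U> (Suc k). x \<in> U}"
    have sub: "{\<alpha>. 0 < \<phi> \<alpha> x} \<subseteq> ?S0 \<union> (?S1 \<union> ?S2)"
    proof
      fix \<alpha> assume "\<alpha> \<in> {\<alpha>. 0 < \<phi> \<alpha> x}"
      then obtain j U where \<alpha>: "\<alpha> = (j, U)" "0 < \<phi> (j, U) x" by (cases \<alpha>) auto
      show "\<alpha> \<in> ?S0 \<union> (?S1 \<union> ?S2)"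
      proof (cases "j = 0")
        case True
        with \<alpha> pos0[of U x] show ?thesis by blast
      next
        case False
        have "R 0 \<le> mdist X q x" using nolevel[OF \<alpha>(2) x] False by linarith
        with levels[OF \<alpha>(2) False x] k posS[OF \<alpha>(2) False x] \<alpha>(1) show ?thesis by blast
      qed
    qed
    have f: "finite (?S0 \<union> (?S1 \<union> ?S2))" using C(1) fin by simp
    have c0: "card ?S0 \<le> card C" using C(1) by (rule card_image_le)
    have c1: "card ?S1 \<le> D + 1" using card_image_le[OF fin(1)[of k], of "Pair k"] fin(2)[of k] by linarith
    have c2: "card ?S2 \<le> D + 1" using card_image_le[OF fin(1)[of "Suc k"], of "Pair (Suc k)"] fin(2)[of "Suc k"] by linarith
    have "card {\<alpha>. 0 < \<phi> \<alpha> x} \<le> card (?S0 \<union> (?S1 \<union> ?S2))" by (rule card_mono[OF f sub])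
    also have "\<dots> \<le> card ?S0 + (card ?S1 + card ?S2)"
      using card_Un_le[of ?S0 "?S1 \<union> ?S2"] card_Un_le[of ?S1 ?S2] by linarith
    finally show ?thesis using finite_subset[OF sub f] c0 c1 c2 by linarith
  qed
  have near: "\<exists>\<alpha>. 0 < \<phi> \<alpha> x" if x: "x \<in> mspace X" "mdist X q x < R 1" for x
  proof -
    have "x \<in> mcball_of X q (R 1)" using x q by simp
    then obtain y where "y \<in> C" "mdist X y x < \<eta> / 2" using C(3) by auto
    then have "0 < \<phi> (0, {y}) x" using \<eta> by (auto simp: \<phi>_def)
    then show ?thesis ..
  qed
  have far: "\<exists>\<alpha>. real j / 3 \<le> \<phi> \<alpha> x" if x: "x \<in> mspace X" and j: "j \<noteq> 0" and k: "R j \<le> mdist X q x" "mdist X q x < R (Suc j)" for x j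
  proof -
    \<comment> \<open>The ball of radius \<open>i / 3\<close> has diameter at most
      \<open>2 * i / 3 < i + 1\<close>, so the Lebesgue number puts it into one member, where
      \<open>x\<close> then has depth at least \<open>i / 3\<close>.\<close>
    have main: "\<exists>U. real j / 3 \<le> \<phi> (i, U) x" if i: "i \<noteq> 0" "j \<le> i" and "real j \<le> cut i x" for i
    proof -
      have "\<exists>U\<in>\<U> i. mcball_of X x (real i / 3) \<subseteq> U"
      proof -
        let ?M = "mcball_of X x (real i / 3)"
        have "mdist X a b \<le> 2 * real i / 3" if "a \<in> ?M" "b \<in> ?M" for a b
          using that M.triangle[of a x b] by (auto simp: M.commute)
        then have "2 * real i / 3 < real i + 1 \<and> (\<forall>a\<in>?M. \<forall>b\<in>?M. mdist X a b \<le> 2 * real i / 3)"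
          by simp
        then have e: "\<exists>e<real i + 1. \<forall>a\<in>?M. \<forall>b\<in>?M. mdist X a b \<le> e" by (rule exI)
        have "?M \<subseteq> mspace X" by auto
        from leb[of i, unfolded lebesgue_number_ge_def, rule_format, OF this e] show ?thesis .
      qed
      then obtain U where U: "U \<in> \<U> i" "mcball_of X x (real i / 3) \<subseteq> U" by blast
      have "real i / 3 \<le> depth X (real i) U x"
      proof (rule depth_ge)
        fix y assume "y \<in> mspace X - U"
        then have "y \<notin> mcball_of X x (real i / 3)" "y \<in> mspace X" using U(2) by auto
        then show "real i / 3 \<le> mdist X x y" using x by simp
      qed auto
      then have "real j / 3 \<le> depth X (real i) U x" using i(2) by (simp add: field_simps)
      then show ?thesis using U(1) i that(3) by (intro exI[of _ U]) (simp add: \<phi>_def)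
    qed
    obtain i where i: "j = Suc i" using j by (cases j) auto
    \<comment> \<open>In the inner half of the annulus the tent of level \<open>j\<close> is still
      high, in the outer half that of level \<open>Suc j\<close> already is.\<close>
    show ?thesis
    proof (cases "mdist X q x \<le> (R j + R (Suc j)) / 2")
      case True
      have "real j \<le> cut j x" using True R_Suc[of j] R_Suc[of i] k i by (simp add: cut_def field_simps)
      then show ?thesis using main[OF j order_refl] by blast
    next
      case False
      have "real j \<le> cut (Suc j) x" using False R_Suc[of j] R_Suc[of "Suc j"] k by (simp add: cut_def field_simps)
      then show ?thesis using main[of "Suc j"] by auto
    qed
  qed
  have posx: "\<exists>\<alpha>. 0 < \<phi> \<alpha> x" if x: "x \<in> mspace X" for x
  proof (cases "mdist X q x < R 1")
    case True
    then show ?thesis using near[OF x] by blast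
  next
    case False
    then have "R 0 \<le> mdist X q x" using R_mono[of 0 1] by simp
    then obtain k where k: "R k \<le> mdist X q x" "mdist X q x < R (Suc k)" using locate by blast
    have "k \<noteq> 0" using k(2) False by (cases k) auto
    from far[OF x this k] obtain \<alpha> where "real k / 3 \<le> \<phi> \<alpha> x" ..
    moreover have "0 < real k / 3" using \<open>k \<noteq> 0\<close> by simp
    ultimately have "0 < \<phi> \<alpha> x" by linarith
    then show ?thesis ..
  qed
  have large: "\<exists>R. \<forall>x\<in>mspace X. R < mdist X q x \<longrightarrow> (\<exists>\<alpha>. r \<le> \<phi> \<alpha> x)" for r
  proof -
    obtain j where j: "3 * r < real j" using reals_Archimedean2 by blast
    show ?thesis
    proof (rule exI[of _ "R (Suc j)"], intro ballI impI)
      fix x assume x: "x \<in> mspace X" "R (Suc j) < mdist X q x"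
      then have "R 0 \<le> mdist X q x" using R_mono[of 0 "Suc j"] by simp
      then obtain k where k: "R k \<le> mdist X q x" "mdist X q x < R (Suc k)" using locate by blast
      have "R (Suc j) < R (Suc k)" using x k by linarith
      then have jk: "Suc j < Suc k" using R_mono[of "Suc k" "Suc j"] by (cases "Suc j < Suc k") auto
      then have "k \<noteq> 0" by simp
      from far[OF x(1) this k] obtain \<alpha> where "real k / 3 \<le> \<phi> \<alpha> x" ..
      moreover have "r \<le> real k / 3" using j jk by (simp add: field_simps)
      ultimately show "\<exists>\<alpha>. r \<le> \<phi> \<alpha> x" by (meson order_trans)
    qed
  qed
  have ptin: "pt (j, U) \<in> U" if "x \<in> U" for j U x
    unfolding pt_def using someI[of "\<lambda>y. y \<in> U" x] that by simp
  have pt0: "pt (j, {y}) = y" for j y by (simp add: pt_def)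
  have pts: "pt \<alpha> \<in> mspace X" if x: "x \<in> mspace X" and \<alpha>: "0 < \<phi> \<alpha> x" for \<alpha> x
  proof -
    obtain j U where jU: "\<alpha> = (j, U)" by (cases \<alpha>)
    show ?thesis
    proof (cases "j = 0")
      case True
      with \<alpha> pos0[of U x] CX pt0 jU show ?thesis by auto
    next
      case False
      with posS[of j U x] \<alpha> x jU ptin[of x U j] \<U>X show ?thesis by blast
    qed
  qed
  have inL: "insert x (pt ` {\<alpha>. 0 < \<phi> \<alpha> x}) \<in> \<L>" if x: "x \<in> mspace X" for x
  proof -
    let ?A = "insert x (pt ` {\<alpha>. 0 < \<phi> \<alpha> x})"
    have fA: "finite ?A" using supp[OF x] by simp
    show ?thesis
    proof (cases "mdist X q x \<le> R 0")
      case True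
      have d: "a \<in> mspace X \<and> mdist X x a \<le> \<eta>" if "a \<in> ?A" for a
      proof (cases "a = x")
        case False
        with that obtain j U where a: "a = pt (j, U)" "0 < \<phi> (j, U) x" by auto
        have "j = 0" using nolevel[OF a(2) x True] .
        with a pos0[of U x] pt0 CX show ?thesis by (auto simp: mdist_commute)
      qed (use x \<eta> in simp)
      show ?thesis
      proof (rule \<eta>0(2)[OF fA])
        show "?A \<subseteq> mcball_of X q (R 0 + 2)"
        proof
          fix a assume "a \<in> ?A"
          then show "a \<in> mcball_of X q (R 0 + 2)"
            using d[of a] mdist_triangle[OF q x, of a] True q \<eta> by auto
        qed
        show "\<forall>a\<in>?A. \<forall>b\<in>?A. mdist X a b \<le> \<eta>0"
        proof (intro ballI)
          fix a b assume "a \<in> ?A" "b \<in> ?A"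
          with d[of a] d[of b] have "a \<in> mspace X" "b \<in> mspace X" "mdist X x a \<le> \<eta>" "mdist X x b \<le> \<eta>" by auto
          then show "mdist X a b \<le> \<eta>0" using mdist_triangle[of a X x b] x \<eta>(3) by (simp add: mdist_commute)
        qed
      qed
    next
      case False
      then obtain k where k: "R k \<le> mdist X q x" "mdist X q x < R (Suc k)" using locate[of "mdist X q x"] by auto
      have "?A \<subseteq> mcball_of X x (B k)"
      proof
        fix a assume "a \<in> ?A"
        then consider "a = x" | j U where "a = pt (j, U)" "0 < \<phi> (j, U) x" by auto
        then have "a \<in> mspace X \<and> mdist X x a \<le> B k"
        proof cases
          case 1
          then show ?thesis using x by (simp add: B_def)
        next
          case 2
          show ?thesis
          proof (cases "j = 0")
            case True
            with 2 pos0[of U x] pt0 CX \<eta> show ?thesis by (auto simp: mdist_commute B_def)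
          next
            case False
            have jk: "j = k \<or> j = Suc k" using levels[OF 2(2) False x k] .
            have U: "U \<in> \<U> j" "x \<in> U" using posS[OF 2(2) False x] by auto
            have "mdist X x a \<le> E j" using E[OF U] ptin[OF U(2)] 2(1) by simp
            moreover have "a \<in> mspace X" using pts[OF x 2(2)] 2(1) by simp
            ultimately show ?thesis using jk by (auto simp: B_def)
          qed
        qed
        then show "a \<in> mcball_of X x (B k)" using x by simp
      qed
      moreover have "R' k < mdist X q x" using k(1) R_R'[of k] by linarith
      ultimately show ?thesis using R'[OF x _ fA] by blast
    qed
  qed
  show thesis
  proof (rule that[of \<phi> "card C + ((D + 1) + (D + 1))" pt])
    show "0 \<le> \<phi> \<alpha> x" for \<alpha> x by (auto simp: \<phi>_def split: prod.splits)
  qed (fact lip supp posx large inL pts)+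
qed

section \<open>Barycentric subdivision of a system of bumps\<close>

definition bumps :: "'a metric \<Rightarrow> nat \<Rightarrow> ('i \<Rightarrow> 'a \<Rightarrow> real) \<Rightarrow> bool" where
  "bumps X N \<phi> \<longleftrightarrow> (\<forall>\<alpha>. one_lipschitz X (\<phi> \<alpha>)) \<and> (\<forall>\<alpha> x. 0 \<le> \<phi> \<alpha> x) \<and>
     (\<forall>x\<in>mspace X. finite {\<alpha>. 0 < \<phi> \<alpha> x} \<and> card {\<alpha>. 0 < \<phi> \<alpha> x} \<le> N)"

text \<open>Halving the gap makes the function 1-Lipschitz again.\<close>

definition bary :: "('i \<Rightarrow> 'a \<Rightarrow> real) \<Rightarrow> 'i set \<Rightarrow> 'a \<Rightarrow> real" where
  "bary \<phi> \<sigma> x = (if finite \<sigma> \<and> \<sigma> \<noteq> {} then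
     max 0 ((Min ((\<lambda>\<alpha>. \<phi> \<alpha> x) ` \<sigma>) - Sup (insert 0 ((\<lambda>\<beta>. \<phi> \<beta> x) ` (- \<sigma>)))) / 2) else 0)"

lemma bumps_lipschitz: "bumps X N \<phi> \<Longrightarrow> one_lipschitz X (\<phi> \<alpha>)"
  by (simp add: bumps_def)

lemma bumps_bdd_above:
  assumes "bumps X N \<phi>" "x \<in> mspace X"
  shows "bdd_above (insert 0 ((\<lambda>\<beta>. \<phi> \<beta> x) ` I))"
proof -
  have "\<phi> \<beta> x \<in> insert 0 ((\<lambda>\<beta>. \<phi> \<beta> x) ` {\<alpha>. 0 < \<phi> \<alpha> x})" for \<beta>
  proof (cases "0 < \<phi> \<beta> x")
    case False
    then have "\<phi> \<beta> x = 0" using assms(1) unfolding bumps_def by (simp add: order_antisym)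
    then show ?thesis by simp
  qed simp
  then have "insert 0 ((\<lambda>\<beta>. \<phi> \<beta> x) ` I) \<subseteq> insert 0 ((\<lambda>\<beta>. \<phi> \<beta> x) ` {\<alpha>. 0 < \<phi> \<alpha> x})" by blast
  moreover have "finite (insert 0 ((\<lambda>\<beta>. \<phi> \<beta> x) ` {\<alpha>. 0 < \<phi> \<alpha> x}))"
    using assms unfolding bumps_def by simp
  ultimately show ?thesis by (meson bdd_above_finite finite_subset)
qed

lemma sup_bumps_ge:
  assumes "bumps X N \<phi>" "x \<in> mspace X"
  shows "\<beta> \<in> I \<Longrightarrow> \<phi> \<beta> x \<le> Sup (insert 0 ((\<lambda>\<beta>. \<phi> \<beta> x) ` I))" "0 \<le> Sup (insert 0 ((\<lambda>\<beta>. \<phi> \<beta> x) ` I))"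
  using bumps_bdd_above[OF assms, of I] by (auto intro: cSup_upper)

lemma sup_bumps_le:
  "0 \<le> (t::real) \<Longrightarrow> (\<And>\<beta>. \<beta> \<in> I \<Longrightarrow> \<phi> \<beta> x \<le> t) \<Longrightarrow> Sup (insert 0 ((\<lambda>\<beta>. \<phi> \<beta> x) ` I)) \<le> t"
  by (rule cSup_least) auto

lemma one_lipschitz_sup_bumps:
  assumes "bumps X N \<phi>"
  shows "one_lipschitz X (\<lambda>x. Sup (insert 0 ((\<lambda>\<beta>. \<phi> \<beta> x) ` I)))"
  unfolding one_lipschitz_def
proof (intro ballI)
  fix x y assume xy: "x \<in> mspace X" "y \<in> mspace X"
  show "Sup (insert 0 ((\<lambda>\<beta>. \<phi> \<beta> x) ` I)) \<le> Sup (insert 0 ((\<lambda>\<beta>. \<phi> \<beta> y) ` I)) + mdist X x y"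
  proof (rule sup_bumps_le)
    show "0 \<le> Sup (insert 0 ((\<lambda>\<beta>. \<phi> \<beta> y) ` I)) + mdist X x y"
      using sup_bumps_ge(2)[OF assms xy(2), of I] by simp
    fix \<beta> assume "\<beta> \<in> I"
    then have "\<phi> \<beta> y \<le> Sup (insert 0 ((\<lambda>\<beta>. \<phi> \<beta> y) ` I))" by (rule sup_bumps_ge(1)[OF assms xy(2)])
    moreover have "\<phi> \<beta> x \<le> \<phi> \<beta> y + mdist X x y"
      by (rule one_lipschitzD[OF bumps_lipschitz[OF assms] xy])
    ultimately show "\<phi> \<beta> x \<le> Sup (insert 0 ((\<lambda>\<beta>. \<phi> \<beta> y) ` I)) + mdist X x y" by linarith
  qed
qed

text \<open>Positivity says that the values of \<open>\<phi>\<close> at \<open>x\<close> on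
  \<open>\<sigma>\<close> exceed 0 and all values off \<open>\<sigma>\<close>, so
  \<open>\<sigma>\<close> is a superlevel set of \<alpha> \<mapsto>
  \<open>\<phi> \<alpha> x\<close>. In barycentric coordinates this describes the open star of the
  barycentre of \<open>\<sigma>\<close>.\<close>

lemma bary_pos:
  assumes "bumps X N \<phi>" "x \<in> mspace X" "0 < bary \<phi> \<sigma> x"
  shows "finite \<sigma>" "\<sigma> \<noteq> {}" "\<alpha> \<in> \<sigma> \<Longrightarrow> 0 < \<phi> \<alpha> x" "\<alpha> \<in> \<sigma> \<Longrightarrow> \<beta> \<notin> \<sigma> \<Longrightarrow> \<phi> \<beta> x < \<phi> \<alpha> x"
proof -
  have f': "finite \<sigma> \<and> \<sigma> \<noteq> {}"
  proof (rule ccontr)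
    assume "\<not> ?thesis"
    then have "bary \<phi> \<sigma> x = 0" unfolding bary_def by (rule if_not_P)
    with assms(3) show False by simp
  qed
  then show f: "finite \<sigma>" "\<sigma> \<noteq> {}" by simp_all
  have "c < a" if "0 < max 0 ((a - c) / 2)" for a c :: real
    using that by (auto simp: max_def split: if_splits)
  from this[OF assms(3)[unfolded bary_def if_P[OF f']]]
  have less: "Sup (insert 0 ((\<lambda>\<beta>. \<phi> \<beta> x) ` (- \<sigma>))) < Min ((\<lambda>\<alpha>. \<phi> \<alpha> x) ` \<sigma>)" .
  have *: "Min ((\<lambda>\<alpha>. \<phi> \<alpha> x) ` \<sigma>) \<le> \<phi> \<alpha> x" if "\<alpha> \<in> \<sigma>" for \<alpha> using f that by (intro Min_le) auto
  show "\<alpha> \<in> \<sigma> \<Longrightarrow> 0 < \<phi> \<alpha> x" using less *[of \<alpha>] sup_bumps_ge(2)[OF assms(1,2), of "- \<sigma>"] by linarith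
  show "\<phi> \<beta> x < \<phi> \<alpha> x" if "\<alpha> \<in> \<sigma>" "\<beta> \<notin> \<sigma>"
    using less *[OF that(1)] sup_bumps_ge(1)[OF assms(1,2), of \<beta> "- \<sigma>"] that(2) by simp
qed

text \<open>Superlevel sets of one and the same function are nested.\<close>

lemma bary_chain:
  assumes "bumps X N \<phi>" "x \<in> mspace X" "0 < bary \<phi> \<sigma> x" "0 < bary \<phi> \<tau> x"
  shows "\<sigma> \<subseteq> \<tau> \<or> \<tau> \<subseteq> \<sigma>"
proof (rule ccontr)
  assume "\<not> ?thesis"
  then obtain \<alpha> \<beta> where "\<alpha> \<in> \<sigma>" "\<alpha> \<notin> \<tau>" "\<beta> \<in> \<tau>" "\<beta> \<notin> \<sigma>" by blast
  with bary_pos(4)[OF assms(1-3), of \<alpha> \<beta>] bary_pos(4)[OF assms(1,2,4), of \<beta> \<alpha>] show False by simp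
qed

lemma bary_card_le:
  assumes "bumps X N \<phi>" "x \<in> mspace X" "0 < bary \<phi> \<sigma> x"
  shows "card \<sigma> \<in> {1..N}" "\<sigma> \<subseteq> {\<alpha>. 0 < \<phi> \<alpha> x}"
proof -
  show sub: "\<sigma> \<subseteq> {\<alpha>. 0 < \<phi> \<alpha> x}" using bary_pos(3)[OF assms] by blast
  have "finite {\<alpha>. 0 < \<phi> \<alpha> x}" "card {\<alpha>. 0 < \<phi> \<alpha> x} \<le> N" using assms(1,2) unfolding bumps_def by blast+
  then have "card \<sigma> \<le> N" using card_mono[OF _ sub] by (meson order_trans)
  moreover have "card \<sigma> \<noteq> 0" using bary_pos(1,2)[OF assms] by simp
  ultimately show "card \<sigma> \<in> {1..N}" by simp
qed

lemma bary_card_inj: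
  assumes "bumps X N \<phi>" "x \<in> mspace X" "0 < bary \<phi> \<sigma> x" "0 < bary \<phi> \<tau> x" "card \<sigma> = card \<tau>"
  shows "\<sigma> = \<tau>"
  using bary_chain[OF assms(1-4)] bary_pos(1)[OF assms(1-3)] bary_pos(1)[OF assms(1,2,4)] assms(5)
  by (metis card_subset_eq)

text \<open>Minimum and supremum of 1-Lipschitz functions are 1-Lipschitz, and so is half of their
  difference. The multiplicity bound survives because a chain of sets with cardinalities in
  \<open>{1..N}\<close> has at most \<open>N\<close> members.\<close>

lemma bumps_bary:
  assumes "bumps X N \<phi>"
  shows "bumps X N (bary \<phi>)"
  unfolding bumps_def
proof (intro conjI allI ballI)
  fix \<sigma> :: "'b set"
  show "0 \<le> bary \<phi> \<sigma> x" for x by (simp add: bary_def)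
  show "one_lipschitz X (bary \<phi> \<sigma>)"
  proof (cases "finite \<sigma> \<and> \<sigma> \<noteq> {}")
    case True
    let ?m = "\<lambda>x. Min ((\<lambda>\<alpha>. \<phi> \<alpha> x) ` \<sigma>)" and ?M = "\<lambda>x. Sup (insert 0 ((\<lambda>\<beta>. \<phi> \<beta> x) ` (- \<sigma>)))"
    have "bary \<phi> \<sigma> x \<le> bary \<phi> \<sigma> y + mdist X x y" if xy: "x \<in> mspace X" "y \<in> mspace X" for x y
    proof -
      have 1: "?M y \<le> ?M x + mdist X x y"
        using one_lipschitzD[OF one_lipschitz_sup_bumps[OF assms], of y x] xy by (simp add: mdist_commute)
      have 2: "?m x - mdist X x y \<le> ?m y"
      proof (subst Min_ge_iff)
        show "\<forall>a\<in>(\<lambda>\<alpha>. \<phi> \<alpha> y) ` \<sigma>. ?m x - mdist X x y \<le> a"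
        proof
          fix a assume "a \<in> (\<lambda>\<alpha>. \<phi> \<alpha> y) ` \<sigma>"
          then obtain \<alpha> where \<alpha>: "\<alpha> \<in> \<sigma>" "a = \<phi> \<alpha> y" by blast
          have "?m x \<le> \<phi> \<alpha> x" using True \<alpha> by (intro Min_le) auto
          moreover have "\<phi> \<alpha> x \<le> \<phi> \<alpha> y + mdist X x y"
            by (rule one_lipschitzD[OF bumps_lipschitz[OF assms] xy])
          ultimately show "?m x - mdist X x y \<le> a" using \<alpha> by linarith
        qed
      qed (use True in auto)
      have "max 0 ((a - c) / 2) \<le> max 0 ((a' - c') / 2) + e"
        if "c' \<le> c + e" "a - e \<le> a'" "0 \<le> e" for a a' c c' e :: real
        using that by (auto simp: max_def field_simps)
      from this[OF 1 2 mdist_nonneg] show ?thesis unfolding bary_def if_P[OF True] .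
    qed
    then show ?thesis by (simp add: one_lipschitz_def)
  next
    case False
    then have "bary \<phi> \<sigma> = (\<lambda>x. 0)" unfolding bary_def by auto
    then show ?thesis by simp
  qed
next
  fix x assume x: "x \<in> mspace X"
  have "{\<sigma>. 0 < bary \<phi> \<sigma> x} \<subseteq> Pow {\<alpha>. 0 < \<phi> \<alpha> x}"
    using bary_card_le(2)[OF assms x] by blast
  then show "finite {\<sigma>. 0 < bary \<phi> \<sigma> x}"
    using assms x unfolding bumps_def by (auto intro: finite_subset)
  have "card {\<sigma>. 0 < bary \<phi> \<sigma> x} \<le> card {1..N}"
  proof (rule card_inj_on_le[of card])
    show "inj_on card {\<sigma>. 0 < bary \<phi> \<sigma> x}"
      by (rule inj_onI) (use bary_card_inj[OF assms x] in blast)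
    show "card ` {\<sigma>. 0 < bary \<phi> \<sigma> x} \<subseteq> {1..N}" using bary_card_le(1)[OF assms x] by blast
  qed simp
  then show "card {\<sigma>. 0 < bary \<phi> \<sigma> x} \<le> N" by simp
qed

text \<open>Pigeonhole: one of the \<open>N\<close> intervals of length \<open>s / N\<close> below \<open>s\<close> contains no value.\<close>

lemma bary_large:
  assumes \<phi>: "bumps X N \<phi>" and x: "x \<in> mspace X" and s: "0 < s" "s \<le> \<phi> \<alpha> x"
  shows "0 < N" "\<exists>\<sigma>. s / (2 * real N) \<le> bary \<phi> \<sigma> x"
proof -
  let ?P = "{\<alpha>. 0 < \<phi> \<alpha> x}"
  have P: "finite ?P" "card ?P \<le> N" using \<phi> x unfolding bumps_def by blast+
  have \<alpha>: "\<alpha> \<in> ?P" using s by simp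
  then have "0 < card ?P" using P(1) card_gt_0_iff by blast
  with P(2) show N: "0 < N" by linarith
  \<comment> \<open>If every interval contained a value, \<open>N\<close> distinct indices would
    have values strictly between 0 and \<open>s\<close>; together with \<open>\<alpha>\<close>,
    whose value is at least \<open>s\<close>, they exceed the multiplicity bound.\<close>
  have "\<exists>k<N. \<forall>\<beta>. \<not> (s * real k / real N < \<phi> \<beta> x \<and> \<phi> \<beta> x < s * real (Suc k) / real N)"
  proof (rule ccontr)
    assume "\<not> ?thesis"
    then have "\<forall>k\<in>{..<N}. \<exists>\<beta>. s * real k / real N < \<phi> \<beta> x \<and> \<phi> \<beta> x < s * real (Suc k) / real N" by blast
    then obtain f where f: "\<forall>k\<in>{..<N}. s * real k / real N < \<phi> (f k) x \<and> \<phi> (f k) x < s * real (Suc k) / real N"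
      by (rule bchoice[THEN exE])
    have fN: "s * real k < \<phi> (f k) x * real N" "\<phi> (f k) x * real N < s * real (Suc k)" if "k < N" for k
      using f that N by (auto simp: field_simps)
    have "inj_on f {..<N}"
    proof (rule inj_onI)
      fix k l assume kl: "k \<in> {..<N}" "l \<in> {..<N}" "f k = f l"
      then have "s * real k < s * real (Suc l)" "s * real l < s * real (Suc k)"
        using fN[of k] fN[of l] by auto
      then have "k < Suc l" "l < Suc k" using s(1) by (simp_all only: mult_less_cancel_left_pos of_nat_less_iff)
      then show "k = l" by simp
    qed
    moreover have "f ` {..<N} \<subseteq> ?P - {\<alpha>}"
    proof
      fix \<beta> assume "\<beta> \<in> f ` {..<N}"
      then obtain k where k: "k < N" "\<beta> = f k" by auto
      have "0 \<le> s * real k" using s(1) by simp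
      then have "0 < \<phi> \<beta> x * real N" using fN(1)[OF k(1)] k(2) by simp
      then have "0 < \<phi> \<beta> x" using N by (simp add: zero_less_mult_iff)
      moreover have "s * real (Suc k) \<le> s * real N" using k(1) s(1) by (intro mult_left_mono) auto
      then have "\<phi> \<beta> x * real N < s * real N" using fN(2)[OF k(1)] k(2) by simp
      then have "\<phi> \<beta> x < s" using N by (simp add: mult_less_cancel_right_pos)
      ultimately show "\<beta> \<in> ?P - {\<alpha>}" using s(2) by auto
    qed
    ultimately have "card {..<N} \<le> card (?P - {\<alpha>})" using P(1) by (intro card_inj_on_le) auto
    also have "\<dots> = card ?P - 1" using \<alpha> P(1) by simp
    finally show False using P(2) N by simp
  qed
  then obtain k where k: "k < N" "\<And>\<beta>. s * real (Suc k) / real N \<le> \<phi> \<beta> x \<or> \<phi> \<beta> x \<le> s * real k / real N"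
    by (meson not_less)
  \<comment> \<open>Cutting at the upper end of the empty interval leaves a gap of at least its
    length \<open>s / N\<close>, which \<open>bary\<close> halves.\<close>
  define \<sigma> where "\<sigma> = {\<beta>. s * real (Suc k) / real N \<le> \<phi> \<beta> x}"
  have pos: "0 < s * real (Suc k) / real N" using s(1) N by simp
  have "s * real (Suc k) / real N \<le> s"
    using k(1) s(1) N by (simp add: divide_le_eq mult_left_mono del: of_nat_Suc)
  then have "\<alpha> \<in> \<sigma>" using s(2) by (simp add: \<sigma>_def)
  moreover have "finite \<sigma>" by (rule finite_subset[OF _ P(1)]) (use pos in \<open>auto simp: \<sigma>_def\<close>)
  ultimately have f: "finite \<sigma> \<and> \<sigma> \<noteq> {}" by blast
  have "s * real (Suc k) / real N \<le> Min ((\<lambda>\<alpha>. \<phi> \<alpha> x) ` \<sigma>)" using f by (auto simp: \<sigma>_def)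
  moreover have "Sup (insert 0 ((\<lambda>\<beta>. \<phi> \<beta> x) ` (- \<sigma>))) \<le> s * real k / real N"
  proof (rule sup_bumps_le)
    show "0 \<le> s * real k / real N" using s(1) by simp
    show "\<phi> \<beta> x \<le> s * real k / real N" if "\<beta> \<in> - \<sigma>" for \<beta> using k(2)[of \<beta>] that by (auto simp: \<sigma>_def)
  qed
  moreover have "s * real (Suc k) / real N - s * real k / real N = s / real N"
    using N by (simp add: field_simps)
  ultimately have "s / real N \<le> Min ((\<lambda>\<alpha>. \<phi> \<alpha> x) ` \<sigma>) - Sup (insert 0 ((\<lambda>\<beta>. \<phi> \<beta> x) ` (- \<sigma>)))" by linarith
  moreover have "(Min ((\<lambda>\<alpha>. \<phi> \<alpha> x) ` \<sigma>) - Sup (insert 0 ((\<lambda>\<beta>. \<phi> \<beta> x) ` (- \<sigma>)))) / 2 \<le> bary \<phi> \<sigma> x"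
    unfolding bary_def if_P[OF f] by (rule max.cobounded2)
  moreover have "s / (2 * real N) = s / real N / 2" by simp
  moreover have "a / 2 \<le> e" if "a \<le> c" "c / 2 \<le> e" for a c e :: real using that by linarith
  ultimately have "s / (2 * real N) \<le> bary \<phi> \<sigma> x" by (simp only:)
  then show "\<exists>\<sigma>. s / (2 * real N) \<le> bary \<phi> \<sigma> x" ..
qed

lemma finite_chain_least:
  assumes "finite s" "s \<noteq> {}" "\<And>\<sigma> \<tau>. \<sigma> \<in> s \<Longrightarrow> \<tau> \<in> s \<Longrightarrow> \<sigma> \<subseteq> \<tau> \<or> \<tau> \<subseteq> \<sigma>"
  shows "\<Inter>s \<in> s"
  using assms
proof (induction s rule: finite_ne_induct)
  case (insert \<sigma> s)
  then have "\<Inter>s \<in> s" by blast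
  with insert.prems[of \<sigma> "\<Inter>s"] show ?case by (auto simp: Int_absorb1 Int_absorb2)
qed simp

text \<open>
  After two subdivisions the simplices \<open>s\<close> meeting at a point form a chain, and the vertices of such
  a simplex are told apart by their cardinality. So the values of \<open>b\<close> on the faces of \<open>s\<close> form a
  table indexed by lists of numbers, and there are only finitely many such tables.
\<close>

lemma finite_types_exist:
  fixes X :: "'a metric" and u :: "'a \<Rightarrow> 'u" and b :: "'a list \<Rightarrow> int" and m :: int
  assumes X: "proper_metric X" and asdim: "asdim_le X D" and q: "q \<in> mspace X"
    and \<L>: "slow_family X q \<L>" and u: "finite (u ` mspace X)" and m: "0 < m" and n: "0 < n"
  obtains T :: "(nat \<times> nat \<times> (nat list \<Rightarrow> int) \<times> 'u) set" and \<Psi> w \<beta>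
  where "finite T" "\<And>t. one_lipschitz X (\<Psi> t)" "\<And>t x. x \<in> mspace X \<Longrightarrow> 0 \<le> \<Psi> t x"
    "\<And>x. x \<in> mspace X \<Longrightarrow> \<exists>t\<in>T. 0 < \<Psi> t x"
    "\<And>r. \<exists>R. \<forall>x\<in>mspace X. R < mdist X q x \<longrightarrow> (\<exists>t\<in>T. r \<le> \<Psi> t x)"
    "\<And>x. x \<in> mspace X \<Longrightarrow> \<exists>v. (\<forall>t\<in>T. 0 < \<Psi> t x \<longrightarrow> v t \<in> mspace X \<and> u (v t) = w t) \<and>
        insert x (v ` {t\<in>T. 0 < \<Psi> t x}) \<in> \<L> \<and>
        (\<forall>ts. length ts = n \<longrightarrow> set ts \<subseteq> {t\<in>T. 0 < \<Psi> t x} \<longrightarrow> m dvd \<beta> ts - b (map v ts))"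
proof -
  obtain \<phi> :: "nat \<times> 'a set \<Rightarrow> 'a \<Rightarrow> real" and pt :: "nat \<times> 'a set \<Rightarrow> 'a" and N :: nat
  where \<phi>: "\<And>\<alpha>. one_lipschitz X (\<phi> \<alpha>)" "\<And>\<alpha> x. 0 \<le> \<phi> \<alpha> x"
    "\<And>x. x \<in> mspace X \<Longrightarrow> finite {\<alpha>. 0 < \<phi> \<alpha> x} \<and> card {\<alpha>. 0 < \<phi> \<alpha> x} \<le> N"
    and \<phi>_pos: "\<And>x. x \<in> mspace X \<Longrightarrow> \<exists>\<alpha>. 0 < \<phi> \<alpha> x"
    and \<phi>_large: "\<And>r. \<exists>R. \<forall>x\<in>mspace X. R < mdist X q x \<longrightarrow> (\<exists>\<alpha>. r \<le> \<phi> \<alpha> x)"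
    and \<phi>_\<L>: "\<And>x. x \<in> mspace X \<Longrightarrow> insert x (pt ` {\<alpha>. 0 < \<phi> \<alpha> x}) \<in> \<L>"
    and \<phi>_pt: "\<And>\<alpha> x. x \<in> mspace X \<Longrightarrow> 0 < \<phi> \<alpha> x \<Longrightarrow> pt \<alpha> \<in> mspace X"
    by (rule slow_partition_exists[OF X asdim q \<L>]) (rule that; assumption)
  have b0: "bumps X N \<phi>" unfolding bumps_def using \<phi> by simp
  define \<psi> where "\<psi> = bary \<phi>"
  define \<theta> where "\<theta> = bary \<psi>"
  have b1: "bumps X N \<psi>" unfolding \<psi>_def by (rule bumps_bary[OF b0])
  have b2: "bumps X N \<theta>" unfolding \<theta>_def by (rule bumps_bary[OF b1])
  \<comment> \<open>A vertex \<open>\<sigma>\<close> of the first subdivision is represented by the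
    point of an arbitrary bump belonging to it.\<close>
  define y where "y \<sigma> = pt (SOME \<alpha>. \<alpha> \<in> \<sigma>)" for \<sigma>
  have y: "y \<sigma> \<in> pt ` {\<alpha>. 0 < \<phi> \<alpha> x}" if "x \<in> mspace X" "0 < \<psi> \<sigma> x" for \<sigma> x
  proof -
    have "\<sigma> \<noteq> {}" "\<sigma> \<subseteq> {\<alpha>. 0 < \<phi> \<alpha> x}"
      using bary_pos(2)[OF b0 that(1)] bary_card_le(2)[OF b0 that(1)] that(2) by (auto simp: \<psi>_def)
    then show ?thesis unfolding y_def using someI_ex[of "\<lambda>\<alpha>. \<alpha> \<in> \<sigma>"] by blast
  qed
  define el where "el s k = (THE \<sigma>. \<sigma> \<in> s \<and> card \<sigma> = k)" for s :: "(nat \<times> 'a set) set set" and k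
  define Ks where "Ks = {ks. set ks \<subseteq> {1..N} \<and> length ks = n}"
  define tab where "tab s = (\<lambda>ks\<in>Ks. b (map (\<lambda>k. y (el s k)) ks) mod m)" for s
  \<comment> \<open>A vertex \<open>s\<close> of the second subdivision is sent to its least element
    \<open>\<Inter>s\<close>, a vertex of the first. The type keeps the rank of \<open>s\<close> in
    a chain, the label under which larger simplices list \<open>\<Inter>s\<close>, the table of
    \<open>s\<close>, and the cover member that \<open>u\<close> assigns to the
    representative.\<close>
  define ty where "ty s = (card s, card (\<Inter>s), tab s, u (y (\<Inter>s)))" for s
  define S where "S x = {s. 0 < \<theta> s x}" for x
  have S: "finite s" "s \<noteq> {}" "card s \<in> {1..N}" "\<Inter>s \<in> s" "\<And>\<sigma>. \<sigma> \<in> s \<Longrightarrow> 0 < \<psi> \<sigma> x"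
    "\<And>\<sigma>. \<sigma> \<in> s \<Longrightarrow> card \<sigma> \<in> {1..N}" "\<And>\<sigma>. \<sigma> \<in> s \<Longrightarrow> el s (card \<sigma>) = \<sigma>"
    if x: "x \<in> mspace X" and s: "s \<in> S x" for s x
  proof -
    have \<theta>s: "0 < bary \<psi> s x" using s by (simp add: S_def \<theta>_def)
    show f: "finite s" "s \<noteq> {}" using bary_pos(1,2)[OF b1 x \<theta>s] .
    show "card s \<in> {1..N}" by (rule bary_card_le(1)[OF b1 x \<theta>s])
    show \<psi>s: "0 < \<psi> \<sigma> x" if "\<sigma> \<in> s" for \<sigma> using bary_pos(3)[OF b1 x \<theta>s that] .
    show "\<Inter>s \<in> s"
      using f by (rule finite_chain_least) (use \<psi>s bary_chain[OF b0 x] in \<open>simp add: \<psi>_def\<close>)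
    show "card \<sigma> \<in> {1..N}" if "\<sigma> \<in> s" for \<sigma>
      using bary_card_le(1)[OF b0 x] \<psi>s[OF that] unfolding \<psi>_def .
    show "el s (card \<sigma>) = \<sigma>" if "\<sigma> \<in> s" for \<sigma>
      unfolding el_def
    proof (rule the_equality)
      fix \<tau> assume "\<tau> \<in> s \<and> card \<tau> = card \<sigma>"
      then show "\<tau> = \<sigma>" using bary_card_inj[OF b0 x] \<psi>s that unfolding \<psi>_def by blast
    qed (use that in simp)
  qed
  have S_chain: "s \<subseteq> s' \<or> s' \<subseteq> s" if "x \<in> mspace X" "s \<in> S x" "s' \<in> S x" for s s' x
    using bary_chain[OF b1 that(1)] that(2,3) by (simp add: S_def \<theta>_def)
  have S_inj: "s = s'" if "x \<in> mspace X" "s \<in> S x" "s' \<in> S x" "card s = card s'" for s s' x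
    using bary_card_inj[OF b1 that(1) _ _ that(4)] that(2,3) by (simp add: S_def \<theta>_def)
  define T where "T = ty ` (\<Union>x\<in>mspace X. S x)"
  have "finite Ks" unfolding Ks_def by (rule finite_lists_length_eq) simp
  have yX: "y (\<Inter>s) \<in> mspace X" if "x \<in> mspace X" "s \<in> S x" for s x
    using y[OF that(1) S(5)[OF that S(4)[OF that]]] \<phi>_pt[OF that(1)] by auto
  have "T \<subseteq> {1..N} \<times> {1..N} \<times> (Ks \<rightarrow>\<^sub>E {0..<m}) \<times> u ` mspace X"
  proof
    fix t assume "t \<in> T"
    then obtain x s where x: "x \<in> mspace X" "s \<in> S x" "t = ty s" by (auto simp: T_def)
    have "tab s \<in> Ks \<rightarrow>\<^sub>E {0..<m}" using m by (auto simp: tab_def)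
    moreover have "card (\<Inter>s) \<in> {1..N}" by (rule S(6)[OF x(1,2) S(4)[OF x(1,2)]])
    ultimately show "t \<in> {1..N} \<times> {1..N} \<times> (Ks \<rightarrow>\<^sub>E {0..<m}) \<times> u ` mspace X"
      unfolding x(3) ty_def using S(3)[OF x(1,2)] yX[OF x(1,2)] by blast
  qed
  moreover have "finite ({1..N} \<times> {1..N} \<times> (Ks \<rightarrow>\<^sub>E {0..<m}) \<times> u ` mspace X)"
    using u \<open>finite Ks\<close> by (intro finite_cartesian_product finite_PiE) auto
  ultimately have finT: "finite T" by (rule finite_subset)
  \<comment> \<open>All simplices of one type are merged into a single bump; the supremum is still
    1-Lipschitz, however far apart they lie.\<close>
  define \<Psi> where "\<Psi> t x = Sup (insert 0 ((\<lambda>s. \<theta> s x) ` {s. ty s = t}))" for t x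
  have \<Psi>_lip: "one_lipschitz X (\<Psi> t)" for t
    unfolding \<Psi>_def by (rule one_lipschitz_sup_bumps[OF b2])
  have \<Psi>_nn: "0 \<le> \<Psi> t x" if "x \<in> mspace X" for t x
    unfolding \<Psi>_def by (rule sup_bumps_ge(2)[OF b2 that])
  have \<Psi>_ge: "\<theta> s x \<le> \<Psi> (ty s) x" if "x \<in> mspace X" for s x
    unfolding \<Psi>_def by (rule sup_bumps_ge(1)[OF b2 that]) simp
  have \<Psi>_pos: "\<exists>s\<in>S x. ty s = t" if "0 < \<Psi> t x" for t x
  proof (rule ccontr)
    assume "\<not> ?thesis"
    then have "\<Psi> t x \<le> 0" unfolding \<Psi>_def S_def by (intro sup_bumps_le) (auto simp: not_less)
    with that show False by simp
  qed
  \<comment> \<open>Each of the two subdivisions costs a factor \<open>2 * real N\<close>.\<close>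
  have big: "\<exists>t\<in>T. r / (4 * real N ^ 2) \<le> \<Psi> t x" if x: "x \<in> mspace X" and r: "0 < r" "r \<le> \<phi> \<alpha> x" for x \<alpha> r
  proof -
    have N: "0 < N" by (rule bary_large(1)[OF b0 x r])
    obtain \<sigma> where \<sigma>: "r / (2 * real N) \<le> \<psi> \<sigma> x" using bary_large(2)[OF b0 x r] unfolding \<psi>_def by blast
    have r': "0 < r / (2 * real N)" using r(1) N by simp
    obtain s where s: "r / (2 * real N) / (2 * real N) \<le> \<theta> s x"
      using bary_large(2)[OF b1 x r' \<sigma>] unfolding \<theta>_def by blast
    have "0 < r / (2 * real N) / (2 * real N)" by (rule divide_pos_pos[OF r']) (use N in simp)
    then have "s \<in> S x" using s by (simp add: S_def)
    then have "ty s \<in> T" using x by (auto simp: T_def)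
    moreover have "r / (4 * real N ^ 2) \<le> \<Psi> (ty s) x"
      using s \<Psi>_ge[OF x, of s] by (simp add: power2_eq_square)
    ultimately show ?thesis by blast
  qed
  have \<Psi>_ex: "\<exists>t\<in>T. 0 < \<Psi> t x" if x: "x \<in> mspace X" for x
  proof -
    obtain \<alpha> where \<alpha>: "0 < \<phi> \<alpha> x" using \<phi>_pos[OF x] by blast
    then obtain t where t: "t \<in> T" "\<phi> \<alpha> x / (4 * real N ^ 2) \<le> \<Psi> t x" using big[OF x \<alpha> order_refl] by blast
    have "0 < \<phi> \<alpha> x / (4 * real N ^ 2)" using \<alpha> bary_large(1)[OF b0 x \<alpha> order_refl] by simp
    with t show ?thesis by force
  qed
  have \<Psi>_large: "\<exists>R. \<forall>x\<in>mspace X. R < mdist X q x \<longrightarrow> (\<exists>t\<in>T. r \<le> \<Psi> t x)" for r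
  proof -
    define r' where "r' = max 1 (r * (4 * real N ^ 2))"
    obtain R where R: "\<forall>x\<in>mspace X. R < mdist X q x \<longrightarrow> (\<exists>\<alpha>. r' \<le> \<phi> \<alpha> x)" using \<phi>_large by blast
    show ?thesis
    proof (rule exI[of _ R], intro ballI impI)
      fix x assume x: "x \<in> mspace X" "R < mdist X q x"
      then obtain \<alpha> where \<alpha>: "r' \<le> \<phi> \<alpha> x" using R by blast
      have r': "0 < r'" by (simp add: r'_def)
      obtain t where t: "t \<in> T" "r' / (4 * real N ^ 2) \<le> \<Psi> t x" using big[OF x(1) r' \<alpha>] by blast
      have "0 < N" by (rule bary_large(1)[OF b0 x(1) r' \<alpha>])
      then have "r \<le> r' / (4 * real N ^ 2)" by (simp add: r'_def le_divide_eq)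
      with t show "\<exists>t\<in>T. r \<le> \<Psi> t x" by force
    qed
  qed
  define w :: "nat \<times> nat \<times> (nat list \<Rightarrow> int) \<times> 'u \<Rightarrow> 'u" where "w t = snd (snd (snd t))" for t
  \<comment> \<open>The table consulted belongs to a type with maximal first entry: among nested
    simplices the largest one contains the least elements of all the others. So
    \<open>\<beta>\<close> depends on the types alone.\<close>
  define \<beta> :: "(nat \<times> nat \<times> (nat list \<Rightarrow> int) \<times> 'u) list \<Rightarrow> int" where
    "\<beta> ts = fst (snd (snd (SOME t. t \<in> set ts \<and> (\<forall>t'\<in>set ts. fst t' \<le> fst t)))) (map (\<lambda>t. fst (snd t)) ts)" for ts
  have local: "\<exists>v. (\<forall>t\<in>T. 0 < \<Psi> t x \<longrightarrow> v t \<in> mspace X \<and> u (v t) = w t) \<and>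
        insert x (v ` {t\<in>T. 0 < \<Psi> t x}) \<in> \<L> \<and>
        (\<forall>ts. length ts = n \<longrightarrow> set ts \<subseteq> {t\<in>T. 0 < \<Psi> t x} \<longrightarrow> m dvd \<beta> ts - b (map v ts))"
    if x: "x \<in> mspace X" for x
  proof -
    \<comment> \<open>Different points may realise a type by different simplices, so
      \<open>v\<close> has to depend on \<open>x\<close>, whereas \<open>w\<close> and
      \<open>\<beta>\<close> are global.\<close>
    define st where "st t = (SOME s. s \<in> S x \<and> ty s = t)" for t
    have st: "st t \<in> S x" "ty (st t) = t" if "0 < \<Psi> t x" for t
      using someI_ex[of "\<lambda>s. s \<in> S x \<and> ty s = t"] \<Psi>_pos[OF that] unfolding st_def by blast+
    define v where "v t = y (\<Inter>(st t))" for t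
    have 1: "v t \<in> mspace X \<and> u (v t) = w t" if "0 < \<Psi> t x" for t
    proof
      show "v t \<in> mspace X" unfolding v_def by (rule yX[OF x st(1)[OF that]])
      have "u (v t) = w (ty (st t))" by (simp add: v_def w_def ty_def)
      then show "u (v t) = w t" by (simp only: st(2)[OF that])
    qed
    have "insert x (v ` {t\<in>T. 0 < \<Psi> t x}) \<subseteq> insert x (pt ` {\<alpha>. 0 < \<phi> \<alpha> x})"
    proof -
      have "v t \<in> pt ` {\<alpha>. 0 < \<phi> \<alpha> x}" if "0 < \<Psi> t x" for t
        unfolding v_def using y[OF x S(5)[OF x st(1)[OF that] S(4)[OF x st(1)[OF that]]]] .
      then show ?thesis by blast
    qed
    with \<phi>_\<L>[OF x] have 2: "insert x (v ` {t\<in>T. 0 < \<Psi> t x}) \<in> \<L>" by (rule slow_family_subset[OF \<L>])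
    have "m dvd \<beta> ts - b (map v ts)" if ts: "length ts = n" "set ts \<subseteq> {t\<in>T. 0 < \<Psi> t x}" for ts
    proof -
      define t0 where "t0 = (SOME t. t \<in> set ts \<and> (\<forall>t'\<in>set ts. fst t' \<le> fst t))"
      have "\<exists>t. t \<in> set ts \<and> (\<forall>t'\<in>set ts. fst t' \<le> fst t)"
      proof -
        have "fst ` set ts \<noteq> {}" using ts(1) n by auto
        then have "Max (fst ` set ts) \<in> fst ` set ts" by (intro Max_in) auto
        then obtain t where t: "t \<in> set ts" "fst t = Max (fst ` set ts)" by force
        have "fst t' \<le> fst t" if "t' \<in> set ts" for t' unfolding t(2) by (rule Max_ge) (use that in auto)
        with t(1) show ?thesis by blast
      qed
      from someI_ex[OF this] have t0: "t0 \<in> set ts" "\<And>t'. t' \<in> set ts \<Longrightarrow> fst t' \<le> fst t0"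
        unfolding t0_def by blast+
      have pos: "0 < \<Psi> t x" if "t \<in> set ts" for t using ts(2) that by blast
      let ?s0 = "st t0"
      have s0: "?s0 \<in> S x" "ty ?s0 = t0" using st[OF pos[OF t0(1)]] .
      have col: "\<Inter>(st t) \<in> ?s0 \<and> card (\<Inter>(st t)) = fst (snd t)" if t: "t \<in> set ts" for t
      proof -
        have s: "st t \<in> S x" "ty (st t) = t" using st[OF pos[OF t]] .
        have "fst (ty s) = card s" "fst (snd (ty s)) = card (\<Inter>s)" for s by (simp_all add: ty_def)
        from this[of "st t"] this(1)[of ?s0]
        have c: "card (st t) = fst t" "card ?s0 = fst t0" "card (\<Inter>(st t)) = fst (snd t)"
          by (simp_all only: s(2) s0(2))
        have "st t \<subseteq> ?s0"
        proof (rule ccontr)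
          assume n: "\<not> st t \<subseteq> ?s0"
          then have sub: "?s0 \<subseteq> st t" using S_chain[OF x s(1) s0(1)] by blast
          then have "card ?s0 = card (st t)"
            using card_mono[OF S(1)[OF x s(1)] sub] t0(2)[OF t] c by linarith
          then show False using S_inj[OF x s0(1) s(1)] n by blast
        qed
        with S(4)[OF x s(1)] c(3) show ?thesis by blast
      qed
      have vts: "map v ts = map (\<lambda>k. y (el ?s0 k)) (map (\<lambda>t. fst (snd t)) ts)"
        unfolding map_map comp_def
      proof (rule map_cong[OF refl])
        fix t assume t: "t \<in> set ts"
        have "el ?s0 (fst (snd t)) = \<Inter>(st t)"
          using S(7)[OF x s0(1), of "\<Inter>(st t)"] col[OF t] by simp
        then show "v t = y (el ?s0 (fst (snd t)))" by (simp add: v_def)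
      qed
      have ks: "map (\<lambda>t. fst (snd t)) ts \<in> Ks"
      proof -
        have "fst (snd t) \<in> {1..N}" if "t \<in> set ts" for t
          using S(6)[OF x s0(1), of "\<Inter>(st t)"] col[OF that] by simp
        then show ?thesis using ts(1) by (auto simp: Ks_def)
      qed
      have "\<beta> ts = tab ?s0 (map (\<lambda>t. fst (snd t)) ts)"
      proof -
        have "fst (snd (snd (ty ?s0))) = tab ?s0" by (simp add: ty_def)
        then show ?thesis unfolding \<beta>_def t0_def[symmetric] by (simp only: s0(2))
      qed
      then have "\<beta> ts = b (map v ts) mod m" unfolding vts tab_def restrict_apply if_P[OF ks] .
      then show ?thesis by (simp add: mod_eq_dvd_iff[symmetric])
    qed
    with 1 2 show ?thesis by (intro exI[of _ v]) blast
  qed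
  show thesis
    by (rule that[of T \<Psi> w \<beta>]) (fact finT \<Psi>_lip \<Psi>_nn \<Psi>_ex \<Psi>_large local)+
qed

section \<open>Open covers of the Higson compactification\<close>

lemma higson_embedding_apply:
  "f \<in> higson_functions X \<Longrightarrow> higson_embedding X x f = f x"
  by (simp add: higson_embedding_def)

lemma higson_embedding_in_topspace:
  "x \<in> mspace X \<Longrightarrow> higson_embedding X x \<in> topspace (higson_compactification X)"
proof -
  assume x: "x \<in> mspace X"
  let ?P = "product_topology (\<lambda>_. euclideanreal) (higson_functions X)"
  have "higson_embedding X ` mspace X \<subseteq> topspace ?P" by (auto simp: higson_embedding_def)
  then have "higson_embedding X ` mspace X \<subseteq> ?P closure_of (higson_embedding X ` mspace X)"
    by (rule closure_of_subset)
  with x show ?thesis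
    by (auto simp: higson_compactification_def Let_def higson_embedding_def)
qed

text \<open>The way in which facts about \<open>X\<close> reach the corona: an open condition
  satisfied anywhere is satisfied at a point of \<open>X\<close>.\<close>

lemma higson_dense:
  assumes "openin (higson_compactification X) W" "W \<noteq> {}"
  obtains x where "x \<in> mspace X" "higson_embedding X x \<in> W"
proof -
  obtain \<xi> where \<xi>: "\<xi> \<in> W" using assms(2) by blast
  then have "\<xi> \<in> higson_compactification X closure_of (higson_embedding X ` mspace X)"
    using openin_subset[OF assms(1)] topspace_higson_dense by blast
  with \<xi> assms(1) show thesis using that unfolding in_closure_of by blast
qed

lemma continuous_map_higson_eval:
  assumes "f \<in> higson_functions X"
  shows "continuous_map (higson_compactification X) euclideanreal (\<lambda>\<xi>. \<xi> f)"
  unfolding higson_compactification_def Let_def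
  by (rule continuous_map_from_subtopology) (rule continuous_map_product_projection[OF assms])

lemma openin_higson_box:
  assumes "finite F" "F \<subseteq> higson_functions X"
  shows "openin (higson_compactification X)
    {\<zeta> \<in> topspace (higson_compactification X). \<forall>f\<in>F. \<bar>\<zeta> f - \<xi> f\<bar> < e}"
  using assms
proof (induction F rule: finite_induct)
  case (insert f F)
  let ?T = "higson_compactification X"
  have "openin ?T {\<zeta> \<in> topspace ?T. \<zeta> f \<in> {\<xi> f - e<..<\<xi> f + e}}"
    by (rule openin_continuous_map_preimage[OF continuous_map_higson_eval]) (use insert.prems in auto)
  moreover have "openin ?T {\<zeta> \<in> topspace ?T. \<forall>f\<in>F. \<bar>\<zeta> f - \<xi> f\<bar> < e}" using insert by simp
  ultimately have "openin ?T ({\<zeta> \<in> topspace ?T. \<zeta> f \<in> {\<xi> f - e<..<\<xi> f + e}} \<inter>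
      {\<zeta> \<in> topspace ?T. \<forall>f\<in>F. \<bar>\<zeta> f - \<xi> f\<bar> < e})" by (rule openin_Int)
  moreover have "{\<zeta> \<in> topspace ?T. \<zeta> f \<in> {\<xi> f - e<..<\<xi> f + e}} \<inter>
      {\<zeta> \<in> topspace ?T. \<forall>f\<in>F. \<bar>\<zeta> f - \<xi> f\<bar> < e} = {\<zeta> \<in> topspace ?T. \<forall>f\<in>insert f F. \<bar>\<zeta> f - \<xi> f\<bar> < e}"
    by (auto simp: abs_less_iff)
  ultimately show ?case by simp
qed simp

text \<open>A neighbourhood in the product topology contains one that restricts finitely many
  functions only. The factor 2 leaves room for the halving in a Lebesgue number argument.\<close>

lemma higson_local_box:
  assumes "openin (higson_compactification X) U" "\<xi> \<in> U"
  shows "\<exists>F e. finite F \<and> F \<subseteq> higson_functions X \<and> 0 < e \<and>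
    (\<forall>\<zeta>\<in>topspace (higson_compactification X). (\<forall>f\<in>F. \<bar>\<zeta> f - \<xi> f\<bar> < 2 * e) \<longrightarrow> \<zeta> \<in> U)"
proof -
  let ?H = "higson_functions X" and ?T = "higson_compactification X"
  let ?P = "product_topology (\<lambda>_. euclideanreal) ?H"
  obtain W where W: "openin ?P W" "W \<inter> topspace ?T \<subseteq> U" "U \<subseteq> W"
  proof -
    obtain W where "openin ?P W" "U = W \<inter> ?P closure_of (higson_embedding X ` mspace X)"
      using assms(1) unfolding higson_compactification_def Let_def openin_subtopology by blast
    moreover have "topspace ?T \<subseteq> ?P closure_of (higson_embedding X ` mspace X)"
      unfolding higson_compactification_def Let_def topspace_subtopology by blast
    ultimately show thesis by (intro that[of W]) blast+
  qed
  then obtain B where B: "finite {f \<in> ?H. B f \<noteq> UNIV}" "\<forall>f\<in>?H. open (B f)" "\<xi> \<in> Pi\<^sub>E ?H B" "Pi\<^sub>E ?H B \<subseteq> W"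
  proof -
    have "\<xi> \<in> W" using assms(2) W(3) by blast
    with W(1) have "\<exists>B. finite {f \<in> ?H. B f \<noteq> topspace euclideanreal} \<and> (\<forall>f\<in>?H. openin euclideanreal (B f)) \<and>
        \<xi> \<in> Pi\<^sub>E ?H B \<and> Pi\<^sub>E ?H B \<subseteq> W"
      unfolding openin_product_topology_alt by (rule bspec)
    then show thesis unfolding topspace_euclidean open_openin[symmetric] by (elim exE conjE) (rule that)
  qed
  let ?F = "{f \<in> ?H. B f \<noteq> UNIV}"
  have "\<forall>f\<in>?F. \<exists>d>0. \<forall>t. \<bar>t - \<xi> f\<bar> < d \<longrightarrow> t \<in> B f"
  proof
    fix f assume "f \<in> ?F"
    then have "open (B f)" "\<xi> f \<in> B f" using B by auto
    then show "\<exists>d>0. \<forall>t. \<bar>t - \<xi> f\<bar> < d \<longrightarrow> t \<in> B f"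
      unfolding open_dist dist_real_def by blast
  qed
  then obtain d where d: "\<forall>f\<in>?F. 0 < d f \<and> (\<forall>t. \<bar>t - \<xi> f\<bar> < d f \<longrightarrow> t \<in> B f)"
    by (rule bchoice[THEN exE])
  define e where "e = Min (insert 1 (d ` ?F)) / 2"
  have "0 < Min (insert 1 (d ` ?F))" using B(1) d by (subst Min_gr_iff) auto
  then have e: "0 < e" by (simp add: e_def)
  have ed: "2 * e \<le> d f" if "f \<in> ?F" for f
    using B(1) that unfolding e_def by (auto intro!: Min_le)
  have "\<zeta> \<in> U" if \<zeta>: "\<zeta> \<in> topspace ?T" "\<forall>f\<in>?F. \<bar>\<zeta> f - \<xi> f\<bar> < 2 * e" for \<zeta>
  proof -
    have "\<zeta> \<in> Pi\<^sub>E ?H B"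
    proof (rule PiE_I)
      fix f assume f: "f \<in> ?H"
      show "\<zeta> f \<in> B f"
      proof (cases "f \<in> ?F")
        case True
        then have "\<bar>\<zeta> f - \<xi> f\<bar> < d f" using \<zeta>(2) ed[OF True] by fastforce
        with d True show ?thesis by blast
      qed (use f in auto)
    next
      fix f assume "f \<notin> ?H"
      moreover have "\<zeta> \<in> topspace ?P"
        using \<zeta>(1) unfolding higson_compactification_def Let_def topspace_subtopology by blast
      ultimately show "\<zeta> f = undefined" by (auto simp: PiE_def extensional_def)
    qed
    with B(4) W(2) \<zeta>(1) show ?thesis by blast
  qed
  note inU = this
  show ?thesis
  proof (intro exI[of _ ?F] exI[of _ e] conjI ballI impI)
    show "?F \<subseteq> ?H" by (rule Collect_restrict)
  qed (fact B(1), fact e, erule (1) inU)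
qed

text \<open>The Lebesgue number lemma for the compactification, closeness being measured by finitely
  many Higson functions \<open>F\<close> with tolerance \<open>\<epsilon>\<close>. Boxes of half the
  size have a finite subcover, which also yields the finite \<open>\<U>0\<close>.\<close>

lemma higson_lebesgue:
  assumes "\<U> \<in> open_covers (higson_compactification X)"
  obtains F \<epsilon> \<U>0 where "finite F" "F \<subseteq> higson_functions X" "0 < \<epsilon>" "finite \<U>0" "\<U>0 \<subseteq> \<U>"
    "\<And>\<xi>. \<xi> \<in> topspace (higson_compactification X) \<Longrightarrow>
      \<exists>U\<in>\<U>0. \<forall>\<zeta>\<in>topspace (higson_compactification X). (\<forall>f\<in>F. \<bar>\<zeta> f - \<xi> f\<bar> < \<epsilon>) \<longrightarrow> \<zeta> \<in> U"
proof -
  let ?H = "higson_functions X" and ?T = "higson_compactification X"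
  have "\<exists>U F e. U \<in> \<U> \<and> finite F \<and> F \<subseteq> ?H \<and> 0 < e \<and>
    (\<forall>\<zeta>\<in>topspace ?T. (\<forall>f\<in>F. \<bar>\<zeta> f - \<xi> f\<bar> < 2 * e) \<longrightarrow> \<zeta> \<in> U)" if "\<xi> \<in> topspace ?T" for \<xi>
  proof -
    have "\<Union>\<U> = topspace ?T" "\<forall>U\<in>\<U>. openin ?T U" using assms unfolding open_covers_def by simp_all
    with that obtain U where U: "U \<in> \<U>" "\<xi> \<in> U" "openin ?T U" by blast
    from higson_local_box[OF U(3,2)] obtain F e where "finite F \<and> F \<subseteq> ?H \<and> 0 < e \<and>
      (\<forall>\<zeta>\<in>topspace ?T. (\<forall>f\<in>F. \<bar>\<zeta> f - \<xi> f\<bar> < 2 * e) \<longrightarrow> \<zeta> \<in> U)" by (elim exE)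
    with U(1) show ?thesis by (intro exI[of _ U] exI[of _ F] exI[of _ e] conjI[OF U(1)])
  qed
  then obtain Uf Ff ef where *: "\<And>\<xi>. \<xi> \<in> topspace ?T \<Longrightarrow> Uf \<xi> \<in> \<U> \<and> finite (Ff \<xi>) \<and> Ff \<xi> \<subseteq> ?H \<and> 0 < ef \<xi> \<and>
    (\<forall>\<zeta>\<in>topspace ?T. (\<forall>f\<in>Ff \<xi>. \<bar>\<zeta> f - \<xi> f\<bar> < 2 * ef \<xi>) \<longrightarrow> \<zeta> \<in> Uf \<xi>)"
    by metis
  define B where "B \<xi> = {\<zeta> \<in> topspace ?T. \<forall>f\<in>Ff \<xi>. \<bar>\<zeta> f - \<xi> f\<bar> < ef \<xi>}" for \<xi>
  have "\<forall>W\<in>B ` topspace ?T. openin ?T W"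
    using * unfolding B_def by (auto intro!: openin_higson_box)
  moreover have "topspace ?T \<subseteq> \<Union>(B ` topspace ?T)" using * by (force simp: B_def)
  ultimately obtain \<F> where \<F>: "finite \<F>" "\<F> \<subseteq> B ` topspace ?T" "topspace ?T \<subseteq> \<Union>\<F>"
    using compact_space_higson_compactification[of X] unfolding compact_space_alt by meson
  then obtain D where D: "finite D" "D \<subseteq> topspace ?T" "\<F> = B ` D" by (meson finite_subset_image)
  define \<epsilon> where "\<epsilon> = Min (insert 1 (ef ` D))"
  have "0 < \<epsilon>" unfolding \<epsilon>_def using D * by (subst Min_gr_iff) auto
  have \<epsilon>: "\<epsilon> \<le> ef \<xi>" if "\<xi> \<in> D" for \<xi> unfolding \<epsilon>_def using D(1) that by (intro Min_le) auto
  show thesis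
  proof (rule that[of "\<Union>(Ff ` D)" \<epsilon> "Uf ` D"])
    fix \<xi> assume \<xi>: "\<xi> \<in> topspace ?T"
    then obtain \<eta> where \<eta>: "\<eta> \<in> D" "\<xi> \<in> B \<eta>" using \<F>(3) D(3) by blast
    have "\<zeta> \<in> Uf \<eta>" if \<zeta>: "\<zeta> \<in> topspace ?T" "\<forall>f\<in>\<Union>(Ff ` D). \<bar>\<zeta> f - \<xi> f\<bar> < \<epsilon>" for \<zeta>
    proof -
      have "\<bar>\<zeta> f - \<eta> f\<bar> < 2 * ef \<eta>" if f: "f \<in> Ff \<eta>" for f
      proof -
        have "\<bar>\<zeta> f - \<xi> f\<bar> < \<epsilon>" using \<zeta>(2) f \<eta>(1) by blast
        moreover have "\<bar>\<xi> f - \<eta> f\<bar> < ef \<eta>" using \<eta>(2) f by (simp add: B_def)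
        ultimately show ?thesis using \<epsilon>[OF \<eta>(1)] by linarith
      qed
      with * \<eta>(1) D(2) \<zeta>(1) show ?thesis by blast
    qed
    with \<eta>(1) show "\<exists>U\<in>Uf ` D. \<forall>\<zeta>\<in>topspace ?T. (\<forall>f\<in>\<Union>(Ff ` D). \<bar>\<zeta> f - \<xi> f\<bar> < \<epsilon>) \<longrightarrow> \<zeta> \<in> U" by blast
  next
    show "finite (\<Union>(Ff ` D))" "\<Union>(Ff ` D) \<subseteq> ?H" "Uf ` D \<subseteq> \<U>" "finite (Uf ` D)"
      using D * by auto
  qed fact
qed

section \<open>Slow families defined by Higson functions\<close>

lemma slow_family_Pow: "slow_family X q (Pow (mspace X))"
proof (rule slow_familyI)
  show "\<exists>\<eta>>0. \<forall>A. finite A \<longrightarrow> A \<subseteq> mcball_of X q R \<longrightarrow>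
        (\<forall>a\<in>A. \<forall>b\<in>A. mdist X a b \<le> \<eta>) \<longrightarrow> A \<in> Pow (mspace X)" for R
    by (rule exI[of _ 1]) auto
  show "\<exists>R'. \<forall>x\<in>mspace X. R' < mdist X q x \<longrightarrow>
        (\<forall>A. finite A \<longrightarrow> A \<subseteq> mcball_of X x R \<longrightarrow> A \<in> Pow (mspace X))" for R
    by (rule exI[of _ 0]) auto
qed auto

text \<open>On balls, compact by properness, \<open>f\<close> is uniformly continuous. At infinity
  its oscillation vanishes off a compact set; this set is bounded, so a large distance from
  \<open>q\<close> suffices to be outside of it.\<close>

lemma slow_family_higson_function:
  fixes X :: "'a metric"
  assumes X: "proper_metric X" and q: "q \<in> mspace X" and f: "f \<in> higson_functions X" and e: "0 < e"
  shows "slow_family X q {A. \<forall>a\<in>A. \<forall>b\<in>A. \<bar>f a - f b\<bar> < e}"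
proof (rule slow_familyI)
  interpret M: Metric_space "mspace X" "mdist X" by simp
  have cont: "continuous_map (mtopology_of X) euclideanreal f" and bdd: "bounded (f ` mspace X)"
    and osc: "\<And>R \<epsilon>. 0 < R \<Longrightarrow> 0 < \<epsilon> \<Longrightarrow> \<exists>K. compactin (mtopology_of X) K \<and>
           (\<forall>x\<in>mspace X - K. diameter (f ` mcball_of X x R) < \<epsilon>)"
    using f unfolding higson_functions_def by blast+
  fix R :: real
  show "\<exists>\<eta>>0. \<forall>A. finite A \<longrightarrow> A \<subseteq> mcball_of X q R \<longrightarrow>
        (\<forall>a\<in>A. \<forall>b\<in>A. mdist X a b \<le> \<eta>) \<longrightarrow> A \<in> {A. \<forall>a\<in>A. \<forall>b\<in>A. \<bar>f a - f b\<bar> < e}"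
  proof -
    let ?B = "submetric X (mcball_of X q R)"
    have "compact_space (mtopology_of ?B)"
      using X q by (simp add: mtopology_of_submetric compact_space_subtopology proper_metric_def)
    moreover have "continuous_map (mtopology_of ?B) (mtopology_of euclidean_metric) f"
      unfolding mtopology_of_submetric mtopology_of_euclidean by (rule continuous_map_from_subtopology[OF cont])
    ultimately have "uniformly_continuous_map ?B euclidean_metric f"
      by (intro continuous_imp_uniformly_continuous_map conjI)
    then have "\<exists>\<delta>>0. \<forall>x\<in>mspace ?B. \<forall>y\<in>mspace ?B. mdist X y x < \<delta> \<longrightarrow> dist (f y) (f x) < e"
      using e unfolding uniformly_continuous_map_def by simp
    then obtain \<delta> where \<delta>: "\<delta> > 0" "\<forall>x\<in>mspace ?B. \<forall>y\<in>mspace ?B. mdist X y x < \<delta> \<longrightarrow> dist (f y) (f x) < e"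
      by blast
    show ?thesis
    proof (intro exI[of _ "\<delta> / 2"] conjI allI impI)
      fix A assume A: "A \<subseteq> mcball_of X q R" "\<forall>a\<in>A. \<forall>b\<in>A. mdist X a b \<le> \<delta> / 2"
      have "\<bar>f a - f b\<bar> < e" if "a \<in> A" "b \<in> A" for a b
      proof -
        have "a \<in> mspace ?B" "b \<in> mspace ?B" using A(1) that by auto
        moreover have "mdist X a b < \<delta>" using A(2) that \<delta>(1) by fastforce
        ultimately show ?thesis using \<delta>(2) by (simp add: dist_real_def)
      qed
      then show "A \<in> {A. \<forall>a\<in>A. \<forall>b\<in>A. \<bar>f a - f b\<bar> < e}" by blast
    qed (use \<delta> in simp)
  qed
  show "\<exists>R'. \<forall>x\<in>mspace X. R' < mdist X q x \<longrightarrow>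
        (\<forall>A. finite A \<longrightarrow> A \<subseteq> mcball_of X x R \<longrightarrow> A \<in> {A. \<forall>a\<in>A. \<forall>b\<in>A. \<bar>f a - f b\<bar> < e})"
  proof -
    \<comment> \<open>Higson functions are controlled on balls of positive radius, whereas
      \<open>R\<close> is arbitrary.\<close>
    obtain K where K: "compactin (mtopology_of X) K"
      "\<forall>x\<in>mspace X - K. diameter (f ` mcball_of X x (max R 1)) < e"
    proof -
      have "0 < max R 1" by (simp add: less_max_iff_disj)
      from osc[OF this e] show thesis by (elim exE conjE) (rule that)
    qed
    have "M.mbounded K" using K(1) M.compactin_imp_mbounded by (simp add: mtopology_of_def)
    then obtain z r where zr: "K \<subseteq> M.mcball z r" unfolding M.mbounded_def by blast
    show ?thesis
    proof (rule exI[of _ "mdist X q z + r"], intro ballI impI allI)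
      fix x A assume x: "x \<in> mspace X" "mdist X q z + r < mdist X q x" and A: "A \<subseteq> mcball_of X x R"
      have "x \<notin> K"
      proof
        assume "x \<in> K"
        then have "z \<in> mspace X" "mdist X z x \<le> r" using zr by auto
        with x M.triangle[of q z x] q show False by auto
      qed
      then have diam: "diameter (f ` mcball_of X x (max R 1)) < e" using K(2) x(1) by blast
      have "\<bar>f a - f b\<bar> < e" if "a \<in> A" "b \<in> A" for a b
      proof -
        have "mcball_of X x R \<subseteq> mcball_of X x (max R 1)" using x(1) by (intro mcball_of_mono) auto
        then have "a \<in> mcball_of X x (max R 1)" "b \<in> mcball_of X x (max R 1)" using A that by blast+
        moreover have "f ` mcball_of X x (max R 1) \<subseteq> f ` mspace X" by (intro image_mono) auto
        then have "bounded (f ` mcball_of X x (max R 1))" using bdd bounded_subset by blast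
        ultimately have "dist (f a) (f b) \<le> diameter (f ` mcball_of X x (max R 1))"
          by (intro diameter_bounded_bound) blast+
        with diam show ?thesis by (simp add: dist_real_def)
      qed
      then show "A \<in> {A. \<forall>a\<in>A. \<forall>b\<in>A. \<bar>f a - f b\<bar> < e}" by blast
    qed
  qed
qed auto

lemma slow_family_higson_functions:
  assumes "proper_metric X" "q \<in> mspace X" "finite F" "F \<subseteq> higson_functions X" "0 < e"
  shows "slow_family X q {A. A \<subseteq> mspace X \<and> (\<forall>f\<in>F. \<forall>a\<in>A. \<forall>b\<in>A. \<bar>f a - f b\<bar> < e)}"
  using assms(3,4)
proof (induction F rule: finite_induct)
  case empty
  then show ?case using slow_family_Pow[of X q] by (simp add: Pow_def)
next
  case (insert f F)
  have "slow_family X q ({A. \<forall>a\<in>A. \<forall>b\<in>A. \<bar>f a - f b\<bar> < e} \<inter>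
      {A. A \<subseteq> mspace X \<and> (\<forall>f\<in>F. \<forall>a\<in>A. \<forall>b\<in>A. \<bar>f a - f b\<bar> < e)})"
    by (rule slow_family_Int) (use insert slow_family_higson_function[OF assms(1,2) _ assms(5)] in auto)
  moreover have "{A. \<forall>a\<in>A. \<forall>b\<in>A. \<bar>f a - f b\<bar> < e} \<inter>
      {A. A \<subseteq> mspace X \<and> (\<forall>f\<in>F. \<forall>a\<in>A. \<forall>b\<in>A. \<bar>f a - f b\<bar> < e)} =
      {A. A \<subseteq> mspace X \<and> (\<forall>f\<in>insert f F. \<forall>a\<in>A. \<forall>b\<in>A. \<bar>f a - f b\<bar> < e)}" by auto
  ultimately show ?case by simp
qed

section \<open>Slowly oscillating quotients of Lipschitz functions\<close>

lemma one_lipschitz_continuous: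
  assumes "one_lipschitz X f"
  shows "continuous_map (mtopology_of X) euclideanreal f"
proof -
  have "Lipschitz_continuous_map X euclidean_metric f"
    unfolding Lipschitz_continuous_map_def
  proof (intro conjI exI[of _ 1] ballI)
    fix x y assume "x \<in> mspace X" "y \<in> mspace X"
    then show "mdist euclidean_metric (f x) (f y) \<le> 1 * mdist X x y"
      using one_lipschitzD[OF assms, of x y] one_lipschitzD[OF assms, of y x]
      by (auto simp: dist_real_def mdist_commute abs_le_iff)
  qed simp
  then show ?thesis using Lipschitz_continuous_imp_continuous_map by fastforce
qed

text \<open>On a ball of radius \<open>R\<close>, numerator and denominator vary by at most
  \<open>2 * R\<close> each and the quotient is at most 1, so it varies by at most
  \<open>4 * R\<close> over the denominator, which tends to infinity.\<close>

lemma higson_function_quotient: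
  fixes X :: "'a metric"
  assumes X: "proper_metric X" and q: "q \<in> mspace X"
    and \<psi>: "one_lipschitz X \<psi>" and g: "one_lipschitz X g"
    and le: "\<And>x. x \<in> mspace X \<Longrightarrow> 0 \<le> \<psi> x \<and> \<psi> x \<le> g x" and pos: "\<And>x. x \<in> mspace X \<Longrightarrow> 0 < g x"
    and large: "\<And>r. \<exists>R. \<forall>x\<in>mspace X. R < mdist X q x \<longrightarrow> r \<le> g x"
  shows "(\<lambda>x\<in>mspace X. \<psi> x / g x) \<in> higson_functions X" (is "?f \<in> _")
proof -
  have "continuous_map (mtopology_of X) euclideanreal (\<lambda>x. \<psi> x / g x)"
    by (rule continuous_map_real_divide) (use \<psi> g pos in \<open>auto intro!: one_lipschitz_continuous dest: less_imp_neq[OF pos]\<close>)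
  then have c: "continuous_map (mtopology_of X) euclideanreal ?f"
    by (rule continuous_map_eq) simp
  have f01: "0 \<le> ?f x \<and> ?f x \<le> 1" if "x \<in> mspace X" for x
    using le[OF that] pos[OF that] that by simp
  then have b: "bounded (?f ` mspace X)"
    unfolding bounded_iff by (intro exI[of _ 1]) force
  have "\<exists>K. compactin (mtopology_of X) K \<and> (\<forall>x\<in>mspace X - K. diameter (?f ` mcball_of X x R) < \<epsilon>)"
    if R: "0 < R" and \<epsilon>: "0 < \<epsilon>" for R \<epsilon>
  proof -
    \<comment> \<open>Makes the bound \<open>4 * R / G\<close> equal to
      \<open>\<epsilon> / 2\<close>, which leaves a strict inequality for the diameter.\<close>
    define G where "G = 8 * R / \<epsilon>"
    have G: "0 < G" using R \<epsilon> by (simp add: G_def)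
    obtain R0 where R0: "\<forall>x\<in>mspace X. R0 < mdist X q x \<longrightarrow> G \<le> g x" using large by blast
    show ?thesis
    proof (intro exI[of _ "mcball_of X q (R0 + R)"] conjI ballI)
      show "compactin (mtopology_of X) (mcball_of X q (R0 + R))" using X q by (simp add: proper_metric_def)
      fix x assume x: "x \<in> mspace X - mcball_of X q (R0 + R)"
      have "\<bar>?f y - ?f z\<bar> \<le> \<epsilon> / 2" if y: "y \<in> mcball_of X x R" and z: "z \<in> mcball_of X x R" for y z
      proof -
        have yz: "y \<in> mspace X" "z \<in> mspace X" "mdist X x y \<le> R" "mdist X x z \<le> R" using y z by auto
        have "mdist X q x > R0 + R" using x q by auto
        then have "mdist X q y > R0" using mdist_triangle[of q X y x] q x yz by (auto simp: mdist_commute)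
        then have gy: "G \<le> g y" using R0 yz by blast
        have d: "mdist X y z \<le> 2 * R" using mdist_triangle[of y X x z] x yz by (auto simp: mdist_commute)
        have \<psi>d: "\<bar>\<psi> y - \<psi> z\<bar> \<le> 2 * R"
          using one_lipschitzD[OF \<psi> yz(1,2)] one_lipschitzD[OF \<psi> yz(2,1)] d by (auto simp: mdist_commute abs_le_iff)
        have gd: "\<bar>g z - g y\<bar> \<le> 2 * R"
          using one_lipschitzD[OF g yz(1,2)] one_lipschitzD[OF g yz(2,1)] d by (auto simp: mdist_commute abs_le_iff)
        have gp: "0 < g y" "0 < g z" using pos yz by auto
        have "?f y - ?f z = ((\<psi> y - \<psi> z) + ?f z * (g z - g y)) / g y"
          using yz gp by (simp add: field_simps)
        then have "\<bar>?f y - ?f z\<bar> = \<bar>(\<psi> y - \<psi> z) + ?f z * (g z - g y)\<bar> / g y"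
          using gp by (simp add: abs_divide)
        also have "\<dots> \<le> (2 * R + 2 * R) / g y"
        proof (rule divide_right_mono)
          have "\<bar>?f z * (g z - g y)\<bar> \<le> 1 * (2 * R)"
            unfolding abs_mult by (rule mult_mono) (use f01[OF yz(2)] gd in auto)
          with \<psi>d show "\<bar>(\<psi> y - \<psi> z) + ?f z * (g z - g y)\<bar> \<le> 2 * R + 2 * R" by linarith
        qed (use gp in simp)
        also have "\<dots> \<le> (2 * R + 2 * R) / G"
          using gy G R gp by (intro divide_left_mono) auto
        also have "\<dots> = \<epsilon> / 2" using R \<epsilon> by (simp add: G_def field_simps)
        finally show ?thesis .
      qed
      note osc = this
      have "diameter (?f ` mcball_of X x R) \<le> \<epsilon> / 2"
      proof (rule diameter_le)
        show "?f ` mcball_of X x R \<noteq> {} \<or> 0 \<le> \<epsilon> / 2" using \<epsilon> by simp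
        fix s t assume "s \<in> ?f ` mcball_of X x R" "t \<in> ?f ` mcball_of X x R"
        then obtain y z where yz: "y \<in> mcball_of X x R" "z \<in> mcball_of X x R" "s = ?f y" "t = ?f z" by blast
        show "norm (s - t) \<le> \<epsilon> / 2" unfolding yz(3,4) real_norm_def by (rule osc[OF yz(1,2)])
      qed
      then show "diameter (?f ` mcball_of X x R) < \<epsilon>" using \<epsilon> by linarith
    qed
  qed
  with c b show ?thesis by (simp add: higson_functions_def)
qed

section \<open>Bounding a Cech cocycle on a finite refinement\<close>

lemma nerveI: "finite \<F> \<Longrightarrow> \<F> \<noteq> {} \<Longrightarrow> \<F> \<subseteq> \<U> \<Longrightarrow> (\<And>U. U \<in> \<F> \<Longrightarrow> \<xi> \<in> U) \<Longrightarrow> \<F> \<in> nerve \<U>"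
  unfolding nerve_def by blast

lemma eval_chain_map_bd:
  "eval_chain c (bd (map f \<sigma>)) = eval_chain (\<lambda>\<tau>. c (map f \<tau>)) (bd \<sigma>)"
  by (simp add: frag_extend_map_bd[symmetric] eval_chain_frag_extend)

lemma one_lipschitz_Max:
  assumes "finite T" "T \<noteq> {}" "\<And>t. t \<in> T \<Longrightarrow> one_lipschitz X (\<Psi> t)"
  shows "one_lipschitz X (\<lambda>x. Max ((\<lambda>t. \<Psi> t x) ` T))"
  unfolding one_lipschitz_def
proof (intro ballI)
  fix x y assume xy: "x \<in> mspace X" "y \<in> mspace X"
  show "Max ((\<lambda>t. \<Psi> t x) ` T) \<le> Max ((\<lambda>t. \<Psi> t y) ` T) + mdist X x y"
  proof (rule Max.boundedI)
    fix a assume "a \<in> (\<lambda>t. \<Psi> t x) ` T"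
    then obtain t where t: "t \<in> T" "a = \<Psi> t x" by blast
    have "\<Psi> t y \<le> Max ((\<lambda>t. \<Psi> t y) ` T)" using assms(1) t(1) by (intro Max_ge) auto
    with one_lipschitzD[OF assms(3)[OF t(1)] xy] t(2)
    show "a \<le> Max ((\<lambda>t. \<Psi> t y) ` T) + mdist X x y" by linarith
  qed (use assms in auto)
qed

text \<open>\<open>u\<close> carries the cocycle to tuples of \<open>X\<close>, where
  \<open>b\<close> bounds it, and the types carry \<open>b\<close> back to a cover. The identity
  \<open>u (v t) = w t\<close> reconciles the two passages; for its sake a type also records a
  member of the cover.\<close>

lemma cech_cocycle_trivial:
  fixes X :: "'a metric" and m :: int and c :: "(('a \<Rightarrow> real) \<Rightarrow> real) set list \<Rightarrow> int"
  assumes X: "proper_metric X" and "uniformly_contractible X" and asdim: "asdim_le X D"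
    and ne: "mspace X \<noteq> {}" and m: "0 < m" and n: "0 < n"
    and \<U>: "\<U> \<in> open_covers (higson_compactification X)"
    and cocycle: "\<And>\<sigma>. length \<sigma> = n + 2 \<Longrightarrow> set \<sigma> \<in> nerve \<U> \<Longrightarrow> m dvd eval_chain c (bd \<sigma>)"
  obtains \<V> \<pi> d where "\<V> \<in> open_covers (higson_compactification X)"
    "\<And>V. V \<in> \<V> \<Longrightarrow> \<pi> V \<in> \<U> \<and> V \<subseteq> \<pi> V"
    "\<And>\<sigma>. length \<sigma> = n + 1 \<Longrightarrow> set \<sigma> \<in> nerve \<V> \<Longrightarrow> m dvd c (map \<pi> \<sigma>) - eval_chain d (bd \<sigma>)"
proof -
  let ?H = "higson_functions X" and ?T = "higson_compactification X" and ?e = "higson_embedding X"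
  obtain q where q: "q \<in> mspace X" using ne by blast
  obtain S where S: "contraction_radius X S" using contraction_radius_exists[OF assms(2)] by blast
  obtain F \<epsilon> \<U>0 where F: "finite F" "F \<subseteq> ?H" "0 < \<epsilon>" "finite \<U>0" "\<U>0 \<subseteq> \<U>"
    and leb: "\<And>\<xi>. \<xi> \<in> topspace ?T \<Longrightarrow>
      \<exists>U\<in>\<U>0. \<forall>\<zeta>\<in>topspace ?T. (\<forall>f\<in>F. \<bar>\<zeta> f - \<xi> f\<bar> < \<epsilon>) \<longrightarrow> \<zeta> \<in> U"
    by (rule higson_lebesgue[OF \<U>]) (rule that; assumption)
  have eF: "?e x f = f x" if "f \<in> F" for f x using F(2) that by (intro higson_embedding_apply) blast
  have eT: "?e x \<in> topspace ?T" if "x \<in> mspace X" for x using that by (rule higson_embedding_in_topspace)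
  \<comment> \<open>\<open>u x\<close> contains the whole \<open>\<epsilon>\<close>-box about
    \<open>x\<close>; it is chosen from the finite subfamily so that \<open>u\<close> has finite
    range.\<close>
  define u where "u x = (SOME U. U \<in> \<U>0 \<and> (\<forall>\<zeta>\<in>topspace ?T. (\<forall>f\<in>F. \<bar>\<zeta> f - f x\<bar> < \<epsilon>) \<longrightarrow> \<zeta> \<in> U))" for x
  have u: "u x \<in> \<U>0" "\<And>\<zeta>. \<zeta> \<in> topspace ?T \<Longrightarrow> (\<And>f. f \<in> F \<Longrightarrow> \<bar>\<zeta> f - f x\<bar> < \<epsilon>) \<Longrightarrow> \<zeta> \<in> u x"
    if x: "x \<in> mspace X" for x
  proof -
    obtain U where U: "U \<in> \<U>0" "\<forall>\<zeta>\<in>topspace ?T. (\<forall>f\<in>F. \<bar>\<zeta> f - ?e x f\<bar> < \<epsilon>) \<longrightarrow> \<zeta> \<in> U"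
      using leb[OF eT[OF x]] by (elim bexE)
    have "U \<in> \<U>0 \<and> (\<forall>\<zeta>\<in>topspace ?T. (\<forall>f\<in>F. \<bar>\<zeta> f - f x\<bar> < \<epsilon>) \<longrightarrow> \<zeta> \<in> U)"
      using U by (simp add: eF)
    then have *: "u x \<in> \<U>0 \<and> (\<forall>\<zeta>\<in>topspace ?T. (\<forall>f\<in>F. \<bar>\<zeta> f - f x\<bar> < \<epsilon>) \<longrightarrow> \<zeta> \<in> u x)"
      unfolding u_def by (rule someI)
    then show "u x \<in> \<U>0" by (rule conjunct1)
    show "\<zeta> \<in> u x" if "\<zeta> \<in> topspace ?T" "\<And>f. f \<in> F \<Longrightarrow> \<bar>\<zeta> f - f x\<bar> < \<epsilon>" for \<zeta>
      using * that by simp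
  qed
  \<comment> \<open>One half of \<open>\<epsilon>\<close> bounds the variation on tuples, the other
    half is spent on approximating points of the compactification by points of
    \<open>X\<close>.\<close>
  define \<K> where "\<K> = {A. A \<subseteq> mspace X \<and> (\<forall>f\<in>F. \<forall>a\<in>A. \<forall>b\<in>A. \<bar>f a - f b\<bar> < \<epsilon> / 2)}"
  have \<K>: "slow_family X q \<K>"
    unfolding \<K>_def by (rule slow_family_higson_functions[OF X q F(1,2)]) (use F(3) in simp)
  have \<K>_nerve: "u ` A \<in> nerve \<U>" if A: "A \<in> \<K>" "finite A" "A \<noteq> {}" for A
  proof -
    obtain a0 where a0: "a0 \<in> A" using A(3) by blast
    show ?thesis
    proof (rule nerveI[where \<xi>="?e a0"])
      show "u ` A \<subseteq> \<U>" using u(1) F(5) A(1) by (auto simp: \<K>_def)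
      fix U assume "U \<in> u ` A"
      then obtain a where a: "a \<in> A" "U = u a" by blast
      have aX: "a \<in> mspace X" "a0 \<in> mspace X" using A(1) a a0 by (auto simp: \<K>_def)
      show "?e a0 \<in> U"
        unfolding a(2)
      proof (rule u(2)[OF aX(1) eT[OF aX(2)]])
        fix f assume f: "f \<in> F"
        then have "\<bar>f a0 - f a\<bar> < \<epsilon> / 2" using A(1) a a0 by (simp add: \<K>_def)
        then show "\<bar>?e a0 f - f a\<bar> < \<epsilon>" using F(3) by (simp add: eF[OF f])
      qed
    qed (use A in auto)
  qed
  have "\<exists>\<L> b. \<L> \<subseteq> \<K> \<and> slow_family X q \<L> \<and>
    (\<forall>\<sigma>. length \<sigma> = n + 1 \<longrightarrow> set \<sigma> \<subseteq> mspace X \<longrightarrow> set \<sigma> \<in> \<L> \<longrightarrow>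
      m dvd (\<lambda>xs. c (map u xs)) \<sigma> - eval_chain b (bd \<sigma>))"
  proof (rule slow_cocycle_trivial[OF X S q \<K>])
    fix \<sigma> assume \<sigma>: "length \<sigma> = n + 2" "set \<sigma> \<in> \<K>"
    have "\<sigma> \<noteq> []" using \<sigma>(1) by auto
    then have "set (map u \<sigma>) \<in> nerve \<U>" using \<K>_nerve[OF \<sigma>(2)] by simp
    then have "m dvd eval_chain c (bd (map u \<sigma>))" using \<sigma>(1) by (intro cocycle) auto
    then show "m dvd eval_chain (\<lambda>xs. c (map u xs)) (bd \<sigma>)" by (simp add: eval_chain_map_bd)
  qed
  then obtain \<L> b where \<L>: "\<L> \<subseteq> \<K>" "slow_family X q \<L>"
    and b: "\<And>\<sigma>. length \<sigma> = n + 1 \<Longrightarrow> set \<sigma> \<subseteq> mspace X \<Longrightarrow> set \<sigma> \<in> \<L> \<Longrightarrow>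
      m dvd c (map u \<sigma>) - eval_chain b (bd \<sigma>)" by blast
  have finu: "finite (u ` mspace X)" by (rule finite_subset[OF _ F(4)]) (use u(1) in blast)
  obtain T :: "(nat \<times> nat \<times> (nat list \<Rightarrow> int) \<times> (('a \<Rightarrow> real) \<Rightarrow> real) set) set" and \<Psi> w \<beta>
    where T: "finite T" and \<Psi>_lip: "\<And>t. one_lipschitz X (\<Psi> t)" and \<Psi>_nn: "\<And>t x. x \<in> mspace X \<Longrightarrow> 0 \<le> \<Psi> t x"
    and \<Psi>_ex: "\<And>x. x \<in> mspace X \<Longrightarrow> \<exists>t\<in>T. 0 < \<Psi> t x"
    and \<Psi>_large: "\<And>r. \<exists>R. \<forall>x\<in>mspace X. R < mdist X q x \<longrightarrow> (\<exists>t\<in>T. r \<le> \<Psi> t x)"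
    and \<Psi>_loc: "\<And>x. x \<in> mspace X \<Longrightarrow> \<exists>v. (\<forall>t\<in>T. 0 < \<Psi> t x \<longrightarrow> v t \<in> mspace X \<and> u (v t) = w t) \<and>
        insert x (v ` {t\<in>T. 0 < \<Psi> t x}) \<in> \<L> \<and>
        (\<forall>ts. length ts = n \<longrightarrow> set ts \<subseteq> {t\<in>T. 0 < \<Psi> t x} \<longrightarrow> m dvd \<beta> ts - b (map v ts))"
    by (rule finite_types_exist[OF X asdim q \<L>(2) finu m n]) (rule that; assumption)
  have Tne: "T \<noteq> {}" using \<Psi>_ex[OF q] by blast
  \<comment> \<open>Division by the pointwise maximum gives functions with values between 0 and 1,
    at each point of \<open>X\<close> one of them equal to 1; the growth of \<open>g\<close> makes
    them slowly oscillating.\<close>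
  define g where "g x = Max ((\<lambda>t. \<Psi> t x) ` T)" for x
  have g_lip: "one_lipschitz X g"
    unfolding g_def by (rule one_lipschitz_Max[OF T Tne \<Psi>_lip])
  have g_ge: "\<Psi> t x \<le> g x" if "t \<in> T" for t x unfolding g_def using T that by (intro Max_ge) auto
  have g_pos: "0 < g x" if "x \<in> mspace X" for x
    using \<Psi>_ex[OF that] g_ge[of _ x] by (meson less_le_trans)
  have g_att: "\<exists>t\<in>T. \<Psi> t x = g x" for x
  proof -
    have "g x \<in> (\<lambda>t. \<Psi> t x) ` T" unfolding g_def using T Tne by (intro Max_in) auto
    then show ?thesis by force
  qed
  define f where "f t = (\<lambda>x\<in>mspace X. \<Psi> t x / g x)" for t
  have fH: "f t \<in> ?H" if t: "t \<in> T" for t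
    unfolding f_def
  proof (rule higson_function_quotient[OF X q \<Psi>_lip g_lip])
    show "0 \<le> \<Psi> t x \<and> \<Psi> t x \<le> g x" if "x \<in> mspace X" for x using \<Psi>_nn[OF that] g_ge[OF t] by simp
    show "0 < g x" if "x \<in> mspace X" for x using that by (rule g_pos)
    show "\<exists>R. \<forall>x\<in>mspace X. R < mdist X q x \<longrightarrow> r \<le> g x" for r
      using \<Psi>_large[of r] g_ge by (meson order_trans)
  qed
  have e_f: "?e x (f t) = \<Psi> t x / g x" if "t \<in> T" "x \<in> mspace X" for t x
    using higson_embedding_apply[OF fH[OF that(1)]] that(2) by (simp add: f_def)
  define Vt where "Vt t = {\<xi> \<in> topspace ?T. 1 / 2 < \<xi> (f t)}" for t
  have Vt_open: "openin ?T (Vt t)" if "t \<in> T" for t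
  proof -
    have "openin ?T {\<xi> \<in> topspace ?T. \<xi> (f t) \<in> {1 / 2<..}}"
      by (rule openin_continuous_map_preimage[OF continuous_map_higson_eval[OF fH[OF that]]]) simp
    then show ?thesis by (simp add: Vt_def)
  qed
  have Vt_pos: "0 < \<Psi> t x" if "t \<in> T" "x \<in> mspace X" "?e x \<in> Vt t" for t x
  proof -
    have "1 / 2 < \<Psi> t x / g x" using that by (simp add: Vt_def e_f)
    then have "0 < \<Psi> t x / g x" by (rule less_trans[rotated]) simp
    then show ?thesis using g_pos[OF that(2)] by (simp add: zero_less_divide_iff)
  qed
  have Vt_cover: "topspace ?T \<subseteq> (\<Union>t\<in>T. Vt t)"
  proof (rule ccontr)
    \<comment> \<open>At an uncovered point all extended functions are at most \<open>1 / 2\<close>,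
      so \<open>W\<close> is nonempty and open and contains a point of \<open>X\<close>, where some
      quotient equals 1.\<close>
    define W where "W = {\<xi> \<in> topspace ?T. \<forall>t\<in>T. \<xi> (f t) < 1}"
    assume "\<not> ?thesis"
    then obtain \<xi> where \<xi>: "\<xi> \<in> topspace ?T" "\<And>t. t \<in> T \<Longrightarrow> \<xi> \<notin> Vt t" by blast
    have "\<xi> \<in> W"
      unfolding W_def
    proof (intro CollectI conjI ballI)
      fix t assume "t \<in> T"
      from \<xi>(2)[OF this] \<xi>(1) show "\<xi> (f t) < 1" by (simp add: Vt_def)
    qed fact
    moreover have "openin ?T (topspace ?T \<inter> (\<Inter>t\<in>T. {\<xi> \<in> topspace ?T. \<xi> (f t) \<in> {..<1}}))"
    proof (rule openin_Int[OF openin_topspace openin_INT2])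
      show "openin ?T {\<xi> \<in> topspace ?T. \<xi> (f t) \<in> {..<1}}" if "t \<in> T" for t
        by (rule openin_continuous_map_preimage[OF continuous_map_higson_eval[OF fH[OF that]]]) simp
    qed (use T Tne in auto)
    moreover have "topspace ?T \<inter> (\<Inter>t\<in>T. {\<xi> \<in> topspace ?T. \<xi> (f t) \<in> {..<1}}) = W"
      by (auto simp: W_def)
    ultimately obtain x where x: "x \<in> mspace X" "?e x \<in> W"
      using higson_dense[of X W] by auto
    obtain t where t: "t \<in> T" "\<Psi> t x = g x" using g_att by blast
    have "?e x (f t) < 1" using x(2) t(1) by (simp add: W_def)
    then show False using e_f[OF t(1) x(1)] t(2) g_pos[OF x(1)] by simp
  qed
  have Vt_sub: "w t \<in> \<U> \<and> Vt t \<subseteq> w t" if t: "t \<in> T" and nonempty: "Vt t \<noteq> {}" for t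
  proof -
    obtain x0 where x0: "x0 \<in> mspace X" "?e x0 \<in> Vt t"
      by (rule higson_dense[OF Vt_open[OF t] nonempty]) (rule that)
    obtain v where "\<forall>t\<in>T. 0 < \<Psi> t x0 \<longrightarrow> v t \<in> mspace X \<and> u (v t) = w t" using \<Psi>_loc[OF x0(1)] by blast
    then have "v t \<in> mspace X \<and> u (v t) = w t" using t Vt_pos[OF t x0] by blast
    then have wU: "w t \<in> \<U>" using u(1)[of "v t"] F(5) by auto
    \<comment> \<open>Within \<open>Vt t\<close> the point \<open>\<xi>\<close> is approximated by
      some \<open>x\<close> of \<open>X\<close>. The vertex \<open>v t\<close> lies in a common set
      of \<open>\<K>\<close> with \<open>x\<close>, so \<open>\<xi>\<close> lies in the box about
      \<open>v t\<close>.\<close>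
    have "\<xi> \<in> w t" if \<xi>: "\<xi> \<in> Vt t" for \<xi>
    proof -
      have \<xi>T: "\<xi> \<in> topspace ?T" using \<xi> by (simp add: Vt_def)
      let ?W = "Vt t \<inter> {\<zeta> \<in> topspace ?T. \<forall>f\<in>F. \<bar>\<zeta> f - \<xi> f\<bar> < \<epsilon> / 2}"
      have "openin ?T ?W" by (intro openin_Int Vt_open[OF t] openin_higson_box F(1,2))
      moreover have "\<xi> \<in> ?W" using \<xi> \<xi>T F(3) by simp
      ultimately obtain x where x: "x \<in> mspace X" "?e x \<in> ?W"
        using higson_dense[of X ?W] by blast
      obtain v where v: "\<forall>t\<in>T. 0 < \<Psi> t x \<longrightarrow> v t \<in> mspace X \<and> u (v t) = w t"
        "insert x (v ` {t\<in>T. 0 < \<Psi> t x}) \<in> \<L>" using \<Psi>_loc[OF x(1)] by blast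
      have pos: "0 < \<Psi> t x" using Vt_pos[OF t x(1)] x(2) by blast
      then have vt: "v t \<in> mspace X" "u (v t) = w t" using v(1) t by blast+
      have *: "insert x (v ` {t\<in>T. 0 < \<Psi> t x}) \<in> \<K>" using v(2) \<L>(1) by blast
      have small: "\<bar>h x - h (v t)\<bar> < \<epsilon> / 2" if "h \<in> F" for h
      proof -
        have "x \<in> insert x (v ` {t\<in>T. 0 < \<Psi> t x})" "v t \<in> insert x (v ` {t\<in>T. 0 < \<Psi> t x})"
          using pos t by blast+
        with * that show ?thesis unfolding \<K>_def mem_Collect_eq by blast
      qed
      have "\<xi> \<in> u (v t)"
      proof (rule u(2)[OF vt(1) \<xi>T])
        fix h assume h: "h \<in> F"
        have "\<bar>?e x h - \<xi> h\<bar> < \<epsilon> / 2" using x(2) h by simp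
        then have "\<bar>h x - \<xi> h\<bar> < \<epsilon> / 2" by (simp add: eF[OF h])
        with small[OF h] show "\<bar>\<xi> h - h (v t)\<bar> < \<epsilon>" by linarith
      qed
      with vt(2) show ?thesis by simp
    qed
    with wU show ?thesis by blast
  qed
  \<comment> \<open>The empty set is dropped: \<open>w t\<close> is known to belong to
    \<open>\<U>\<close> only if some point of \<open>X\<close> lies in \<open>Vt t\<close>.\<close>
  define \<V> where "\<V> = Vt ` T - {{}}"
  define \<tau> where "\<tau> V = (SOME t. t \<in> T \<and> Vt t = V)" for V
  have \<tau>: "\<tau> V \<in> T" "Vt (\<tau> V) = V" if "V \<in> \<V>" for V
  proof -
    have "\<exists>t. t \<in> T \<and> Vt t = V" using that by (auto simp: \<V>_def)
    from someI_ex[OF this] show "\<tau> V \<in> T" "Vt (\<tau> V) = V" unfolding \<tau>_def by blast+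
  qed
  show thesis
  proof (rule that[of \<V> "\<lambda>V. w (\<tau> V)" "\<lambda>Vs. \<beta> (map \<tau> Vs)"])
    have "\<Union>\<V> = (\<Union>t\<in>T. Vt t)" unfolding \<V>_def by blast
    moreover have "(\<Union>t\<in>T. Vt t) \<subseteq> topspace ?T" by (auto simp: Vt_def)
    ultimately show "\<V> \<in> open_covers ?T"
      unfolding open_covers_def using Vt_open Vt_cover by (auto simp: \<V>_def)
    show "w (\<tau> V) \<in> \<U> \<and> V \<subseteq> w (\<tau> V)" if "V \<in> \<V>" for V
      using Vt_sub[OF \<tau>(1)[OF that]] \<tau>(2)[OF that] that by (auto simp: \<V>_def)
    fix \<sigma> :: "(('a \<Rightarrow> real) \<Rightarrow> real) set list"
    assume \<sigma>: "length \<sigma> = n + 1" "set \<sigma> \<in> nerve \<V>"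
    have \<sigma>V: "set \<sigma> \<subseteq> \<V>" "\<Inter>(set \<sigma>) \<noteq> {}" "set \<sigma> \<noteq> {}" using \<sigma>(2) by (auto simp: nerve_def)
    \<comment> \<open>Finitely many open sets with a common point have one in \<open>X\<close>,
      where the local description of the types applies.\<close>
    have "openin ?T (\<Inter>(set \<sigma>))"
      by (rule openin_Inter) (use \<sigma>V Vt_open in \<open>auto simp: \<V>_def\<close>)
    then obtain x where x: "x \<in> mspace X" "?e x \<in> \<Inter>(set \<sigma>)"
      using higson_dense[of X "\<Inter>(set \<sigma>)"] \<sigma>V(2) by blast
    obtain v where v: "\<forall>t\<in>T. 0 < \<Psi> t x \<longrightarrow> v t \<in> mspace X \<and> u (v t) = w t"
        "insert x (v ` {t\<in>T. 0 < \<Psi> t x}) \<in> \<L>"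
        "\<forall>ts. length ts = n \<longrightarrow> set ts \<subseteq> {t\<in>T. 0 < \<Psi> t x} \<longrightarrow> m dvd \<beta> ts - b (map v ts)"
      using \<Psi>_loc[OF x(1)] by (elim exE conjE)
    have pos: "\<tau> V \<in> T \<and> 0 < \<Psi> (\<tau> V) x" if "V \<in> set \<sigma>" for V
    proof -
      have V: "V \<in> \<V>" using that \<sigma>V by blast
      have "?e x \<in> Vt (\<tau> V)" using \<tau>(2)[OF V] x(2) that by blast
      with Vt_pos[OF \<tau>(1)[OF V] x(1)] \<tau>(1)[OF V] show ?thesis by blast
    qed
    define s where "s = map (\<lambda>V. v (\<tau> V)) \<sigma>"
    have "set s \<subseteq> insert x (v ` {t\<in>T. 0 < \<Psi> t x})" using pos by (auto simp: s_def)
    then have sL: "set s \<in> \<L>" by (rule slow_family_subset[OF \<L>(2) v(2)])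
    have sX: "set s \<subseteq> mspace X" using v(1) pos by (auto simp: s_def)
    have 1: "m dvd c (map u s) - eval_chain b (bd s)"
      by (rule b[OF _ sX sL]) (simp add: s_def \<sigma>(1))
    have 2: "map u s = map (\<lambda>V. w (\<tau> V)) \<sigma>" using v(1) pos by (auto simp: s_def)
    \<comment> \<open>Over the faces of \<open>\<sigma>\<close>, the values of
      \<open>\<beta>\<close> are congruent to those of \<open>b\<close> on the vertices chosen at
      \<open>x\<close>, so the coboundaries over \<open>\<sigma>\<close> are congruent as
      well.\<close>
    have "m dvd eval_chain (\<lambda>Vs. \<beta> (map \<tau> Vs) - b (map (\<lambda>V. v (\<tau> V)) Vs)) (bd \<sigma>)"
    proof (rule eval_chain_dvd)
      fix \<rho> assume "\<rho> \<in> Poly_Mapping.keys (bd \<sigma>)"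
      then have \<rho>: "length \<rho> = n" "set \<rho> \<subseteq> set \<sigma>" using keys_bd[of \<rho> \<sigma>] \<sigma>(1) by auto
      have "set (map \<tau> \<rho>) \<subseteq> {t\<in>T. 0 < \<Psi> t x}" using \<rho>(2) pos by auto
      then have "m dvd \<beta> (map \<tau> \<rho>) - b (map v (map \<tau> \<rho>))"
        by (intro v(3)[rule_format]) (simp_all only: length_map \<rho>(1))
      then show "m dvd \<beta> (map \<tau> \<rho>) - b (map (\<lambda>V. v (\<tau> V)) \<rho>)" by (simp add: comp_def)
    qed
    then have 3: "m dvd eval_chain (\<lambda>Vs. \<beta> (map \<tau> Vs)) (bd \<sigma>) - eval_chain b (bd s)"
      unfolding eval_chain_fun_diff s_def by (simp add: eval_chain_map_bd)
    show "m dvd c (map (\<lambda>V. w (\<tau> V)) \<sigma>) - eval_chain (\<lambda>Vs. \<beta> (map \<tau> Vs)) (bd \<sigma>)"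
      using dvd_diff[OF 1 3] unfolding 2 by simp
  qed
qed

section \<open>Triviality of the direct limit\<close>

lemma finprod_integer_mod_group:
  assumes "finite A" "0 < p" "\<And>i. i \<in> A \<Longrightarrow> f i \<in> {0..<int p}"
  shows "finprod (integer_mod_group p) f A = (\<Sum>i\<in>A. f i) mod int p"
  using assms(1,3)
proof (induction A rule: finite_induct)
  case empty
  interpret G: comm_group "integer_mod_group p" by (rule abelian_integer_mod_group)
  show ?case by simp
next
  case (insert i A)
  interpret G: comm_group "integer_mod_group p" by (rule abelian_integer_mod_group)
  have "f \<in> A \<rightarrow> carrier (integer_mod_group p)" "f i \<in> carrier (integer_mod_group p)"
    using insert.prems assms(2) by (auto simp: carrier_integer_mod_group)
  then have "finprod (integer_mod_group p) f (insert i A) = (f i + finprod (integer_mod_group p) f A) mod int p"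
    using insert.hyps by simp
  with insert show ?case by (simp add: mod_simps)
qed

lemma coboundary_integer_mod_group:
  assumes "\<sigma> \<in> ordered_simplices (Suc n) K" "0 < p"
  shows "coboundary n K (integer_mod_group p) c \<sigma> = eval_chain c (bd \<sigma>) mod int p"
proof -
  have len: "{..Suc n} = {..<length \<sigma>}" using assms(1) by (auto simp: ordered_simplices_def)
  have "coboundary n K (integer_mod_group p) c \<sigma> =
      (\<Sum>i\<in>{..Suc n}. ((-1) ^ i * c (face i \<sigma>)) mod int p) mod int p"
    using assms unfolding coboundary_def
    by (simp add: int_pow_integer_mod_group finprod_integer_mod_group)
  also have "\<dots> = eval_chain c (bd \<sigma>) mod int p"
    unfolding eval_chain_bd len by (simp only: mod_sum_eq)
  finally show ?thesis .
qed

lemma keys_bd_ordered_simplices: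
  assumes "\<sigma> \<in> ordered_simplices (Suc n) (nerve \<U>)" "\<tau> \<in> Poly_Mapping.keys (bd \<sigma>)"
  shows "\<tau> \<in> ordered_simplices n (nerve \<U>)"
proof -
  have \<tau>: "length \<tau> = Suc n" "set \<tau> \<subseteq> set \<sigma>" using keys_bd[OF assms(2)] assms(1) by (auto simp: ordered_simplices_def)
  have "set \<sigma> \<in> nerve \<U>" using assms(1) by (simp add: ordered_simplices_def)
  then obtain \<xi> where "\<xi> \<in> \<Inter>(set \<sigma>)" "set \<sigma> \<subseteq> \<U>" by (auto simp: nerve_def)
  then have "set \<tau> \<in> nerve \<U>" using \<tau> by (intro nerveI[of _ _ \<xi>]) auto
  with \<tau> show ?thesis by (simp add: ordered_simplices_def)
qed

lemma eval_chain_dvd_cong: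
  assumes "\<And>\<tau>. \<tau> \<in> Poly_Mapping.keys z \<Longrightarrow> m dvd c \<tau> - d \<tau>"
  shows "m dvd eval_chain c z - eval_chain d z"
  unfolding eval_chain_fun_diff[symmetric] by (rule eval_chain_dvd) (rule assms)

lemma dvd_cong_trans:
  fixes m :: int
  assumes "m dvd x - y" "m dvd y" shows "m dvd x"
  using dvd_add[OF assms] by simp

lemma dvd_mod_diff: "m dvd x mod m - (x :: int)"
  by (simp add: mod_eq_dvd_iff[symmetric])

lemma r_coset_subgroup_generated [simp]: "B #>\<^bsub>subgroup_generated G S\<^esub> a = B #>\<^bsub>G\<^esub> a"
  by (simp add: r_coset_def subgroup_generated_def)

lemma set_mult_subgroup_generated [simp]: "A <#>\<^bsub>subgroup_generated G S\<^esub> B = A <#>\<^bsub>G\<^esub> B"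
  by (simp add: set_mult_def subgroup_generated_def)

section \<open>Cochains modulo \<open>p\<close> on nerves\<close>

context
  fixes p :: nat assumes p: "0 < p"
begin

abbreviation "Zp \<equiv> integer_mod_group p"

definition cocycle_mod :: "nat \<Rightarrow> 'v set set \<Rightarrow> ('v list \<Rightarrow> int) \<Rightarrow> bool" where
  "cocycle_mod n K c \<longleftrightarrow> (\<forall>\<sigma>\<in>ordered_simplices (Suc n) K. int p dvd eval_chain c (bd \<sigma>))"

definition coboundary_mod :: "nat \<Rightarrow> 'v set set \<Rightarrow> ('v list \<Rightarrow> int) \<Rightarrow> bool" where
  "coboundary_mod n K c \<longleftrightarrow> (\<exists>d. \<forall>\<sigma>\<in>ordered_simplices n K. int p dvd c \<sigma> - eval_chain d (bd \<sigma>))"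

lemma carrier_cochain_group:
  "carrier (cochain_group n K Zp) = (\<Pi>\<^sub>E \<sigma>\<in>ordered_simplices n K. {0..<int p})"
  using p by (simp add: cochain_group_def carrier_integer_mod_group)

lemma mult_cochain_group:
  "x \<otimes>\<^bsub>cochain_group n K Zp\<^esub> y = (\<lambda>\<sigma>\<in>ordered_simplices n K. (x \<sigma> + y \<sigma>) mod int p)"
  by (simp add: cochain_group_def)

lemma group_cochain_group: "group (cochain_group n K Zp)"
  by (simp add: cochain_group_def)

lemma inv_cochain_group:
  assumes "x \<in> carrier (cochain_group n K Zp)"
  shows "inv\<^bsub>cochain_group n K Zp\<^esub> x = (\<lambda>\<sigma>\<in>ordered_simplices n K. (- x \<sigma>) mod int p)"
proof -
  have "\<And>\<sigma>. \<sigma> \<in> ordered_simplices n K \<Longrightarrow> x \<sigma> \<in> carrier Zp"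
    using assms by (auto simp: cochain_group_def)
  then show ?thesis
    using assms unfolding cochain_group_def by (subst inv_product_group) (auto intro!: restrict_ext)
qed

lemma inv_cochain_dvd:
  assumes "x \<in> carrier (cochain_group n K Zp)" "\<sigma> \<in> ordered_simplices n K"
  shows "int p dvd (inv\<^bsub>cochain_group n K Zp\<^esub> x) \<sigma> - (- x \<sigma>)"
  unfolding inv_cochain_group[OF assms(1)] restrict_apply if_P[OF assms(2)] by (rule dvd_mod_diff)

text \<open>\<open>cohomology_group\<close> is formed from the subgroup generated by the cocycles,
  so the cocycle condition has to be carried along products and inverses.\<close>

lemma generate_cocycles:
  assumes "c \<in> carrier (subgroup_generated (cochain_group n (nerve \<U>) Zp) (cocycles n (nerve \<U>) Zp))"
  shows "c \<in> carrier (cochain_group n (nerve \<U>) Zp) \<and> cocycle_mod n (nerve \<U>) c"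
proof -
  let ?C = "cochain_group n (nerve \<U>) Zp" and ?Z = "cocycles n (nerve \<U>) Zp"
  interpret C: group ?C by (rule group_cochain_group)
  have c: "c \<in> generate ?C (carrier ?C \<inter> ?Z)" using assms by (simp add: carrier_subgroup_generated)
  have coc: "cocycle_mod n (nerve \<U>) h" if "h \<in> ?Z" for h
    unfolding cocycle_mod_def
  proof
    fix \<sigma> assume \<sigma>: "\<sigma> \<in> ordered_simplices (Suc n) (nerve \<U>)"
    have "coboundary n (nerve \<U>) Zp h \<sigma> = 0"
      using that \<sigma> by (simp add: cocycles_def kernel_def cochain_group_def)
    then show "int p dvd eval_chain h (bd \<sigma>)"
      using coboundary_integer_mod_group[OF \<sigma> p, of h] by (simp add: dvd_eq_mod_eq_0)
  qed
  have gen: "generate ?C (carrier ?C \<inter> ?Z) \<subseteq> carrier ?C" by (rule C.generate_incl) simp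
  have keys: "\<tau> \<in> ordered_simplices n (nerve \<U>)"
    if "\<sigma> \<in> ordered_simplices (Suc n) (nerve \<U>)" "\<tau> \<in> Poly_Mapping.keys (bd \<sigma>)" for \<sigma> \<tau>
    using that by (rule keys_bd_ordered_simplices)
  from c show ?thesis
  proof (induction rule: generate.induct)
    case one
    have "int p dvd eval_chain (one ?C) (bd \<sigma>)" if "\<sigma> \<in> ordered_simplices (Suc n) (nerve \<U>)" for \<sigma>
      by (rule eval_chain_dvd) (use keys[OF that] in \<open>simp add: cochain_group_def\<close>)
    then show ?case by (simp add: cocycle_mod_def)
  next
    case (incl h)
    then show ?case using coc by blast
  next
    case (inv h)
    have "int p dvd eval_chain (inv\<^bsub>?C\<^esub> h) (bd \<sigma>)" if \<sigma>: "\<sigma> \<in> ordered_simplices (Suc n) (nerve \<U>)" for \<sigma>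
    proof (rule dvd_cong_trans)
      show "int p dvd eval_chain (inv\<^bsub>?C\<^esub> h) (bd \<sigma>) - eval_chain (\<lambda>\<tau>. - h \<tau>) (bd \<sigma>)"
        using inv by (intro eval_chain_dvd_cong inv_cochain_dvd keys[OF \<sigma>]) simp_all
      show "int p dvd eval_chain (\<lambda>\<tau>. - h \<tau>) (bd \<sigma>)"
        using coc[of h] inv \<sigma> by (simp add: eval_chain_fun_minus cocycle_mod_def)
    qed
    then show ?case using inv by (simp add: cocycle_mod_def)
  next
    case (eng h1 h2)
    have "int p dvd eval_chain (h1 \<otimes>\<^bsub>?C\<^esub> h2) (bd \<sigma>)" if \<sigma>: "\<sigma> \<in> ordered_simplices (Suc n) (nerve \<U>)" for \<sigma>
    proof (rule dvd_cong_trans)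
      show "int p dvd eval_chain (h1 \<otimes>\<^bsub>?C\<^esub> h2) (bd \<sigma>) - eval_chain (\<lambda>\<tau>. h1 \<tau> + h2 \<tau>) (bd \<sigma>)"
        by (intro eval_chain_dvd_cong) (simp add: mult_cochain_group keys[OF \<sigma>] mod_eq_dvd_iff[symmetric])
      show "int p dvd eval_chain (\<lambda>\<tau>. h1 \<tau> + h2 \<tau>) (bd \<sigma>)"
        using eng \<sigma> by (simp add: eval_chain_fun_add cocycle_mod_def)
    qed
    then show ?case using eng by (simp add: cocycle_mod_def)
  qed
qed

text \<open>An integer cochain whose coboundary is \<open>x\<close> modulo \<open>p\<close> is
  reduced modulo \<open>p\<close> and restricted to the simplices; this gives a member of the
  cochain group with the same coboundary.\<close>

lemma coboundaries_iff:
  "x \<in> coboundaries (Suc k) (nerve \<U>) Zp \<longleftrightarrow>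
    x \<in> carrier (cochain_group (Suc k) (nerve \<U>) Zp) \<and> coboundary_mod (Suc k) (nerve \<U>) x"
proof
  assume "x \<in> coboundaries (Suc k) (nerve \<U>) Zp"
  then obtain d where d: "x = coboundary k (nerve \<U>) Zp d" by (auto simp: coboundaries_def)
  have x: "x \<sigma> = eval_chain d (bd \<sigma>) mod int p" if "\<sigma> \<in> ordered_simplices (Suc k) (nerve \<U>)" for \<sigma>
    unfolding d by (rule coboundary_integer_mod_group[OF that p])
  have "x \<in> extensional (ordered_simplices (Suc k) (nerve \<U>))" by (simp add: d coboundary_def)
  then have "x \<in> carrier (cochain_group (Suc k) (nerve \<U>) Zp)"
    unfolding carrier_cochain_group using p x by (auto simp: PiE_iff)
  moreover have "coboundary_mod (Suc k) (nerve \<U>) x"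
    unfolding coboundary_mod_def by (intro exI[of _ d]) (simp add: x mod_eq_dvd_iff[symmetric])
  ultimately show "x \<in> carrier (cochain_group (Suc k) (nerve \<U>) Zp) \<and> coboundary_mod (Suc k) (nerve \<U>) x" ..
next
  assume x: "x \<in> carrier (cochain_group (Suc k) (nerve \<U>) Zp) \<and> coboundary_mod (Suc k) (nerve \<U>) x"
  then obtain d where d: "\<And>\<sigma>. \<sigma> \<in> ordered_simplices (Suc k) (nerve \<U>) \<Longrightarrow> int p dvd x \<sigma> - eval_chain d (bd \<sigma>)"
    by (auto simp: coboundary_mod_def)
  define d' where "d' = (\<lambda>\<tau>\<in>ordered_simplices k (nerve \<U>). d \<tau> mod int p)"
  have "d' \<in> carrier (cochain_group k (nerve \<U>) Zp)"
    unfolding carrier_cochain_group d'_def using p by simp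
  moreover have "x = coboundary k (nerve \<U>) Zp d'"
  proof
    fix \<sigma>
    show "x \<sigma> = coboundary k (nerve \<U>) Zp d' \<sigma>"
    proof (cases "\<sigma> \<in> ordered_simplices (Suc k) (nerve \<U>)")
      case True
      have "int p dvd eval_chain d (bd \<sigma>) - eval_chain d' (bd \<sigma>)"
        by (rule eval_chain_dvd_cong)
          (simp add: d'_def keys_bd_ordered_simplices[OF True] mod_eq_dvd_iff[symmetric])
      with d[OF True] have "int p dvd (x \<sigma> - eval_chain d (bd \<sigma>)) + (eval_chain d (bd \<sigma>) - eval_chain d' (bd \<sigma>))"
        by (rule dvd_add)
      then have "x \<sigma> mod int p = eval_chain d' (bd \<sigma>) mod int p" by (simp add: mod_eq_dvd_iff)
      moreover have "x \<sigma> \<in> {0..<int p}" using x True unfolding carrier_cochain_group by blast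
      ultimately show ?thesis using coboundary_integer_mod_group[OF True p, of d'] by simp
    next
      case False
      then show ?thesis using x by (auto simp: carrier_cochain_group coboundary_def PiE_def extensional_def)
    qed
  qed
  ultimately show "x \<in> coboundaries (Suc k) (nerve \<U>) Zp" by (simp add: coboundaries_def)
qed

lemma coboundary_mod_add:
  assumes "coboundary_mod n K x" "coboundary_mod n K y"
    and "\<And>\<sigma>. \<sigma> \<in> ordered_simplices n K \<Longrightarrow> int p dvd z \<sigma> - (x \<sigma> + y \<sigma>)"
  shows "coboundary_mod n K z"
proof -
  obtain d e where d: "\<forall>\<sigma>\<in>ordered_simplices n K. int p dvd x \<sigma> - eval_chain d (bd \<sigma>)"
    and e: "\<forall>\<sigma>\<in>ordered_simplices n K. int p dvd y \<sigma> - eval_chain e (bd \<sigma>)"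
    using assms(1,2) unfolding coboundary_mod_def by (elim exE) (rule that)
  have "int p dvd z \<sigma> - eval_chain (\<lambda>\<tau>. d \<tau> + e \<tau>) (bd \<sigma>)" if \<sigma>: "\<sigma> \<in> ordered_simplices n K" for \<sigma>
  proof -
    have "int p dvd (z \<sigma> - (x \<sigma> + y \<sigma>)) + ((x \<sigma> - eval_chain d (bd \<sigma>)) + (y \<sigma> - eval_chain e (bd \<sigma>)))"
      by (rule dvd_add[OF assms(3)[OF \<sigma>] dvd_add[OF d[rule_format, OF \<sigma>] e[rule_format, OF \<sigma>]]])
    moreover have "(z \<sigma> - (x \<sigma> + y \<sigma>)) + ((x \<sigma> - eval_chain d (bd \<sigma>)) + (y \<sigma> - eval_chain e (bd \<sigma>))) =
        z \<sigma> - eval_chain (\<lambda>\<tau>. d \<tau> + e \<tau>) (bd \<sigma>)" by (simp add: eval_chain_fun_add)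
    ultimately show ?thesis by (simp only:)
  qed
  note * = ballI[OF this]
  show ?thesis unfolding coboundary_mod_def by (rule exI) (rule *)
qed

lemma coboundary_mod_pullback:
  assumes "coboundary_mod n (nerve \<U>) x"
    and f: "\<And>W. W \<in> \<W> \<Longrightarrow> f W \<in> \<U> \<and> W \<subseteq> f W"
  shows "coboundary_mod n (nerve \<W>) (\<lambda>\<sigma>. x (map f \<sigma>))"
proof -
  obtain d where d: "\<forall>\<sigma>\<in>ordered_simplices n (nerve \<U>). int p dvd x \<sigma> - eval_chain d (bd \<sigma>)"
    using assms(1) unfolding coboundary_mod_def by blast
  have "int p dvd x (map f \<sigma>) - eval_chain (\<lambda>\<tau>. d (map f \<tau>)) (bd \<sigma>)" if \<sigma>: "\<sigma> \<in> ordered_simplices n (nerve \<W>)" for \<sigma>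
  proof -
    have s: "length \<sigma> = Suc n" "set \<sigma> \<in> nerve \<W>" using \<sigma> by (auto simp: ordered_simplices_def)
    then obtain \<xi> where \<xi>: "\<xi> \<in> \<Inter>(set \<sigma>)" "set \<sigma> \<subseteq> \<W>" by (auto simp: nerve_def)
    have "f ` set \<sigma> \<in> nerve \<U>"
      by (rule nerveI[of _ _ \<xi>]) (use f \<xi> s(1) in auto)
    then have "map f \<sigma> \<in> ordered_simplices n (nerve \<U>)" using s by (simp add: ordered_simplices_def)
    with d have "int p dvd x (map f \<sigma>) - eval_chain d (bd (map f \<sigma>))" by blast
    then show ?thesis by (simp add: eval_chain_map_bd)
  qed
  note * = ballI[OF this]
  show ?thesis unfolding coboundary_mod_def by (rule exI) (rule *)
qed

text \<open>A common point \<open>\<xi>\<close> of the members of a simplex lies in all their images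
  under \<open>f\<close> and \<open>g\<close>, so the prism between the two stays in the nerve of
  \<open>\<U>\<close>, where \<open>c\<close> is a cocycle.\<close>

lemma coboundary_mod_contiguous:
  assumes c: "cocycle_mod n (nerve \<U>) c"
    and f: "\<And>W. W \<in> \<W> \<Longrightarrow> f W \<in> \<U> \<and> W \<subseteq> f W" and g: "\<And>W. W \<in> \<W> \<Longrightarrow> g W \<in> \<U> \<and> W \<subseteq> g W"
  shows "coboundary_mod n (nerve \<W>) (\<lambda>\<sigma>. c (map f \<sigma>) - c (map g \<sigma>))"
proof -
  obtain P where P': "\<forall>\<sigma>. Poly_Mapping.keys (P \<sigma>) \<subseteq>
        {\<tau>. set \<tau> \<subseteq> f ` set \<sigma> \<union> g ` set \<sigma> \<and> length \<tau> = Suc (length \<sigma>)} \<and>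
      Bd (P \<sigma>) = (frag_of (map f \<sigma>) - frag_of (map g \<sigma>)) - frag_extend P (bd \<sigma>)"
    by (rule exE[OF contiguous_chain_homotopy[of f g]]) (rule that)
  note P = P'[THEN spec, THEN conjunct1] P'[THEN spec, THEN conjunct2]
  have "int p dvd c (map f \<sigma>) - c (map g \<sigma>) - eval_chain (\<lambda>\<tau>. eval_chain c (P \<tau>)) (bd \<sigma>)"
    if \<sigma>: "\<sigma> \<in> ordered_simplices n (nerve \<W>)" for \<sigma>
  proof -
    have s: "length \<sigma> = Suc n" "set \<sigma> \<in> nerve \<W>" using \<sigma> by (auto simp: ordered_simplices_def)
    then obtain \<xi> where \<xi>: "\<xi> \<in> \<Inter>(set \<sigma>)" "set \<sigma> \<subseteq> \<W>" by (auto simp: nerve_def)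
    have "int p dvd eval_chain c (bd \<tau>)" if "\<tau> \<in> Poly_Mapping.keys (P \<sigma>)" for \<tau>
    proof -
      have \<tau>: "set \<tau> \<subseteq> f ` set \<sigma> \<union> g ` set \<sigma>" "length \<tau> = Suc (Suc n)" using P(1)[of \<sigma>] that s by auto
      have "set \<tau> \<in> nerve \<U>"
      proof (rule nerveI[of _ _ \<xi>])
        show "set \<tau> \<noteq> {}" using \<tau>(2) by auto
        show "set \<tau> \<subseteq> \<U>" using \<tau>(1) f g \<xi>(2) by blast
        show "\<xi> \<in> U" if U: "U \<in> set \<tau>" for U
        proof -
          obtain W where "W \<in> set \<sigma>" "U = f W \<or> U = g W" using \<tau>(1) U by blast
          moreover from this have "W \<in> \<W>" "\<xi> \<in> W" using \<xi> by auto
          ultimately show ?thesis using f[of W] g[of W] by blast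
        qed
      qed simp
      with \<tau> c show ?thesis by (simp add: cocycle_mod_def ordered_simplices_def)
    qed
    then have "int p dvd eval_chain c (Bd (P \<sigma>))"
      unfolding Bd_def eval_chain_frag_extend by (rule eval_chain_dvd)
    then show ?thesis by (simp add: P(2) eval_chain_frag_extend)
  qed
  note * = ballI[OF this]
  show ?thesis unfolding coboundary_mod_def by (rule exI) (rule *)
qed

lemma subgroup_coboundaries:
  "subgroup (coboundaries (Suc k) (nerve \<U>) Zp) (cochain_group (Suc k) (nerve \<U>) Zp)"
proof -
  let ?C = "cochain_group (Suc k) (nerve \<U>) Zp" and ?B = "coboundaries (Suc k) (nerve \<U>) Zp"
  interpret C: group ?C by (rule group_cochain_group)
  show ?thesis
  proof (rule C.subgroupI)
    show "?B \<subseteq> carrier ?C" using coboundaries_iff by blast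
    have "coboundary_mod (Suc k) (nerve \<U>) (one ?C)"
      unfolding coboundary_mod_def
      by (intro exI[of _ "\<lambda>_. 0"] ballI) (simp add: cochain_group_def eval_chain_bd)
    then show "?B \<noteq> {}" using coboundaries_iff[of "one ?C"] by blast
    fix x assume x: "x \<in> ?B"
    then obtain d where d: "\<forall>\<sigma>\<in>ordered_simplices (Suc k) (nerve \<U>). int p dvd x \<sigma> - eval_chain d (bd \<sigma>)"
      and xC: "x \<in> carrier ?C" unfolding coboundaries_iff coboundary_mod_def by blast
    have "int p dvd (inv\<^bsub>?C\<^esub> x) \<sigma> - eval_chain (\<lambda>\<tau>. - d \<tau>) (bd \<sigma>)"
      if \<sigma>: "\<sigma> \<in> ordered_simplices (Suc k) (nerve \<U>)" for \<sigma>
    proof -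
      have "int p dvd ((inv\<^bsub>?C\<^esub> x) \<sigma> - (- x \<sigma>)) - (x \<sigma> - eval_chain d (bd \<sigma>))"
        by (rule dvd_diff[OF inv_cochain_dvd[OF xC \<sigma>] d[rule_format, OF \<sigma>]])
      then show ?thesis by (simp add: eval_chain_fun_minus algebra_simps)
    qed
    then have "coboundary_mod (Suc k) (nerve \<U>) (inv\<^bsub>?C\<^esub> x)" unfolding coboundary_mod_def by blast
    then show "inv\<^bsub>?C\<^esub> x \<in> ?B" using xC by (simp add: coboundaries_iff)
    fix y assume y: "y \<in> ?B"
    have "coboundary_mod (Suc k) (nerve \<U>) (x \<otimes>\<^bsub>?C\<^esub> y)"
      by (rule coboundary_mod_add[of _ _ x y])
        (use x y in \<open>simp_all add: coboundaries_iff mult_cochain_group mod_eq_dvd_iff[symmetric]\<close>)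
    then show "x \<otimes>\<^bsub>?C\<^esub> y \<in> ?B" using x y by (simp add: coboundaries_iff)
  qed
qed

lemma coboundaries_in_cohomology:
  "coboundaries (Suc k) (nerve \<U>) Zp \<in> carrier (cohomology_group (Suc k) (nerve \<U>) Zp)"
proof -
  let ?C = "cochain_group (Suc k) (nerve \<U>) Zp" and ?B = "coboundaries (Suc k) (nerve \<U>) Zp"
  interpret C: group ?C by (rule group_cochain_group)
  have "?B \<subseteq> carrier ?C" using subgroup_coboundaries by (rule subgroup.subset)
  then have "?B #>\<^bsub>?C\<^esub> one ?C = ?B" by (rule C.coset_mult_one)
  moreover have "one ?C \<in> carrier (subgroup_generated ?C (cocycles (Suc k) (nerve \<U>) Zp))"
    by (simp add: carrier_subgroup_generated generate.one)
  ultimately show ?thesis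
    unfolding cohomology_group_def carrier_FactGroup by force
qed

text \<open>\<open>van\<close> kills the class along some projection \<open>\<pi>\<close>, while the
  direct limit uses the chosen \<open>refinement_projection\<close>, from \<open>\<U>\<close>
  directly to each later stage \<open>\<W>\<close>. The two projections from \<open>\<W>\<close> to
  \<open>\<U>\<close> are contiguous, so the class dies along the chosen one too.\<close>

lemma cohomology_class_vanishes:
  assumes a: "a \<in> carrier (cohomology_group (Suc k) (nerve \<U>) Zp)"
    and van: "\<And>c. cocycle_mod (Suc k) (nerve \<U>) c \<Longrightarrow> \<exists>\<V>\<in>\<O>. cover_refines \<V> \<U> \<and>
      (\<exists>\<pi>. (\<forall>V\<in>\<V>. \<pi> V \<in> \<U> \<and> V \<subseteq> \<pi> V) \<and> coboundary_mod (Suc k) (nerve \<V>) (\<lambda>\<sigma>. c (map \<pi> \<sigma>)))"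
  obtains \<V> where "\<V> \<in> \<O>" "cover_refines \<V> \<U>"
    "\<And>\<W>. cover_refines \<W> \<V> \<Longrightarrow> cohomology_induced (Suc k) (nerve \<W>) Zp (refinement_projection \<U> \<W>) a =
      coboundaries (Suc k) (nerve \<W>) Zp"
proof -
  let ?C = "cochain_group (Suc k) (nerve \<U>) Zp" and ?B = "coboundaries (Suc k) (nerve \<U>) Zp"
  obtain c where c: "c \<in> carrier (subgroup_generated ?C (cocycles (Suc k) (nerve \<U>) Zp))" "a = ?B #>\<^bsub>?C\<^esub> c"
    using a unfolding cohomology_group_def carrier_FactGroup by auto
  have cz: "c \<in> carrier ?C" "cocycle_mod (Suc k) (nerve \<U>) c" using generate_cocycles[OF c(1)] by simp_all
  obtain \<V> \<pi> where \<V>: "\<V> \<in> \<O>" "cover_refines \<V> \<U>" "\<And>V. V \<in> \<V> \<Longrightarrow> \<pi> V \<in> \<U> \<and> V \<subseteq> \<pi> V"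
    "coboundary_mod (Suc k) (nerve \<V>) (\<lambda>\<sigma>. c (map \<pi> \<sigma>))"
    using van[OF cz(2)] by blast
  have "cohomology_induced (Suc k) (nerve \<W>) Zp (refinement_projection \<U> \<W>) a = coboundaries (Suc k) (nerve \<W>) Zp"
    if \<W>: "cover_refines \<W> \<V>" for \<W>
  proof -
    let ?CW = "cochain_group (Suc k) (nerve \<W>) Zp" and ?BW = "coboundaries (Suc k) (nerve \<W>) Zp"
    interpret CW: group ?CW by (rule group_cochain_group)
    define f where "f = refinement_projection \<U> \<W>"
    define r where "r = refinement_projection \<V> \<W>"
    have proj: "refinement_projection A \<W> W \<in> A \<and> W \<subseteq> refinement_projection A \<W> W"
      if "cover_refines \<W> A" "W \<in> \<W>" for A W
    proof -
      have "\<exists>\<pi>. \<forall>V\<in>\<W>. \<pi> V \<in> A \<and> V \<subseteq> \<pi> V"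
        using that(1) unfolding cover_refines_def by metis
      from someI_ex[OF this] that(2) show ?thesis unfolding refinement_projection_def by blast
    qed
    have "cover_refines \<W> \<U>" using \<W> \<V>(2) unfolding cover_refines_def by (meson order_trans)
    then have f: "\<And>W. W \<in> \<W> \<Longrightarrow> f W \<in> \<U> \<and> W \<subseteq> f W" unfolding f_def by (rule proj)
    have r: "\<And>W. W \<in> \<W> \<Longrightarrow> r W \<in> \<V> \<and> W \<subseteq> r W" unfolding r_def using \<W> by (rule proj)
    have \<pi>r: "\<And>W. W \<in> \<W> \<Longrightarrow> \<pi> (r W) \<in> \<U> \<and> W \<subseteq> \<pi> (r W)" using r \<V>(3) by blast
    have 1: "coboundary_mod (Suc k) (nerve \<W>) (\<lambda>\<sigma>. c (map (\<lambda>W. \<pi> (r W)) \<sigma>))"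
      using coboundary_mod_pullback[OF \<V>(4) r] by (simp add: comp_def)
    have 2: "coboundary_mod (Suc k) (nerve \<W>) (\<lambda>\<sigma>. c (map f \<sigma>) - c (map (\<lambda>W. \<pi> (r W)) \<sigma>))"
      by (rule coboundary_mod_contiguous[OF cz(2) f \<pi>r])
    have 3: "coboundary_mod (Suc k) (nerve \<W>) (\<lambda>\<sigma>. c (map f \<sigma>))"
      by (rule coboundary_mod_add[OF 1 2]) simp
    \<comment> \<open>The induced map is a union over all representatives of the class; each of them
      contributes the trivial coset.\<close>
    have "?BW #>\<^bsub>?CW\<^esub> cochain_pullback (Suc k) (nerve \<W>) f x = ?BW" if x: "x \<in> a" for x
    proof -
      obtain h where h: "h \<in> ?B" "x = h \<otimes>\<^bsub>?C\<^esub> c" using x c(2) by (auto simp: r_coset_def)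
      have hm: "coboundary_mod (Suc k) (nerve \<U>) h" using h(1) by (simp add: coboundaries_iff)
      have 4: "coboundary_mod (Suc k) (nerve \<W>) (\<lambda>\<sigma>. h (map f \<sigma>))"
        by (rule coboundary_mod_pullback[OF hm f])
      let ?y = "cochain_pullback (Suc k) (nerve \<W>) f x"
      have fs: "map f \<sigma> \<in> ordered_simplices (Suc k) (nerve \<U>)" if \<sigma>: "\<sigma> \<in> ordered_simplices (Suc k) (nerve \<W>)" for \<sigma>
      proof -
        have s: "length \<sigma> = Suc (Suc k)" "set \<sigma> \<in> nerve \<W>" using \<sigma> by (auto simp: ordered_simplices_def)
        then obtain \<xi> where \<xi>: "\<xi> \<in> \<Inter>(set \<sigma>)" "set \<sigma> \<subseteq> \<W>" by (auto simp: nerve_def)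
        have "f ` set \<sigma> \<in> nerve \<U>" by (rule nerveI[of _ _ \<xi>]) (use f \<xi> s(1) in auto)
        then show ?thesis using s by (simp add: ordered_simplices_def)
      qed
      have yv: "?y \<sigma> = (h (map f \<sigma>) + c (map f \<sigma>)) mod int p" if "\<sigma> \<in> ordered_simplices (Suc k) (nerve \<W>)" for \<sigma>
        using that fs[OF that] by (simp add: cochain_pullback_def h(2) mult_cochain_group)
      have "coboundary_mod (Suc k) (nerve \<W>) ?y"
        by (rule coboundary_mod_add[OF 4 3]) (simp add: yv mod_eq_dvd_iff[symmetric])
      moreover have "?y \<in> carrier ?CW"
        unfolding carrier_cochain_group
      proof (rule PiE_I)
        show "?y \<sigma> \<in> {0..<int p}" if "\<sigma> \<in> ordered_simplices (Suc k) (nerve \<W>)" for \<sigma>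
          using yv[OF that] p by simp
      qed (simp add: cochain_pullback_def)
      ultimately have "?y \<in> ?BW" by (simp add: coboundaries_iff)
      then show ?thesis using \<open>?y \<in> carrier ?CW\<close> subgroup_coboundaries by (intro CW.coset_join2)
    qed
    \<comment> \<open>A union over no representatives would be empty instead of the trivial
      coset.\<close>
    moreover have "a \<noteq> {}"
    proof -
      have "?B \<noteq> {}" using subgroup.one_closed[OF subgroup_coboundaries] by blast
      then show ?thesis unfolding c(2) r_coset_def by blast
    qed
    ultimately show ?thesis unfolding cohomology_induced_def f_def[symmetric] by auto
  qed
  with \<V>(1,2) show thesis by (rule that)
qed

end

text \<open>If any two elements become trivial at a common later stage, the limit relation
  identifies everything and a single class is left. Unit and product are unions of classes, so both
  are this class.\<close>

lemma trivial_direct_limit: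
  assumes "I \<noteq> {}" and one: "\<And>i. i \<in> I \<Longrightarrow> one (H i) \<in> carrier (H i)"
    and mult: "\<And>i. i \<in> I \<Longrightarrow> one (H i) \<otimes>\<^bsub>H i\<^esub> one (H i) = one (H i)"
    and van: "\<And>i j a b. i \<in> I \<Longrightarrow> j \<in> I \<Longrightarrow> a \<in> carrier (H i) \<Longrightarrow> b \<in> carrier (H j) \<Longrightarrow>
      \<exists>k\<in>I. prec i k \<and> prec j k \<and> \<phi> i k a = one (H k) \<and> \<phi> j k b = one (H k)"
  shows "trivial_group (direct_limit I prec H \<phi>)"
proof -
  define R where "R = direct_limit_rel I prec H \<phi>"
  define S where "S = (SIGMA i:I. carrier (H i))"
  have R: "(x, y) \<in> R \<longleftrightarrow> x \<in> S \<and> y \<in> S" for x y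
  proof -
    obtain i a j b where xy: "x = (i, a)" "y = (j, b)" by (cases x, cases y)
    show ?thesis
      using van[of i j a b] unfolding R_def direct_limit_rel_def S_def xy by fastforce
  qed
  then have RS: "R `` {x} = (if x \<in> S then S else {})" for x by (simp add: set_eq_iff R Image_singleton_iff)
  obtain i0 where i0: "i0 \<in> I" using assms(1) by blast
  have S1: "(i, one (H i)) \<in> S" if "i \<in> I" for i using one[OF that] that by (simp add: S_def)
  let ?D = "direct_limit I prec H \<phi>"
  have "S // R = {S}"
    unfolding quotient_def using S1[OF i0] by (auto simp: RS)
  then have carr: "carrier ?D = {S}"
    unfolding direct_limit_def Let_def R_def[symmetric] S_def by simp
  have "(\<Union>i\<in>I. R `` {(i, one (H i))}) = S" using S1 i0 by (auto simp: RS)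
  then have oneD: "one ?D = S" unfolding direct_limit_def Let_def R_def[symmetric] by simp
  have "S \<otimes>\<^bsub>?D\<^esub> S = (\<Union>(i, a)\<in>S. \<Union>(j, b)\<in>S. \<Union>k\<in>{k\<in>I. prec i k \<and> prec j k}.
                 R `` {(k, \<phi> i k a \<otimes>\<^bsub>H k\<^esub> \<phi> j k b)})" (is "_ = ?M")
    unfolding direct_limit_def Let_def R_def[symmetric] by simp
  also have "?M = S"
  proof
    show "?M \<subseteq> S" by (auto simp: RS split: if_splits)
    obtain k where k: "k \<in> I" "prec i0 k" "\<phi> i0 k (one (H i0)) = one (H k)"
      using van[OF i0 i0 one[OF i0] one[OF i0]] by blast
    have "S \<subseteq> R `` {(k, \<phi> i0 k (one (H i0)) \<otimes>\<^bsub>H k\<^esub> \<phi> i0 k (one (H i0)))}"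
      unfolding k(3) mult[OF k(1)] RS using S1[OF k(1)] by simp
    then show "S \<subseteq> ?M" using S1[OF i0] k(1,2) by blast
  qed
  finally have multD: "S \<otimes>\<^bsub>?D\<^esub> S = S" .
  have "group ?D"
    by (rule groupI) (auto simp: carr oneD multD)
  then show ?thesis by (simp add: trivial_group_def carr oneD)
qed

lemma common_refinement:
  assumes "\<U> \<in> open_covers T" "\<V> \<in> open_covers T"
  obtains \<W> where "\<W> \<in> open_covers T" "cover_refines \<W> \<U>" "cover_refines \<W> \<V>"
proof (rule that[of "{U \<inter> V |U V. U \<in> \<U> \<and> V \<in> \<V>}"])
  have "\<Union>{U \<inter> V |U V. U \<in> \<U> \<and> V \<in> \<V>} = \<Union>\<U> \<inter> \<Union>\<V>" by blast
  then show "{U \<inter> V |U V. U \<in> \<U> \<and> V \<in> \<V>} \<in> open_covers T"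
    using assms unfolding open_covers_def by auto
qed (auto simp: cover_refines_def)

lemma cocycles_vanish_on_refinement:
  fixes X :: "'a metric"
  assumes "proper_metric X" "uniformly_contractible X" "asdim_le X D" and p: "0 < p" and n: "0 < n"
    and \<U>: "\<U> \<in> open_covers (higson_compactification X)" and c: "cocycle_mod p n (nerve \<U>) c"
  shows "\<exists>\<V>\<in>open_covers (higson_compactification X). cover_refines \<V> \<U> \<and>
      (\<exists>\<pi>. (\<forall>V\<in>\<V>. \<pi> V \<in> \<U> \<and> V \<subseteq> \<pi> V) \<and> coboundary_mod p n (nerve \<V>) (\<lambda>\<sigma>. c (map \<pi> \<sigma>)))"
proof (cases "mspace X = {}")
  case True
  \<comment> \<open>Over the empty space all members of a cover are empty, so the nerve has no
    simplices and every cochain is a coboundary.\<close>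
  then have "topspace (higson_compactification X) = {}"
    using topspace_higson_dense[of X] by simp
  then have "U = {}" if "U \<in> \<U>" for U using \<U> that by (auto simp: open_covers_def)
  then have "nerve \<U> = {}" by (auto simp: nerve_def)
  then have "coboundary_mod p n (nerve \<U>) (\<lambda>\<sigma>. c (map (\<lambda>U. U) \<sigma>))"
    by (simp add: coboundary_mod_def[OF p] ordered_simplices_def)
  then show ?thesis using \<U> by (intro bexI[of _ \<U>] conjI exI[of _ "\<lambda>U. U"]) (auto simp: cover_refines_def)
next
  case False
  have m: "0 < int p" using p by simp
  have coc: "int p dvd eval_chain c (bd \<sigma>)" if "length \<sigma> = n + 2" "set \<sigma> \<in> nerve \<U>" for \<sigma>
    using c that unfolding cocycle_mod_def[OF p] by (simp add: ordered_simplices_def)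
  obtain \<V> \<pi> d where \<V>: "\<V> \<in> open_covers (higson_compactification X)"
    and \<pi>: "\<And>V. V \<in> \<V> \<Longrightarrow> \<pi> V \<in> \<U> \<and> V \<subseteq> \<pi> V"
    and d: "\<And>\<sigma>. length \<sigma> = n + 1 \<Longrightarrow> set \<sigma> \<in> nerve \<V> \<Longrightarrow> int p dvd c (map \<pi> \<sigma>) - eval_chain d (bd \<sigma>)"
    by (rule cech_cocycle_trivial[OF assms(1-3) False m n \<U> coc]) (assumption | rule that)+
  have "coboundary_mod p n (nerve \<V>) (\<lambda>\<sigma>. c (map \<pi> \<sigma>))"
    unfolding coboundary_mod_def[OF p] using d by (intro exI[of _ d]) (simp add: ordered_simplices_def)
  moreover have "cover_refines \<V> \<U>" using \<pi> unfolding cover_refines_def by blast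
  ultimately show ?thesis using \<V> \<pi> by blast
qed

theorem theorem3p3:
  fixes X :: "'a metric" and n p :: nat
  assumes "proper_metric X"
    and "uniformly_contractible X"
    and "asdim X < \<infinity>"
    and "n \<ge> 1"
    and "prime p"
  shows "trivial_group (cech_cohomology n (higson_compactification X) (integer_mod_group p))"
proof -
  have p: "0 < p" using assms(5) by (simp add: prime_gt_0_nat)
  obtain k where n: "n = Suc k" using assms(4) by (cases n) auto
  let ?T = "higson_compactification X"
  \<comment> \<open>The infimum over an empty set of dimensions is infinite.\<close>
  obtain D where D: "asdim_le X D"
  proof (rule ccontr)
    assume "\<not> thesis"
    then have "{n. asdim_le X n} = {}" using that by blast
    then have "asdim X = \<infinity>" by (simp add: asdim_def top_enat_def)
    with assms(3) show False by simp
  qed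
  show ?thesis
    unfolding cech_cohomology_def n
  proof (rule trivial_direct_limit)
    have "{topspace ?T} \<in> open_covers ?T" by (simp add: open_covers_def)
    then show "open_covers ?T \<noteq> {}" by blast
  next
    fix \<U> :: "(('a \<Rightarrow> real) \<Rightarrow> real) set set"
    have 1: "one (cohomology_group (Suc k) (nerve \<U>) (integer_mod_group p)) =
        coboundaries (Suc k) (nerve \<U>) (integer_mod_group p)" for \<U> :: "(('a \<Rightarrow> real) \<Rightarrow> real) set set"
      by (simp add: cohomology_group_def)
    show "one (cohomology_group (Suc k) (nerve \<U>) (integer_mod_group p)) \<in>
        carrier (cohomology_group (Suc k) (nerve \<U>) (integer_mod_group p))"
      unfolding 1 by (rule coboundaries_in_cohomology[OF p])
    show "one (cohomology_group (Suc k) (nerve \<U>) (integer_mod_group p))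
        \<otimes>\<^bsub>cohomology_group (Suc k) (nerve \<U>) (integer_mod_group p)\<^esub>
        one (cohomology_group (Suc k) (nerve \<U>) (integer_mod_group p)) =
        one (cohomology_group (Suc k) (nerve \<U>) (integer_mod_group p))"
      unfolding 1
      unfolding cohomology_group_def
      by (simp add: group.subgroup_mult_id[OF group_cochain_group[OF p] subgroup_coboundaries[OF p]])
    fix \<V> :: "(('a \<Rightarrow> real) \<Rightarrow> real) set set" and a b
    assume \<U>: "\<U> \<in> open_covers ?T" and \<V>: "\<V> \<in> open_covers ?T"
      and a: "a \<in> carrier (cohomology_group (Suc k) (nerve \<U>) (integer_mod_group p))"
      and b: "b \<in> carrier (cohomology_group (Suc k) (nerve \<V>) (integer_mod_group p))"
    note van = cocycles_vanish_on_refinement[OF assms(1,2) D p zero_less_Suc]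
    obtain \<U>' where \<U>': "\<U>' \<in> open_covers ?T" "cover_refines \<U>' \<U>"
      "\<And>\<W>. cover_refines \<W> \<U>' \<Longrightarrow> cohomology_induced (Suc k) (nerve \<W>) (integer_mod_group p) (refinement_projection \<U> \<W>) a =
      coboundaries (Suc k) (nerve \<W>) (integer_mod_group p)"
      by (rule cohomology_class_vanishes[OF p a van[OF \<U>]]) (assumption | rule that)+
    obtain \<V>' where \<V>': "\<V>' \<in> open_covers ?T" "cover_refines \<V>' \<V>"
      "\<And>\<W>. cover_refines \<W> \<V>' \<Longrightarrow> cohomology_induced (Suc k) (nerve \<W>) (integer_mod_group p) (refinement_projection \<V> \<W>) b =
      coboundaries (Suc k) (nerve \<W>) (integer_mod_group p)"
      by (rule cohomology_class_vanishes[OF p b van[OF \<V>]]) (assumption | rule that)+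
    \<comment> \<open>Each class dies on every refinement of its own cover, so a common refinement
      serves both.\<close>
    obtain \<W> where \<W>: "\<W> \<in> open_covers ?T" "cover_refines \<W> \<U>'" "cover_refines \<W> \<V>'"
      by (rule common_refinement[OF \<U>'(1) \<V>'(1)])
    have "cover_refines \<W> \<U>" "cover_refines \<W> \<V>"
      using \<W>(2,3) \<U>'(2) \<V>'(2) unfolding cover_refines_def by (meson order_trans)+
    with \<W> \<U>'(3)[OF \<W>(2)] \<V>'(3)[OF \<W>(3)]
    show "\<exists>\<W>\<in>open_covers ?T. cover_refines \<W> \<U> \<and> cover_refines \<W> \<V> \<and>
      cohomology_induced (Suc k) (nerve \<W>) (integer_mod_group p) (refinement_projection \<U> \<W>) a =
        one (cohomology_group (Suc k) (nerve \<W>) (integer_mod_group p)) \<and>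
      cohomology_induced (Suc k) (nerve \<W>) (integer_mod_group p) (refinement_projection \<V> \<W>) b =
        one (cohomology_group (Suc k) (nerve \<W>) (integer_mod_group p))"
      unfolding 1 by blast
  qed
qed

end
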